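(* The model-checking problem for $\mathrm{RB}\pm\mathrm{ATL}^{\#}$ (given a resource-bounded concurrent game structure with diminishing resource $M$, a state $s$ of $M$, and an $\mathrm{RB}\pm\mathrm{ATL}^{\#}$ formula $\phi$ over the agents, resource types and propositions of $M$, decide whether $M,s\models\phi$) is decidable in PSPACE, provided the resource bounds occurring in $\phi$ are written in unary.
   Context: **Models.** A resource-bounded concurrent game structure with diminishing resource (RB-CGS$^\#$) is a tuple $M=(Agt,Res,S,\Pi,\pi,Act,d,c,\delta)$ where: $Agt=\{a_1,\dots,a_n\}$ is a non-empty finite set of agents; $Res=\{res_1,\dots,res_r\}$ is a non-empty finite set of resource types, the first of which is the distinguished diminishing resource; $S$ is a non-empty finite set of states; $\Pi$ is a finite set of propositions and $\pi:\Pi\to\wp(S)$; $Act$ is a non-empty finite set of actions; $d:S\times Agt\to\wp(Act)\setminus\{\emptyset\}$ gives the actions available to each agent at each state, and $D(s)=d(s,a_1)\times\cdots\times d(s,a_n)$; $c:S\times Act\to\mathbb{Z}^r$ is a partial function (defined for available actions) whose $i$-th component is the consumption (negative) or production (positive) of resource $i$, and the first component of $c(s,\sigma)$ is always at most $-1$; $\delta:S\times Act^{|Agt|}\to S$ is a partial function giving a successor state for every $s$ and $\sigma\in D(s)$. Models are given as explicit finite inputs. **Costs.** $\mathsf{prod}(s,\sigma)$ is $c(s,\sigma)$ with negative entries replaced by $0$; $\mathsf{cons}(s,\sigma)=(|\min(0,c_1(s,\sigma))|,\dots,|\min(0,c_r(s,\sigma))|)$. For a coalition $A\subseteq Agt$,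 $D_A(s)$ is the set of joint actions $\sigma=(\sigma_a)_{a\in A}$ with $\sigma_a\in d(s,a)$; $\mathsf{cons}(s,\sigma)=(\mathsf{cons}(s,\sigma_a))_{a\in A}$ and $\mathsf{prod}(s,\sigma)=(\mathsf{prod}(s,\sigma_a))_{a\in A}$. Vectors are compared and added pointwise. For $\sigma\in D_A(s)$, $out(s,\sigma)=\{s'\mid \exists\sigma'\in D(s):\ \sigma'_A=\sigma,\ s'=\delta(s,\sigma')\}$, where $\sigma'_A$ is the restriction of $\sigma'$ to $A$. **Syntax.** A resource bound for $A$ is $b\in\mathcal{B}_A$, assigning to each $a\in A$ a vector $b_a\in\mathbb{N}^r$. Formulas: $\phi,\psi::=p\mid\neg\phi\mid\phi\vee\psi\mid\langle\!\langle A^b\rangle\!\rangle\bigcirc\phi\mid\langle\!\langle A^b\rangle\!\rangle\phi\,\mathcal{U}\,\psi\mid\langle\!\langle A^b\rangle\!\rangle\phi\,\mathcal{R}\,\psi$, with $p\in\Pi$, $A\subseteq Agt$, $b\in\mathcal{B}_A$. **Strategies and computations.** A computation is $\lambda\in S^+$ (finite non-empty sequence of states), $\lambda[i]$ its $i$-th element, $\lambda[i,j]$ the segment from $i$ to $j$, $|\lambda|$ its length. A strategy for $A$ is a map $F_A:S^+\to Act^{|A|}$ with $F_A(\lambda)\in D_A(\lambda[|\lambda|])$. $\lambda$ is consistent with $F_A$ if $\lambda[i+1]\in out(\lambda[i],F_A(\lambda[1,i]))$ for all $1\le i<|\lambda|$. It is $b$-consistent with $F_A$ if moreover $\mathsf{cons}(\lambda[i],F_A(\lambda[1,i]))\le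 e_A(\lambda[i])$ for all $1\le i<|\lambda|$, where $e_A(\lambda[1])=b$ and $e_A(\lambda[i+1])=e_A(\lambda[i])-\mathsf{cons}(\lambda[i],F_A(\lambda[1,i]))+\mathsf{prod}(\lambda[i],F_A(\lambda[1,i]))$. It is $b$-maximal if it is $b$-consistent and cannot be extended further while remaining $b$-consistent (the next action prescribed by $F_A$ would violate $b$-consistency). $out(s,F_A,b)$ is the set of all $b$-maximal computations starting from $s$ that are $b$-consistent with $F_A$. **Semantics.** Propositions ($M,s\models p$ iff $s\in\pi(p)$), $\neg$, $\vee$ as usual. - $M,s\models\langle\!\langle A^b\rangle\!\rangle\bigcirc\phi$ iff there is a strategy $F_A$ such that for all $\lambda\in out(s,F_A,b)$: $|\lambda|\ge2$ and $M,\lambda[2]\models\phi$. - $M,s\models\langle\!\langle A^b\rangle\!\rangle\phi\,\mathcal{U}\,\psi$ iff there is $F_A$ such that for all $\lambda\in out(s,F_A,b)$ there is $1\le i\le|\lambda|$ with $M,\lambda[i]\models\psi$ and $M,\lambda[j]\models\phi$ for all $1\le j<i$. - $M,s\models\langle\!\langle A^b\rangle\!\rangle\phi\,\mathcal{R}\,\psi$ iff there is $F_A$ such that for all $\lambda\in out(s,F_A,b)$, either there is $1\le i\le|\lambda|$ with $M,\lambda[i]\models\phi$ and $M,\lambda[j]\models\psi$ for all $1\le j\le i$, or $M,\lambda[j]\models\psi$ for all $1\le j\le|\lambda|$. *)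

theory Defs
  imports Main "HOL-Library.FuncSet" "HOL-Computational_Algebra.Polynomial"
begin

section \<open>Resource-bounded concurrent game structures with diminishing resource\<close>

text \<open>
  The resource types are the indices \<open>0, \<dots>, nres - 1\<close>; index 0 is the diminishing resource.
  Vectors over the resources are functions on \<open>nat\<close> of which only the values at these indices
  matter.  The functions below are total; neither the semantics nor the encoding looks at the
  values of \<open>cost\<close> for unavailable actions, of \<open>delta\<close> for unavailable joint actions, or of
  \<open>val\<close> and \<open>avail\<close> outside the given sets.
\<close>

record ('a, 's, 'p, 'x) cgs =
  Agt :: "'a set"
  nres :: nat
  St :: "'s set"
  Props :: "'p set"
  val :: "'p \<Rightarrow> 's set"
  Act :: "'x set"
  avail :: "'s \<Rightarrow> 'a \<Rightarrow> 'x set"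
  cost :: "'s \<Rightarrow> 'x \<Rightarrow> nat \<Rightarrow> int"
  delta :: "'s \<Rightarrow> ('a \<Rightarrow> 'x) \<Rightarrow> 's"

definition joint_actions :: "('a, 's, 'p, 'x) cgs \<Rightarrow> 'a set \<Rightarrow> 's \<Rightarrow> ('a \<Rightarrow> 'x) set" where
  "joint_actions M A s = (\<Pi>\<^sub>E a\<in>A. avail M s a)"

definition rb_cgs :: "('a, 's, 'p, 'x) cgs \<Rightarrow> bool" where
  "rb_cgs M \<longleftrightarrow>
     finite (Agt M) \<and> Agt M \<noteq> {} \<and>
     nres M \<ge> 1 \<and>
     finite (St M) \<and> St M \<noteq> {} \<and>
     finite (Props M) \<and> (\<forall>p\<in>Props M. val M p \<subseteq> St M) \<and>
     finite (Act M) \<and> Act M \<noteq> {} \<and>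
     (\<forall>s\<in>St M. \<forall>a\<in>Agt M. avail M s a \<subseteq> Act M \<and> avail M s a \<noteq> {}) \<and>
     (\<forall>s\<in>St M. \<forall>a\<in>Agt M. \<forall>x\<in>avail M s a. cost M s x 0 \<le> -1) \<and>
     (\<forall>s\<in>St M. \<forall>\<sigma>\<in>joint_actions M (Agt M) s. delta M s \<sigma> \<in> St M)"

definition consumed :: "('a, 's, 'p, 'x) cgs \<Rightarrow> 's \<Rightarrow> 'x \<Rightarrow> nat \<Rightarrow> int" where
  "consumed M s x i = \<bar>min 0 (cost M s x i)\<bar>"

definition produced :: "('a, 's, 'p, 'x) cgs \<Rightarrow> 's \<Rightarrow> 'x \<Rightarrow> nat \<Rightarrow> int" where
  "produced M s x i = max 0 (cost M s x i)"

definition outcomes :: "('a, 's, 'p, 'x) cgs \<Rightarrow> 'a set \<Rightarrow> 's \<Rightarrow> ('a \<Rightarrow> 'x) \<Rightarrow> 's set" where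
  "outcomes M A s \<sigma> =
     {delta M s \<sigma>' | \<sigma>'. \<sigma>' \<in> joint_actions M (Agt M) s \<and> restrict \<sigma>' A = \<sigma>}"


section \<open>Strategies and computations\<close>

text \<open>Computations are non-empty lists of states, so positions are counted from 0.\<close>

definition strategy ::
  "('a, 's, 'p, 'x) cgs \<Rightarrow> 'a set \<Rightarrow> ('s list \<Rightarrow> 'a \<Rightarrow> 'x) \<Rightarrow> bool" where
  "strategy M A F \<longleftrightarrow>
     (\<forall>l\<in>lists (St M). l \<noteq> [] \<longrightarrow> F l \<in> joint_actions M A (last l))"

definition consistent ::
  "('a, 's, 'p, 'x) cgs \<Rightarrow> 'a set \<Rightarrow> ('s list \<Rightarrow> 'a \<Rightarrow> 'x) \<Rightarrow> 's list \<Rightarrow> bool" where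
  "consistent M A F l \<longleftrightarrow>
     l \<noteq> [] \<and> l \<in> lists (St M) \<and>
     (\<forall>i. Suc i < length l \<longrightarrow> l ! Suc i \<in> outcomes M A (l ! i) (F (take (Suc i) l)))"

primrec endowment ::
  "('a, 's, 'p, 'x) cgs \<Rightarrow> ('s list \<Rightarrow> 'a \<Rightarrow> 'x) \<Rightarrow> ('a \<Rightarrow> nat \<Rightarrow> nat) \<Rightarrow> 's list \<Rightarrow>
     nat \<Rightarrow> 'a \<Rightarrow> nat \<Rightarrow> int" where
  "endowment M F b l 0 = (\<lambda>a j. int (b a j))"
| "endowment M F b l (Suc i) =
     (\<lambda>a j. endowment M F b l i a j
        - consumed M (l ! i) (F (take (Suc i) l) a) j
        + produced M (l ! i) (F (take (Suc i) l) a) j)"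

definition b_consistent ::
  "('a, 's, 'p, 'x) cgs \<Rightarrow> 'a set \<Rightarrow> ('s list \<Rightarrow> 'a \<Rightarrow> 'x) \<Rightarrow> ('a \<Rightarrow> nat \<Rightarrow> nat) \<Rightarrow>
     's list \<Rightarrow> bool" where
  "b_consistent M A F b l \<longleftrightarrow>
     consistent M A F l \<and>
     (\<forall>i. Suc i < length l \<longrightarrow>
        (\<forall>a\<in>A. \<forall>j<nres M.
           consumed M (l ! i) (F (take (Suc i) l) a) j \<le> endowment M F b l i a j))"

definition b_maximal ::
  "('a, 's, 'p, 'x) cgs \<Rightarrow> 'a set \<Rightarrow> ('s list \<Rightarrow> 'a \<Rightarrow> 'x) \<Rightarrow> ('a \<Rightarrow> nat \<Rightarrow> nat) \<Rightarrow>
     's list \<Rightarrow> bool" where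
  "b_maximal M A F b l \<longleftrightarrow>
     b_consistent M A F b l \<and> \<not> (\<exists>s'. b_consistent M A F b (l @ [s']))"

definition out ::
  "('a, 's, 'p, 'x) cgs \<Rightarrow> 'a set \<Rightarrow> 's \<Rightarrow> ('s list \<Rightarrow> 'a \<Rightarrow> 'x) \<Rightarrow>
     ('a \<Rightarrow> nat \<Rightarrow> nat) \<Rightarrow> 's list set" where
  "out M A s F b = {l. b_maximal M A F b l \<and> hd l = s}"


section \<open>Syntax and semantics\<close>

text \<open>
  In the coalition modalities, \<open>b a j\<close> is the amount of resource \<open>j\<close> allotted to agent \<open>a\<close>;
  it is relevant only for \<open>a\<close> in the coalition.
\<close>

datatype ('a, 'p) fm =
    Prop 'p
  | Neg "('a, 'p) fm"
  | Or "('a, 'p) fm" "('a, 'p) fm"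
  | Next "'a set" "'a \<Rightarrow> nat \<Rightarrow> nat" "('a, 'p) fm"
  | Until "'a set" "'a \<Rightarrow> nat \<Rightarrow> nat" "('a, 'p) fm" "('a, 'p) fm"
  | Release "'a set" "'a \<Rightarrow> nat \<Rightarrow> nat" "('a, 'p) fm" "('a, 'p) fm"

primrec fm_over :: "('a, 's, 'p, 'x) cgs \<Rightarrow> ('a, 'p) fm \<Rightarrow> bool" where
  "fm_over M (Prop p) \<longleftrightarrow> p \<in> Props M"
| "fm_over M (Neg \<phi>) \<longleftrightarrow> fm_over M \<phi>"
| "fm_over M (Or \<phi> \<psi>) \<longleftrightarrow> fm_over M \<phi> \<and> fm_over M \<psi>"
| "fm_over M (Next A b \<phi>) \<longleftrightarrow> A \<subseteq> Agt M \<and> fm_over M \<phi>"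
| "fm_over M (Until A b \<phi> \<psi>) \<longleftrightarrow> A \<subseteq> Agt M \<and> fm_over M \<phi> \<and> fm_over M \<psi>"
| "fm_over M (Release A b \<phi> \<psi>) \<longleftrightarrow> A \<subseteq> Agt M \<and> fm_over M \<phi> \<and> fm_over M \<psi>"

primrec sat :: "('a, 's, 'p, 'x) cgs \<Rightarrow> ('a, 'p) fm \<Rightarrow> 's \<Rightarrow> bool" where
  "sat M (Prop p) = (\<lambda>s. s \<in> val M p)"
| "sat M (Neg \<phi>) = (\<lambda>s. \<not> sat M \<phi> s)"
| "sat M (Or \<phi> \<psi>) = (\<lambda>s. sat M \<phi> s \<or> sat M \<psi> s)"
| "sat M (Next A b \<phi>) = (\<lambda>s. \<exists>F. strategy M A F \<and>
     (\<forall>l\<in>out M A s F b. length l \<ge> 2 \<and> sat M \<phi> (l ! 1)))"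
| "sat M (Until A b \<phi> \<psi>) = (\<lambda>s. \<exists>F. strategy M A F \<and>
     (\<forall>l\<in>out M A s F b. \<exists>i<length l. sat M \<psi> (l ! i) \<and> (\<forall>j<i. sat M \<phi> (l ! j))))"
| "sat M (Release A b \<phi> \<psi>) = (\<lambda>s. \<exists>F. strategy M A F \<and>
     (\<forall>l\<in>out M A s F b.
        (\<exists>i<length l. sat M \<phi> (l ! i) \<and> (\<forall>j\<le>i. sat M \<psi> (l ! j))) \<or>
        (\<forall>j<length l. sat M \<psi> (l ! j))))"


section \<open>Encoding of instances as words\<close>

text \<open>
  In an instance all agents, states, propositions and actions are named by natural numbers.
  An instance is written as a nested list of bit strings, serialised over the alphabet
  \<open>{1..5}\<close>: 1 and 2 are the bits, 3 ends a bit string, 4 and 5 are brackets.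
\<close>

datatype data = Bits "bool list" | Lst "data list"

primrec word :: "data \<Rightarrow> nat list" where
  "word (Bits bs) = map (\<lambda>b. if b then 2 else 1) bs @ [3]"
| "word (Lst ds) = 4 # concat (map word ds) @ [5]"

text \<open>Least significant bit first, without superfluous zeros.\<close>

fun binary_bits :: "nat \<Rightarrow> bool list" where
  "binary_bits n = (if n = 0 then [] else odd n # binary_bits (n div 2))"

declare binary_bits.simps [simp del]

definition binary :: "nat \<Rightarrow> data" where
  "binary n = Bits (binary_bits n)"

definition unary :: "nat \<Rightarrow> data" where
  "unary n = Bits (replicate n True)"

definition signed_binary :: "int \<Rightarrow> data" where
  "signed_binary z = Bits ((z < 0) # binary_bits (nat \<bar>z\<bar>))"

definition enc_set :: "nat set \<Rightarrow> data" where
  "enc_set X = Lst (map binary (sorted_list_of_set X))"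

text \<open>
  A structure is given by its sets and by the graphs of its functions.  Costs are listed
  for available actions only, and transitions only for available joint actions; a joint
  action is written as the list of the agents' actions, in the order of the agents.
\<close>

type_synonym input_cgs = "(nat, nat, nat, nat) cgs"

definition enc_val :: "input_cgs \<Rightarrow> data" where
  "enc_val M = Lst [Lst [binary p, enc_set (val M p)]. p \<leftarrow> sorted_list_of_set (Props M)]"

definition enc_avail :: "input_cgs \<Rightarrow> data" where
  "enc_avail M = Lst [Lst [binary s, binary a, enc_set (avail M s a)].
     s \<leftarrow> sorted_list_of_set (St M), a \<leftarrow> sorted_list_of_set (Agt M)]"

definition enc_cost :: "input_cgs \<Rightarrow> data" where
  "enc_cost M = Lst [Lst [binary s, binary x, Lst (map (\<lambda>i. signed_binary (cost M s x i)) [0..<nres M])].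
     s \<leftarrow> sorted_list_of_set (St M), x \<leftarrow> sorted_list_of_set (\<Union>a\<in>Agt M. avail M s a)]"

definition joint_of_list :: "input_cgs \<Rightarrow> nat list \<Rightarrow> nat \<Rightarrow> nat" where
  "joint_of_list M xs =
     restrict (\<lambda>a. the (map_of (zip (sorted_list_of_set (Agt M)) xs) a)) (Agt M)"

definition enc_delta :: "input_cgs \<Rightarrow> data" where
  "enc_delta M = Lst [Lst [binary s, Lst (map binary xs), binary (delta M s (joint_of_list M xs))].
     s \<leftarrow> sorted_list_of_set (St M),
     xs \<leftarrow> product_lists (map (\<lambda>a. sorted_list_of_set (avail M s a)) (sorted_list_of_set (Agt M)))]"

definition enc_cgs :: "input_cgs \<Rightarrow> data" where
  "enc_cgs M = Lst [enc_set (Agt M), unary (nres M), enc_set (St M), enc_set (Act M),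
     enc_val M, enc_avail M, enc_cost M, enc_delta M]"

text \<open>
  The parameter \<open>num\<close> is the number representation used for the resource bounds; \<open>r\<close> is
  the number of resource types.
\<close>

definition enc_bound ::
  "(nat \<Rightarrow> data) \<Rightarrow> nat \<Rightarrow> nat set \<Rightarrow> (nat \<Rightarrow> nat \<Rightarrow> nat) \<Rightarrow> data" where
  "enc_bound num r A b =
     Lst [Lst [binary a, Lst (map (\<lambda>j. num (b a j)) [0..<r])]. a \<leftarrow> sorted_list_of_set A]"

primrec enc_fm :: "(nat \<Rightarrow> data) \<Rightarrow> nat \<Rightarrow> (nat, nat) fm \<Rightarrow> data" where
  "enc_fm num r (Prop p) = Lst [binary 0, binary p]"
| "enc_fm num r (Neg \<phi>) = Lst [binary 1, enc_fm num r \<phi>]"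
| "enc_fm num r (Or \<phi> \<psi>) = Lst [binary 2, enc_fm num r \<phi>, enc_fm num r \<psi>]"
| "enc_fm num r (Next A b \<phi>) = Lst [binary 3, enc_bound num r A b, enc_fm num r \<phi>]"
| "enc_fm num r (Until A b \<phi> \<psi>) =
     Lst [binary 4, enc_bound num r A b, enc_fm num r \<phi>, enc_fm num r \<psi>]"
| "enc_fm num r (Release A b \<phi> \<psi>) =
     Lst [binary 5, enc_bound num r A b, enc_fm num r \<phi>, enc_fm num r \<psi>]"

definition model_checking :: "(nat \<Rightarrow> data) \<Rightarrow> nat list set" where
  "model_checking num =
     {word (Lst [enc_cgs M, binary s, enc_fm num (nres M) \<phi>]) | M s \<phi>.
        rb_cgs M \<and> s \<in> St M \<and> fm_over M \<phi> \<and> sat M \<phi> s}"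


section \<open>Turing machines and PSPACE\<close>

text \<open>
  Deterministic multi-tape machines with two-way infinite tapes.  States and tape symbols are
  initial segments of \<open>nat\<close>; 0 is the initial state and the blank symbol, respectively.
\<close>

datatype move = Go_Left | Stay | Go_Right

record tm =
  tapes :: nat
  symbols :: nat
  states :: nat
  accept :: nat
  reject :: nat
  trans :: "nat \<Rightarrow> nat list \<Rightarrow> nat \<times> (nat \<times> move) list"

definition turing_machine :: "tm \<Rightarrow> bool" where
  "turing_machine T \<longleftrightarrow>
     tapes T \<ge> 1 \<and> symbols T \<ge> 1 \<and> 0 < states T \<and>
     accept T < states T \<and> reject T < states T \<and> accept T \<noteq> reject T \<and>
     (\<forall>q gs. q < states T \<and> length gs = tapes T \<and> set gs \<subseteq> {..<symbols T} \<longrightarrow>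
        (case trans T q gs of (q', as) \<Rightarrow>
           q' < states T \<and> length as = tapes T \<and> fst ` set as \<subseteq> {..<symbols T}))"

type_synonym tape = "(int \<Rightarrow> nat) \<times> int"
type_synonym config = "nat \<times> tape list"

fun read_tape :: "tape \<Rightarrow> nat" where
  "read_tape (f, h) = f h"

fun act_tape :: "tape \<Rightarrow> nat \<times> move \<Rightarrow> tape" where
  "act_tape (f, h) (g, m) =
     (f(h := g), case m of Go_Left \<Rightarrow> h - 1 | Stay \<Rightarrow> h | Go_Right \<Rightarrow> h + 1)"

fun step :: "tm \<Rightarrow> config \<Rightarrow> config" where
  "step T (q, ts) =
     (if q = accept T \<or> q = reject T then (q, ts)
      else case trans T q (map read_tape ts) of (q', as) \<Rightarrow> (q', map2 act_tape ts as))"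

definition init_config :: "tm \<Rightarrow> nat list \<Rightarrow> config" where
  "init_config T w =
     (0, (\<lambda>i. if 0 \<le> i \<and> i < int (length w) then w ! nat i else 0, 0)
         # replicate (tapes T - 1) (\<lambda>_. 0, 0))"

definition run :: "tm \<Rightarrow> nat list \<Rightarrow> nat \<Rightarrow> config" where
  "run T w t = (step T ^^ t) (init_config T w)"

text \<open>
  Space is measured by the distance of the heads from the origin, which up to constant
  factors is the number of cells visited.
\<close>

definition decides_in_space :: "tm \<Rightarrow> nat \<Rightarrow> nat list set \<Rightarrow> (nat \<Rightarrow> nat) \<Rightarrow> bool" where
  "decides_in_space T k L f \<longleftrightarrow>
     (\<forall>w\<in>lists {1..k}.
        (\<exists>t. fst (run T w t) = (if w \<in> L then accept T else reject T)) \<and>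
        (\<forall>t. \<forall>(c, h)\<in>set (snd (run T w t)). \<bar>h\<bar> \<le> int (f (length w))))"

text \<open>Languages over an arbitrary finite alphabet, taken to be \<open>{1..k}\<close>.\<close>

definition PSPACE :: "nat list set set" where
  "PSPACE = {L. \<exists>k T p. turing_machine T \<and> k < symbols T \<and> L \<subseteq> lists {1..k} \<and>
     decides_in_space T k L (poly (p :: nat poly))}"

end

theory Submission
  imports Defs
begin

text \<open>
  A step of a non-empty coalition uses up at least one unit of the diminishing resource of each
  member, so that a play lasts no longer than the initial amount, which is at most the length of
  a unary bound.  (For the empty coalition no computation is maximal, and the modalities hold
  trivially.)  Unfolding the modalities one step at a time therefore turns an instance into a NAND
  tree of linear height.  The other resources may grow, but only by exponentially large amounts in
  linearly many steps, so that their binary representations remain polynomial, and depth-first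
  evaluation of the tree needs only a polynomially large stack.

  The machine is obtained by compiling a while language on tapes; computability in polynomial space
  is shown to be closed under enough operations to express the evaluation.  Since a word may fail
  to encode an instance, the program decodes it and checks the conditions on the resulting data,
  which hold exactly for the encodings.
\<close>

section \<open>A while language on tapes and its compilation to Turing machines\<close>

text \<open>Membership in PSPACE asks only for termination and for a bound on the head positions.
  Programs may therefore take exponential time: addition counts, and a subformula is evaluated anew
  at every position where it is needed, instead of labelling the states. As subformulas are
  positions of the same tree, the lengths of plays and the depth of nesting add up in the height,
  and a single search suffices.

  Two levels of NAND express one round of the game, the choice of the coalition and the answers of
  the others. With NAND the search needs no values on its stack: a true node is removed in favour of
  its siblings, a false one settles its parent.

  What shapes the definitions is that the machine has to halt within its space on every word. The
  functions on decoded data are therefore total on data of any shape and polynomially bounded there,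
  with explicit cut-offs if necessary. Only the search relies on the validity of an instance, since
  otherwise neither the height of the tree nor the growth of the amounts is under control.\<close>

datatype com =
    Skip
  | Move nat move
  | Write nat nat
  | Seq com com
  | Ite nat "nat \<Rightarrow> bool" com com
  | Loop nat "nat \<Rightarrow> bool" com

text \<open>
  The control state of the compiled machine is the list of the commands that remain to be
  executed.  Only finitely many such lists are reachable from a given command.
\<close>

fun control :: "com list \<Rightarrow> (nat \<Rightarrow> nat) \<Rightarrow> com list" where
  "control [] g = []"
| "control (Seq a b # K) g = a # b # K"
| "control (Ite r P a b # K) g = (if P (g r) then a else b) # K"
| "control (Loop r P a # K) g = (if P (g r) then a # Loop r P a # K else K)"
| "control (_ # K) g = K"

fun effect :: "com list \<Rightarrow> nat \<Rightarrow> nat \<Rightarrow> nat \<times> move" where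
  "effect (Move r' m # K) r g = (g, if r = r' then m else Stay)"
| "effect (Write r' s # K) r g = (if r = r' then s else g, Stay)"
| "effect _ r g = (g, Stay)"

text \<open>A finite set closed under \<open>control\<close>, obtained by recursion on the command:
  what stands behind a subprogram, \<open>b\<close> or the loop itself, is appended to each of its
  lists. It may contain more than the reachable lists.\<close>

primrec controls :: "com \<Rightarrow> com list set" where
  "controls Skip = {[Skip], []}"
| "controls (Move r m) = {[Move r m], []}"
| "controls (Write r s) = {[Write r s], []}"
| "controls (Seq a b) = {[Seq a b]} \<union> (\<lambda>l. l @ [b]) ` controls a \<union> controls b"
| "controls (Ite r P a b) = {[Ite r P a b]} \<union> controls a \<union> controls b"
| "controls (Loop r P a) = {[Loop r P a], []} \<union> (\<lambda>l. l @ [Loop r P a]) ` controls a"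

text \<open>Six symbols: the blank 0 and the alphabet \<open>{1..5}\<close> of the words. The stacks
  use 1 and 2 only.\<close>

primrec wf_com :: "com \<Rightarrow> bool" where
  "wf_com Skip \<longleftrightarrow> True"
| "wf_com (Move r m) \<longleftrightarrow> True"
| "wf_com (Write r s) \<longleftrightarrow> s < 6"
| "wf_com (Seq a b) \<longleftrightarrow> wf_com a \<and> wf_com b"
| "wf_com (Ite r P a b) \<longleftrightarrow> wf_com a \<and> wf_com b"
| "wf_com (Loop r P a) \<longleftrightarrow> wf_com a"

lemma finite_controls: "finite (controls c)"
  by (induction c) auto

lemma controls_self: "[c] \<in> controls c"
  by (cases c) auto

lemma control_append: "l \<noteq> [] \<Longrightarrow> control (l @ K) g = control l g @ K"
  by (cases "(l, g)" rule: control.cases) auto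

text \<open>The part of the list before the appended suffix obeys the induction hypothesis as long
  as it is nonempty; once it is empty, the suffix is the singleton list of the next command.\<close>

lemma control_controls: "l \<in> controls c \<Longrightarrow> control l g \<in> controls c"
proof (induction c arbitrary: l)
  case (Seq a b)
  show ?case
  proof (cases "l \<in> (\<lambda>l. l @ [b]) ` controls a")
    case True
    then obtain l' where l': "l = l' @ [b]" "l' \<in> controls a" by auto
    show ?thesis
    proof (cases "l' = []")
      case True
      then show ?thesis using l' Seq.IH(2)[of "[b]"] controls_self[of b] by auto
    next
      case False
      then show ?thesis using l' Seq.IH(1)[of l'] by (auto simp: control_append)
    qed
  next
    case False
    then show ?thesis using Seq.prems Seq.IH(2)[of l] controls_self[of a] by auto
  qed
next
  case (Loop r P a)
  have K: "[a, Loop r P a] \<in> (\<lambda>l. l @ [Loop r P a]) ` controls a"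
    using controls_self[of a] by force
  show ?case
  proof (cases "l \<in> (\<lambda>l. l @ [Loop r P a]) ` controls a")
    case True
    then obtain l' where l': "l = l' @ [Loop r P a]" "l' \<in> controls a" by auto
    show ?thesis
    proof (cases "l' = []")
      case True
      then show ?thesis using l' K by auto
    next
      case False
      then show ?thesis using l' Loop.IH[of l'] by (auto simp: control_append)
    qed
  next
    case False
    then show ?thesis using Loop.prems K by auto
  qed
qed (auto simp: controls_self)

lemma effect_wf:
  assumes "l \<in> controls c" "wf_com c" "g < 6"
  shows "fst (effect l r g) < 6"
proof -
  have "\<forall>d\<in>set l. wf_com d"
    using assms(1,2) by (induction c arbitrary: l) force+
  then show ?thesis using assms(3) by (cases "(l, r, g)" rule: effect.cases) auto
qed

section \<open>Small-step semantics and its simulation by the compiled machine\<close>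

type_synonym tapes = "nat \<Rightarrow> tape"

text \<open>Tape 0 holds the input and tapes 1 to 4 the stacks. Commands may name further tapes; a
  test then sees the blank, here and in \<open>compile\<close>.\<close>

definition reads :: "tapes \<Rightarrow> nat \<Rightarrow> nat" where
  "reads \<tau> r = (if r < 5 then read_tape (\<tau> r) else 0)"

text \<open>
  A program halts when no command remains; the machine then accepts iff the symbol read on
  tape 1 is 2.  The states \<open>Inr True\<close> and \<open>Inr False\<close> are the accepting and the rejecting one.
\<close>

fun sstep :: "(com list + bool) \<times> tapes \<Rightarrow> (com list + bool) \<times> tapes" where
  "sstep (Inl K, \<tau>) =
     (if K = [] then Inr (reads \<tau> 1 = 2) else Inl (control K (reads \<tau>)),
      \<lambda>r. act_tape (\<tau> r) (effect K r (read_tape (\<tau> r))))"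
| "sstep (Inr b, \<tau>) = (Inr b, \<tau>)"
definition heads_within :: "nat \<Rightarrow> tapes \<Rightarrow> bool" where
  "heads_within m \<tau> \<longleftrightarrow> (\<forall>r<5. \<bar>snd (\<tau> r)\<bar> \<le> int m)"

definition machine_states :: "com \<Rightarrow> (com list + bool) set" where
  "machine_states c = Inl ` controls c \<union> range Inr"

text \<open>Machine states are numbers and the initial one is 0, so the bijection has to be
  normalised at \<open>[c]\<close>.\<close>

definition numbering :: "com \<Rightarrow> com list + bool \<Rightarrow> nat" where
  "numbering c = (SOME f. bij_betw f (machine_states c) {..<card (machine_states c)} \<and> f (Inl [c]) = 0)"

lemma numbering:
  "bij_betw (numbering c) (machine_states c) {..<card (machine_states c)}"
  "numbering c (Inl [c]) = 0"
proof -
  let ?Q = "machine_states c"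
  have fin: "finite ?Q" by (simp add: machine_states_def finite_controls)
  have q0: "Inl [c] \<in> ?Q" by (simp add: machine_states_def controls_self)
  have "card ?Q > 0" using fin q0 by (auto simp: card_gt_0_iff)
  moreover obtain h where h: "bij_betw h ?Q {0..<card ?Q}"
    using ex_bij_betw_finite_nat[OF fin] by blast
  \<comment> \<open>The transposition of 0 and the number of the start state, applied after an
    arbitrary numbering, moves the start state to 0.\<close>
  moreover define s where "s = (\<lambda>x::nat. if x = 0 then h (Inl [c]) else if x = h (Inl [c]) then 0 else x)"
  have "s (h (Inl [c])) = 0" by (simp add: s_def)
  have "h (Inl [c]) < card ?Q" using h q0 by (auto simp: bij_betw_def)
  then have "bij_betw s {..<card ?Q} {..<card ?Q}"
    using \<open>card ?Q > 0\<close> by (intro bij_betw_byWitness[where f' = s]) (auto simp: s_def)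
  then have "bij_betw (s \<circ> h) ?Q {..<card ?Q}"
    using h by (auto simp: atLeast0LessThan intro: bij_betw_trans)
  with \<open>s (h (Inl [c])) = 0\<close>
  have "\<exists>f. bij_betw f ?Q {..<card ?Q} \<and> f (Inl [c]) = 0" by (intro exI[of _ "s \<circ> h"]) auto
  from someI_ex[OF this] show "bij_betw (numbering c) ?Q {..<card ?Q}" "numbering c (Inl [c]) = 0"
    by (simp_all add: numbering_def)
qed

text \<open>On the two final states \<open>trans\<close> is never consulted, but
  \<open>turing_machine\<close> constrains its values there as well; hence the trivial
  action.\<close>

definition compile :: "com \<Rightarrow> tm" where
  "compile c = \<lparr>tapes = 5, symbols = 6, states = card (machine_states c),
     accept = numbering c (Inr True), reject = numbering c (Inr False),
     trans = (\<lambda>q gs. case inv_into (machine_states c) (numbering c) q of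
        Inl K \<Rightarrow> (numbering c (if K = [] then Inr (gs ! 1 = 2) else Inl (control K (\<lambda>r. if r < 5 then gs ! r else 0))),
           map (\<lambda>r. effect K r (gs ! r)) [0..<5])
      | Inr b \<Rightarrow> (q, map (\<lambda>g. (g, Stay)) gs))\<rparr>"

lemma inv_numbering: "q \<in> machine_states c \<Longrightarrow> inv_into (machine_states c) (numbering c) (numbering c q) = q"
  using numbering(1)[of c] by (auto simp: bij_betw_def)

lemma numbering_less: "q \<in> machine_states c \<Longrightarrow> numbering c q < card (machine_states c)"
  using numbering(1)[of c] by (auto simp: bij_betw_def)

lemma numbering_Inr_neq: "numbering c (Inr True) \<noteq> numbering c (Inr False)"
  using inv_numbering[of "Inr True" c] inv_numbering[of "Inr False" c] by (metis Inr_inject UnI2 machine_states_def rangeI)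

lemma numbering_eq_Inr: "q \<in> machine_states c \<Longrightarrow> numbering c q = numbering c (Inr b) \<longleftrightarrow> q = Inr b"
  using inv_numbering[of q c] inv_numbering[of "Inr b" c] by (metis UnI2 machine_states_def rangeI)

lemma turing_machine_compile:
  assumes "wf_com c"
  shows "turing_machine (compile c)"
proof -
  have *: "q' < card (machine_states c) \<and> length as = 5 \<and> fst ` set as \<subseteq> {..<6}"
    if q: "q < card (machine_states c)" and gs: "length gs = 5" "set gs \<subseteq> {..<6}"
      and tr: "trans (compile c) q gs = (q', as)" for q gs q' as
  proof -
    from q obtain s where s: "s \<in> machine_states c" "q = numbering c s"
      using numbering(1)[of c] by (auto simp: bij_betw_def)
    show ?thesis
    proof (cases s)
      case (Inl K)
      then have K: "K \<in> controls c" using s by (auto simp: machine_states_def)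
      have "Inl L \<in> machine_states c \<longleftrightarrow> L \<in> controls c" "Inr b \<in> machine_states c" for L b
        by (auto simp: machine_states_def)
      moreover have "gs ! r < 6" if "r < 5" for r using gs that by (metis lessThan_iff nth_mem subsetD)
      then have "fst (effect K r (gs ! r)) < 6" if "r < 5" for r
        using effect_wf[OF K assms] that by auto
      ultimately show ?thesis
        using tr s Inl K inv_numbering[OF s(1)] control_controls[OF K]
        by (auto simp del: upt_rec_numeral simp: compile_def intro!: numbering_less)
          (auto simp: machine_states_def dest: arg_cong[where f = fst])
    next
      case (Inr b)
      then show ?thesis using tr s inv_numbering[OF s(1)] gs q
        by (auto simp: compile_def)
    qed
  qed
  have "Inr b \<in> machine_states c" for b by (simp add: machine_states_def)
  then have "numbering c (Inr b) < card (machine_states c)" for b by (rule numbering_less)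
  moreover from this[of True] have "0 < card (machine_states c)" by simp
  moreover have "tapes (compile c) = 5" "symbols (compile c) = 6" "states (compile c) = card (machine_states c)"
    "accept (compile c) = numbering c (Inr True)" "reject (compile c) = numbering c (Inr False)"
    by (simp_all add: compile_def)
  ultimately show ?thesis
    using * numbering_Inr_neq[of c] unfolding turing_machine_def by (simp split: prod.split) blast
qed

lemma map_upt5: "map2 f (map g [0..<5]) (map h [0..<5]) = map (\<lambda>r. f (g r) (h r)) [0..<5::nat]"
  by (simp add: zip_map_map zip_same_conv_map)

lemma act_tape_Stay [simp]: "act_tape t (read_tape t, Stay) = t"
  by (cases t) simp

text \<open>Membership of the state in \<open>machine_states\<close> is carried along because the
  inverse of the numbering is meaningful only there.\<close>

lemma step_compile:
  assumes "q \<in> machine_states c"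
  shows "step (compile c) (numbering c q, map \<tau> [0..<5]) =
           (numbering c (fst (sstep (q, \<tau>))), map (snd (sstep (q, \<tau>))) [0..<5])"
    and "fst (sstep (q, \<tau>)) \<in> machine_states c"
proof -
  show "fst (sstep (q, \<tau>)) \<in> machine_states c"
    using assms control_controls by (cases q) (auto simp: machine_states_def)
  show "step (compile c) (numbering c q, map \<tau> [0..<5]) =
           (numbering c (fst (sstep (q, \<tau>))), map (snd (sstep (q, \<tau>))) [0..<5])"
  proof (cases q)
    case (Inr b)
    then show ?thesis by (cases b) (auto simp: compile_def)
  next
    case (Inl K)
    have reads: "(\<lambda>r. if r < 5 then map (\<lambda>x. read_tape (\<tau> x)) [0..<5] ! r else 0) = reads \<tau>"
      by (auto simp: reads_def)
    have nth1: "map (\<lambda>x. read_tape (\<tau> x)) [0..<5] ! Suc 0 = reads \<tau> (Suc 0)"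
      by (simp add: reads_def)
    have "numbering c q \<noteq> accept (compile c)" "numbering c q \<noteq> reject (compile c)"
      using Inl assms by (auto simp: compile_def numbering_eq_Inr)
    moreover have "map (\<lambda>r. effect K r (map (\<lambda>x. read_tape (\<tau> x)) [0..<5] ! r)) [0..<5] =
        map (\<lambda>r. effect K r (read_tape (\<tau> r))) [0..<5]"
      by (intro map_cong) auto
    moreover have "trans (compile c) (numbering c q) (map (\<lambda>x. read_tape (\<tau> x)) [0..<5]) =
      (numbering c (if K = [] then Inr (reads \<tau> 1 = 2) else Inl (control K (reads \<tau>))),
       map (\<lambda>r. effect K r (map (\<lambda>x. read_tape (\<tau> x)) [0..<5] ! r)) [0..<5])"
      using inv_numbering[OF assms] Inl unfolding compile_def by (simp del: upt_rec_numeral nth_map add: reads[unfolded upt_rec_numeral] reads nth1 cong: if_cong)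
    ultimately show ?thesis
      using Inl by (simp add: map_upt5 comp_def)
  qed
qed

lemma run_compile:
  assumes "init_config (compile c) w = (0, map \<tau> [0..<5])"
  shows "run (compile c) w t = (numbering c (fst ((sstep ^^ t) (Inl [c], \<tau>))), map (snd ((sstep ^^ t) (Inl [c], \<tau>))) [0..<5])"
    and "fst ((sstep ^^ t) (Inl [c], \<tau>)) \<in> machine_states c"
proof -
  have "run (compile c) w t = (numbering c (fst ((sstep ^^ t) (Inl [c], \<tau>))), map (snd ((sstep ^^ t) (Inl [c], \<tau>))) [0..<5])
    \<and> fst ((sstep ^^ t) (Inl [c], \<tau>)) \<in> machine_states c"
  proof (induction t)
    case 0
    then show ?case using assms by (simp add: run_def numbering machine_states_def controls_self)
  next
    case (Suc t)
    let ?s = "(sstep ^^ t) (Inl [c], \<tau>)"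
    have "run (compile c) w (Suc t) = step (compile c) (numbering c (fst ?s), map (snd ?s) [0..<5])"
      using Suc by (simp add: run_def)
    then show ?case
      using step_compile[of "fst ?s" c "snd ?s"] Suc by simp
  qed
  then show "run (compile c) w t = (numbering c (fst ((sstep ^^ t) (Inl [c], \<tau>))), map (snd ((sstep ^^ t) (Inl [c], \<tau>))) [0..<5])"
    and "fst ((sstep ^^ t) (Inl [c], \<tau>)) \<in> machine_states c" by auto
qed

section \<open>Big-step semantics with a bound on the head positions\<close>

inductive exec :: "nat \<Rightarrow> com \<Rightarrow> tapes \<Rightarrow> tapes \<Rightarrow> bool" for m where
  exec_Skip: "heads_within m \<tau> \<Longrightarrow> exec m Skip \<tau> \<tau>"
| exec_Move: "heads_within m \<tau> \<Longrightarrow> heads_within m \<tau>' \<Longrightarrow>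
    \<tau>' = \<tau>(r := act_tape (\<tau> r) (read_tape (\<tau> r), mv)) \<Longrightarrow> exec m (Move r mv) \<tau> \<tau>'"
| exec_Write: "heads_within m \<tau> \<Longrightarrow> heads_within m \<tau>' \<Longrightarrow>
    \<tau>' = \<tau>(r := act_tape (\<tau> r) (s, Stay)) \<Longrightarrow> exec m (Write r s) \<tau> \<tau>'"
| exec_Seq: "exec m a \<tau> \<tau>' \<Longrightarrow> exec m b \<tau>' \<tau>'' \<Longrightarrow> exec m (Seq a b) \<tau> \<tau>''"
| exec_Ite: "r < 5 \<Longrightarrow> exec m (if P (read_tape (\<tau> r)) then a else b) \<tau> \<tau>' \<Longrightarrow> exec m (Ite r P a b) \<tau> \<tau>'"
| exec_LoopF: "r < 5 \<Longrightarrow> heads_within m \<tau> \<Longrightarrow> \<not> P (read_tape (\<tau> r)) \<Longrightarrow> exec m (Loop r P a) \<tau> \<tau>"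
| exec_LoopT: "r < 5 \<Longrightarrow> P (read_tape (\<tau> r)) \<Longrightarrow> exec m a \<tau> \<tau>' \<Longrightarrow> exec m (Loop r P a) \<tau>' \<tau>'' \<Longrightarrow>
    exec m (Loop r P a) \<tau> \<tau>''"

definition sstep_within :: "nat \<Rightarrow> (com list + bool) \<times> tapes \<Rightarrow> (com list + bool) \<times> tapes \<Rightarrow> bool" where
  "sstep_within m x y \<longleftrightarrow> y = sstep x \<and> heads_within m (snd x) \<and> heads_within m (snd y)"

lemma exec_start: "exec m c \<tau> \<tau>' \<Longrightarrow> heads_within m \<tau>"
  by (induction rule: exec.induct) auto

lemma exec_end: "exec m c \<tau> \<tau>' \<Longrightarrow> heads_within m \<tau>'"
  by (induction rule: exec.induct) blast+

text \<open>The continuation \<open>K\<close> is arbitrary so that the induction hypothesis can run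
  a subprogram in front of what follows it: \<open>b # K\<close> in a sequence, the loop itself
  behind its body.\<close>

lemma exec_sstep: "exec m c \<tau> \<tau>' \<Longrightarrow> (sstep_within m)\<^sup>*\<^sup>* (Inl (c # K), \<tau>) (Inl K, \<tau>')"
proof (induction arbitrary: K rule: exec.induct)
  case (exec_Move \<tau> \<tau>' r mv)
  then show ?case
    by (intro r_into_rtranclp) (auto simp: sstep_within_def heads_within_def)
next
  case (exec_Write \<tau> \<tau>' r s)
  then show ?case
    by (intro r_into_rtranclp) (auto simp: sstep_within_def heads_within_def)
next
  case (exec_Seq a \<tau> \<tau>' b \<tau>'')
  have "sstep_within m (Inl (Seq a b # K), \<tau>) (Inl (a # b # K), \<tau>)"
    using exec_start[OF exec_Seq.hyps(1)] by (auto simp: sstep_within_def)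
  with exec_Seq.IH(1)[of "b # K"] exec_Seq.IH(2)[of K] show ?case by (meson converse_rtranclp_into_rtranclp rtranclp_trans)
next
  case (exec_Ite r P \<tau> a b \<tau>')
  have "sstep_within m (Inl (Ite r P a b # K), \<tau>) (Inl ((if P (read_tape (\<tau> r)) then a else b) # K), \<tau>)"
    using exec_start[OF exec_Ite.hyps(2)] exec_Ite.hyps(1) by (auto simp: sstep_within_def reads_def)
  with exec_Ite.IH show ?case by (meson converse_rtranclp_into_rtranclp)
next
  case (exec_LoopT r P \<tau> a \<tau>' \<tau>'')
  have "sstep_within m (Inl (Loop r P a # K), \<tau>) (Inl (a # Loop r P a # K), \<tau>)"
    using exec_start[OF exec_LoopT.hyps(3)] exec_LoopT.hyps(1,2) by (auto simp: sstep_within_def reads_def)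
  with exec_LoopT.IH(1)[of "Loop r P a # K"] exec_LoopT.IH(2)[of K] show ?case
    by (meson converse_rtranclp_into_rtranclp rtranclp_trans)
qed (auto simp: sstep_within_def reads_def intro!: r_into_rtranclp)

lemma sstep_within_funpow:
  assumes "(sstep_within m)\<^sup>*\<^sup>* x y" "heads_within m (snd x)"
  shows "\<exists>n. (sstep ^^ n) x = y \<and> (\<forall>i\<le>n. heads_within m (snd ((sstep ^^ i) x)))"
  using assms
proof (induction rule: rtranclp_induct)
  case base
  then show ?case by (intro exI[of _ 0]) auto
next
  case (step y z)
  then obtain n where "(sstep ^^ n) x = y" "\<forall>i\<le>n. heads_within m (snd ((sstep ^^ i) x))" by auto
  with step.hyps show ?case
    by (intro exI[of _ "Suc n"]) (auto simp: sstep_within_def le_Suc_eq)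
qed

lemma exec_compile:
  assumes c: "exec m c \<tau> \<tau>'"
    and init: "init_config (compile c) w = (0, map \<tau> [0..<5])"
  shows "\<exists>t. fst (run (compile c) w t) =
      (if read_tape (\<tau>' 1) = 2 then accept (compile c) else reject (compile c))"
    and "(h, p) \<in> set (snd (run (compile c) w t)) \<Longrightarrow> \<bar>p\<bar> \<le> int m"
proof -
  let ?x = "(Inl [c], \<tau>) :: (com list + bool) \<times> tapes"
  let ?b = "read_tape (\<tau>' 1) = 2"
  obtain n where n: "(sstep ^^ n) ?x = (Inl [], \<tau>')" "\<forall>i\<le>n. heads_within m (snd ((sstep ^^ i) ?x))"
    using sstep_within_funpow[OF exec_sstep[OF c, of "[]"]] exec_start[OF c] by auto
  have "(sstep ^^ Suc n) ?x = (Inr ?b, \<tau>')"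
    using n(1) by (simp add: reads_def)
  \<comment> \<open>The final state is absorbing, so a bound on the finitely many configurations
    before it is a bound at all times, as \<open>decides_in_space\<close> demands.\<close>
  then have halt: "(sstep ^^ (i + Suc n)) ?x = (Inr ?b, \<tau>')" for i
    by (induction i) simp_all
  show "\<exists>t. fst (run (compile c) w t) = (if ?b then accept (compile c) else reject (compile c))"
    using halt[of 0] run_compile(1)[OF init, of "Suc n"]
    by (intro exI[of _ "Suc n"]) (auto simp: compile_def)
  have "heads_within m (snd ((sstep ^^ t) ?x))"
  proof (cases "t \<le> n")
    case True
    then show ?thesis using n by auto
  next
    case False
    then show ?thesis using halt[of "t - Suc n"] exec_end[OF c] by simp
  qed
  then show "(h, p) \<in> set (snd (run (compile c) w t)) \<Longrightarrow> \<bar>p\<bar> \<le> int m"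
    unfolding run_compile(1)[OF init] heads_within_def by (auto simp del: upt_rec_numeral simp: set_upt) (metis snd_conv)
qed


section \<open>Stacks on tapes\<close>

text \<open>The top is under the head and cell 0 stays blank. Hence an empty stack reads as 0, and
  the head position is the height of the stack, which turns space into stack height.\<close>

definition tape_of :: "nat list \<Rightarrow> tape" where
  "tape_of xs = (\<lambda>k. if 1 \<le> k \<and> k \<le> int (length xs) then rev xs ! nat (k - 1) else 0, int (length xs))"

lemma read_tape_of: "read_tape (tape_of xs) = (case xs of [] \<Rightarrow> 0 | x # _ \<Rightarrow> x)"
  by (cases xs) (auto simp: tape_of_def nth_append)

lemma push_tape: "act_tape (act_tape (tape_of xs) (read_tape (tape_of xs), Go_Right)) (g, Stay) = tape_of (g # xs)"
  by (auto simp: tape_of_def fun_eq_iff nth_append nat_less_iff Suc_le_eq)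

lemma pop_tape: "act_tape (act_tape (tape_of (g # xs)) (0, Stay)) (0, Go_Left) = tape_of xs"
  by (auto simp: tape_of_def fun_eq_iff nth_append nat_less_iff)

type_synonym stacks = "nat \<Rightarrow> nat list"

definition on_tapes :: "tape \<Rightarrow> stacks \<Rightarrow> tapes" where
  "on_tapes inp \<sigma> r = (if r = 0 then inp else tape_of (\<sigma> r))"

definition fits :: "nat \<Rightarrow> stacks \<Rightarrow> bool" where
  "fits m \<sigma> \<longleftrightarrow> (\<forall>r. length (\<sigma> r) \<le> m)"

definition top_of :: "stacks \<Rightarrow> nat \<Rightarrow> nat" where
  "top_of \<sigma> r = (case \<sigma> r of [] \<Rightarrow> 0 | x # _ \<Rightarrow> x)"

text \<open>Programs on stacks leave tape 0 alone, so any content and any admissible head position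
  is allowed there. Quantifying over larger bounds makes monotonicity in \<open>m\<close>
  immediate.\<close>

definition sexec :: "nat \<Rightarrow> com \<Rightarrow> stacks \<Rightarrow> stacks \<Rightarrow> bool" where
  "sexec m c \<sigma> \<sigma>' \<longleftrightarrow> (\<forall>inp m'. m \<le> m' \<and> \<bar>snd inp\<bar> \<le> int m' \<longrightarrow> exec m' c (on_tapes inp \<sigma>) (on_tapes inp \<sigma>'))"

definition push :: "nat \<Rightarrow> nat \<Rightarrow> com" where
  "push r g = Seq (Move r Go_Right) (Write r g)"

text \<open>The cell is blanked before the head leaves it; otherwise the tape would not be
  \<open>tape_of\<close> of the remaining stack.\<close>

definition pop :: "nat \<Rightarrow> com" where
  "pop r = Seq (Write r 0) (Move r Go_Left)"

lemma wf_push [simp]: "wf_com (push r g) \<longleftrightarrow> g < 6"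
  by (simp add: push_def)

lemma wf_pop [simp]: "wf_com (pop r)"
  by (simp add: pop_def)

lemma sexec_mono: "sexec m c \<sigma> \<sigma>' \<Longrightarrow> m \<le> m' \<Longrightarrow> sexec m' c \<sigma> \<sigma>'"
  by (auto simp: sexec_def)

lemma heads_within_on_tapes: "fits m \<sigma> \<Longrightarrow> m \<le> m' \<Longrightarrow> \<bar>snd inp\<bar> \<le> int m' \<Longrightarrow> heads_within m' (on_tapes inp \<sigma>)"
  unfolding heads_within_def on_tapes_def fits_def tape_of_def by (auto intro: order_trans)

lemma sexec_push:
  assumes "fits m \<sigma>" "length (\<sigma> r) < m" "1 \<le> r"
  shows "sexec m (push r g) \<sigma> (\<sigma>(r := g # \<sigma> r))"
  unfolding sexec_def push_def
proof (intro allI impI, elim conjE)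
  fix inp :: tape and m' assume m': "m \<le> m'" "\<bar>snd inp\<bar> \<le> int m'"
  let ?t = "on_tapes inp \<sigma>"
  let ?u = "?t(r := act_tape (?t r) (read_tape (?t r), Go_Right))"
  have a: "heads_within m' ?t" using assms m' heads_within_on_tapes by blast
  moreover have "fits m (\<sigma>(r := g # \<sigma> r))" using assms by (auto simp: fits_def Suc_le_eq)
  then have b: "heads_within m' (on_tapes inp (\<sigma>(r := g # \<sigma> r)))" using m' heads_within_on_tapes by blast
  have c: "on_tapes inp (\<sigma>(r := g # \<sigma> r)) = ?u(r := act_tape (?u r) (g, Stay))"
    using assms by (auto simp: on_tapes_def push_tape fun_eq_iff)
  \<comment> \<open>Between the two commands tape \<open>r\<close> need not represent a stack, but
    its head is already where the push leaves it.\<close>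
  have "snd (?u r) = snd (on_tapes inp (\<sigma>(r := g # \<sigma> r)) r)"
    using c by (cases "?u r") auto
  then have "heads_within m' ?u" using a b unfolding heads_within_def by (metis fun_upd_other)
  then show "exec m' (Seq (Move r Go_Right) (Write r g)) ?t (on_tapes inp (\<sigma>(r := g # \<sigma> r)))"
    using exec_Seq[OF exec_Move[OF a _ refl] exec_Write[OF _ b c]] by blast
qed

lemma sexec_pop:
  assumes "fits m \<sigma>" "\<sigma> r = g # xs" "1 \<le> r"
  shows "sexec m (pop r) \<sigma> (\<sigma>(r := xs))"
  unfolding sexec_def pop_def
proof (intro allI impI, elim conjE)
  fix inp :: tape and m' assume m': "m \<le> m'" "\<bar>snd inp\<bar> \<le> int m'"
  let ?t = "on_tapes inp \<sigma>"
  let ?u = "?t(r := act_tape (?t r) (0, Stay))"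
  have a: "heads_within m' ?t" using assms m' heads_within_on_tapes by blast
  moreover have "fits m (\<sigma>(r := xs))" using assms unfolding fits_def
    by (metis Suc_leD fun_upd_apply length_Cons)
  then have b: "heads_within m' (on_tapes inp (\<sigma>(r := xs)))" using m' heads_within_on_tapes by blast
  have c: "on_tapes inp (\<sigma>(r := xs)) = ?u(r := act_tape (?u r) (read_tape (?u r), Go_Left))"
    using assms pop_tape[of g xs] by (auto simp: on_tapes_def fun_eq_iff tape_of_def)
  have "snd (?u r) = snd (?t r)" by (cases "?t r") auto
  then have "heads_within m' ?u" using a unfolding heads_within_def by (metis fun_upd_apply)
  then show "exec m' (Seq (Write r 0) (Move r Go_Left)) ?t (on_tapes inp (\<sigma>(r := xs)))"
    using exec_Seq[OF exec_Write[OF a _ refl] exec_Move[OF _ b c]] by blast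
qed

lemma read_on_tapes: "1 \<le> r \<Longrightarrow> read_tape (on_tapes inp \<sigma> r) = top_of \<sigma> r"
  by (simp add: on_tapes_def read_tape_of top_of_def)

lemma sexec_Skip: "fits m \<sigma> \<Longrightarrow> sexec m Skip \<sigma> \<sigma>"
  unfolding sexec_def using heads_within_on_tapes exec_Skip by blast

lemma sexec_Seq: "sexec m a \<sigma> \<sigma>' \<Longrightarrow> sexec m b \<sigma>' \<sigma>'' \<Longrightarrow> sexec m (Seq a b) \<sigma> \<sigma>''"
  unfolding sexec_def using exec_Seq by blast

lemma sexec_Ite: "1 \<le> r \<Longrightarrow> r < 5 \<Longrightarrow> sexec m (if P (top_of \<sigma> r) then a else b) \<sigma> \<sigma>' \<Longrightarrow> sexec m (Ite r P a b) \<sigma> \<sigma>'"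
  unfolding sexec_def by (auto intro!: exec_Ite simp: read_on_tapes)

lemma sexec_LoopF: "1 \<le> r \<Longrightarrow> r < 5 \<Longrightarrow> \<not> P (top_of \<sigma> r) \<Longrightarrow> fits m \<sigma> \<Longrightarrow> sexec m (Loop r P a) \<sigma> \<sigma>"
  unfolding sexec_def by (auto intro!: exec_LoopF simp: read_on_tapes heads_within_on_tapes)

lemma sexec_LoopT: "1 \<le> r \<Longrightarrow> r < 5 \<Longrightarrow> P (top_of \<sigma> r) \<Longrightarrow> sexec m a \<sigma> \<sigma>' \<Longrightarrow> sexec m (Loop r P a) \<sigma>' \<sigma>'' \<Longrightarrow>
    sexec m (Loop r P a) \<sigma> \<sigma>''"
  unfolding sexec_def by (metis exec_LoopT read_on_tapes)


section \<open>Trees as values\<close>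

datatype tree = Leaf | Node tree tree

text \<open>The prefix code of a tree; it makes \<open>Node\<close> and its inverse a single push or pop.\<close>

primrec code :: "tree \<Rightarrow> nat list" where
  "code Leaf = [1]"
| "code (Node a b) = 2 # code a @ code b"

lemma code_ne [simp]: "code t \<noteq> []" by (cases t) auto

lemma length_code_pos [simp]: "0 < length (code t)" by simp

lemma code_symbols: "set (code t) \<subseteq> {1, 2}" by (induction t) auto

text \<open>Moves one code from \<open>r\<close> to \<open>r'\<close>, reversing it. The code is
  self-delimiting: stack 4 counts, in unary, the subtrees still to be read. A symbol 2 replaces one
  pending subtree by two, a symbol 1 completes one.\<close>

definition shift :: "nat \<Rightarrow> nat \<Rightarrow> com" where
  "shift r r' = Seq (push 4 1) (Loop 4 (\<lambda>g. g \<noteq> 0)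
     (Ite r (\<lambda>g. g = 2) (Seq (pop r) (Seq (push r' 2) (push 4 1))) (Seq (pop r) (Seq (push r' 1) (pop 4)))))"

definition transfer :: "nat \<Rightarrow> nat \<Rightarrow> com" where
  "transfer r r' = Loop r (\<lambda>g. g \<noteq> 0)
     (Ite r (\<lambda>g. g = 2) (Seq (pop r) (push r' 2)) (Seq (pop r) (push r' 1)))"

definition transfer2 :: "nat \<Rightarrow> nat \<Rightarrow> nat \<Rightarrow> com" where
  "transfer2 r r' r'' = Loop r (\<lambda>g. g \<noteq> 0)
     (Ite r (\<lambda>g. g = 2) (Seq (pop r) (Seq (push r' 2) (push r'' 2))) (Seq (pop r) (Seq (push r' 1) (push r'' 1))))"

definition clear :: "nat \<Rightarrow> com" where
  "clear r = Loop r (\<lambda>g. g \<noteq> 0) (pop r)"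

text \<open>Inside a tree the remaining input is a sequence of codes, so the claim has to be about a
  list \<open>ts\<close> of pending trees. Its total code length drops by one with each
  symbol.\<close>

lemma sexec_shift_loop:
  assumes "fits m \<sigma>" "\<sigma> r = concat (map code ts) @ rest" "\<sigma> 4 = replicate (length ts) 1"
    "length (\<sigma> r) + length (\<sigma> r') \<le> m" "r \<noteq> r'" "1 \<le> r" "r < 4" "1 \<le> r'" "r' < 4"
  shows "sexec m (Loop 4 (\<lambda>g. g \<noteq> 0)
     (Ite r (\<lambda>g. g = 2) (Seq (pop r) (Seq (push r' 2) (push 4 1))) (Seq (pop r) (Seq (push r' 1) (pop 4)))))
     \<sigma> (\<sigma>(r := rest, r' := rev (concat (map code ts)) @ \<sigma> r', 4 := []))"
  using assms
proof (induction "length (concat (map code ts))" arbitrary: \<sigma> ts rule: less_induct)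
  case less
  let ?body = "Ite r (\<lambda>g. g = 2) (Seq (pop r) (Seq (push r' 2) (push 4 1))) (Seq (pop r) (Seq (push r' 1) (pop 4)))"
  let ?loop = "Loop 4 (\<lambda>g. g \<noteq> 0) ?body"
  have len4: "length ts \<le> length (concat (map code ts))"
    by (induction ts) (auto simp: Suc_le_eq add_strict_increasing)
  show ?case
  proof (cases ts)
    case Nil
    then have eq: "\<sigma>(r := rest, r' := rev (concat (map code ts)) @ \<sigma> r', 4 := []) = \<sigma>"
      using less.prems by (auto simp: fun_eq_iff)
    show ?thesis
      unfolding eq by (rule sexec_LoopF) (use Nil less.prems in \<open>auto simp: top_of_def\<close>)
  next
    case (Cons t us)
    show ?thesis
    proof (cases t)
      case Leaf
      let ?s1 = "\<sigma>(r := concat (map code us) @ rest)"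
      let ?s2 = "?s1(r' := 1 # ?s1 r')"
      let ?s3 = "?s2(4 := replicate (length us) 1)"
      have s: "\<sigma> r = 1 # concat (map code us) @ rest" "\<sigma> 4 = 1 # replicate (length us) 1"
        using less.prems Cons Leaf by auto
      have 1: "sexec m (pop r) \<sigma> ?s1" using less.prems s by (intro sexec_pop[where g = 1]) auto
      have f1: "fits m ?s1" using less.prems(1) s unfolding fits_def
        by (metis Suc_leD fun_upd_apply length_Cons)
      have 2: "sexec m (push r' 1) ?s1 ?s2" using less.prems f1 s by (intro sexec_push) auto
      have f2: "fits m ?s2" using f1 less.prems s unfolding fits_def by auto
      have 3: "sexec m (pop 4) ?s2 ?s3" using less.prems f2 s by (intro sexec_pop[where g = 1]) auto
      have f3: "fits m ?s3" using f2 less.prems s unfolding fits_def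
        by (metis Suc_leD fun_upd_apply length_Cons)
      have "sexec m ?loop ?s3 (?s3(r := rest, r' := rev (concat (map code us)) @ ?s3 r', 4 := []))"
        using less.prems f3 s Cons Leaf by (intro less.hyps) auto
      also have "?s3(r := rest, r' := rev (concat (map code us)) @ ?s3 r', 4 := []) =
          \<sigma>(r := rest, r' := rev (concat (map code ts)) @ \<sigma> r', 4 := [])"
        using less.prems(5,7,9) Cons Leaf by (simp add: fun_eq_iff)
      finally have 4: "sexec m ?loop ?s3 (\<sigma>(r := rest, r' := rev (concat (map code ts)) @ \<sigma> r', 4 := []))" .
      have t: "top_of \<sigma> r = 1" "top_of \<sigma> 4 = 1" using s by (simp_all add: top_of_def)
      have "sexec m ?body \<sigma> ?s3"
        using sexec_Seq[OF 1 sexec_Seq[OF 2 3]] less.prems(6,7) t by (intro sexec_Ite) simp_all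
      with 4 t show ?thesis by (intro sexec_LoopT[OF _ _ _ _ 4]) simp_all
    next
      case (Node a b)
      let ?us = "a # b # us"
      let ?s1 = "\<sigma>(r := concat (map code ?us) @ rest)"
      let ?s2 = "?s1(r' := 2 # ?s1 r')"
      let ?s3 = "?s2(4 := 1 # ?s2 4)"
      have s: "\<sigma> r = 2 # concat (map code ?us) @ rest" "\<sigma> 4 = 1 # replicate (length us) 1"
        using less.prems Cons Node by auto
      have 1: "sexec m (pop r) \<sigma> ?s1" using less.prems s by (intro sexec_pop[where g = 2]) auto
      have f1: "fits m ?s1" using less.prems(1) s unfolding fits_def
        by (metis Suc_leD fun_upd_apply length_Cons)
      have 2: "sexec m (push r' 2) ?s1 ?s2" using less.prems f1 s by (intro sexec_push) auto
      have f2: "fits m ?s2" using f1 less.prems s unfolding fits_def by auto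
      \<comment> \<open>Each pending tree contributes at least one symbol and the first one more
        than one. The counter is thus shorter than stack \<open>r\<close>, and its increment
        fits.\<close>
      have "length ts < length (concat (map code ts))"
      proof -
        have "length us \<le> length (concat (map code us))"
          by (induction us) (auto simp: Suc_le_eq add_strict_increasing)
        moreover have "length (concat (map code ts)) = 1 + length (code a) + length (code b) + length (concat (map code us))"
          "length ts = Suc (length us)" by (simp_all add: Cons Node)
        ultimately show ?thesis using length_code_pos[of a] by linarith
      qed
      then have l4: "length (\<sigma> 4) < m" using less.prems by simp
      have 3: "sexec m (push 4 1) ?s2 ?s3" using less.prems f2 s l4 by (intro sexec_push) auto
      have f3: "fits m ?s3" using f2 less.prems s l4 unfolding fits_def by auto
      have "sexec m ?loop ?s3 (?s3(r := rest, r' := rev (concat (map code ?us)) @ ?s3 r', 4 := []))"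
        using less.prems f3 s Cons Node by (intro less.hyps) auto
      also have "?s3(r := rest, r' := rev (concat (map code ?us)) @ ?s3 r', 4 := []) =
          \<sigma>(r := rest, r' := rev (concat (map code ts)) @ \<sigma> r', 4 := [])"
        using less.prems(5,7,9) Cons Node by (simp add: fun_eq_iff)
      finally have 4: "sexec m ?loop ?s3 (\<sigma>(r := rest, r' := rev (concat (map code ts)) @ \<sigma> r', 4 := []))" .
      have t: "top_of \<sigma> r = 2" "top_of \<sigma> 4 = 1" using s by (simp_all add: top_of_def)
      have "sexec m ?body \<sigma> ?s3"
        using sexec_Seq[OF 1 sexec_Seq[OF 2 3]] less.prems(6,7) t by (intro sexec_Ite) simp_all
      with 4 t show ?thesis by (intro sexec_LoopT[OF _ _ _ _ 4]) simp_all
    qed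
  qed
qed

lemma sexec_shift:
  assumes "fits m \<sigma>" "\<sigma> r = code t @ rest" "\<sigma> 4 = []" "length (\<sigma> r) + length (\<sigma> r') \<le> m"
    "r \<noteq> r'" "1 \<le> r" "r < 4" "1 \<le> r'" "r' < 4"
  shows "sexec m (shift r r') \<sigma> (\<sigma>(r := rest, r' := rev (code t) @ \<sigma> r'))"
proof -
  let ?s = "\<sigma>(4 := 1 # \<sigma> 4)"
  have "0 < m" using assms by (metis add_gr_0 length_append length_code_pos less_le_trans)
  then have 1: "sexec m (push 4 1) \<sigma> ?s" using assms by (intro sexec_push) auto
  have f: "fits m ?s" using \<open>0 < m\<close> assms by (auto simp: fits_def Suc_le_eq)
  have "sexec m (Loop 4 (\<lambda>g. g \<noteq> 0)
     (Ite r (\<lambda>g. g = 2) (Seq (pop r) (Seq (push r' 2) (push 4 1))) (Seq (pop r) (Seq (push r' 1) (pop 4)))))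
    ?s (?s(r := rest, r' := rev (concat (map code [t])) @ ?s r', 4 := []))"
    using f assms by (intro sexec_shift_loop) auto
  also have "?s(r := rest, r' := rev (concat (map code [t])) @ ?s r', 4 := []) = \<sigma>(r := rest, r' := rev (code t) @ \<sigma> r')"
    using assms by (auto simp: fun_eq_iff)
  finally show ?thesis unfolding shift_def by (rule sexec_Seq[OF 1])
qed

lemma sexec_transfer:
  assumes "fits m \<sigma>" "set (\<sigma> r) \<subseteq> {1, 2}" "length (\<sigma> r) + length (\<sigma> r') \<le> m"
    "r \<noteq> r'" "1 \<le> r" "r < 4" "1 \<le> r'" "r' < 4"
  shows "sexec m (transfer r r') \<sigma> (\<sigma>(r := [], r' := rev (\<sigma> r) @ \<sigma> r'))"
  using assms
proof (induction "\<sigma> r" arbitrary: \<sigma>)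
  case Nil
  then have eq: "\<sigma>(r := [], r' := rev (\<sigma> r) @ \<sigma> r') = \<sigma>" by (auto simp: fun_eq_iff)
  show ?case unfolding transfer_def eq by (rule sexec_LoopF) (use Nil in \<open>auto simp: top_of_def\<close>)
next
  case (Cons g xs)
  let ?s1 = "\<sigma>(r := xs)"
  let ?s2 = "?s1(r' := g # ?s1 r')"
  have s: "\<sigma> r = g # xs" using Cons by simp
  have f1: "fits m ?s1" using Cons.prems(1) s unfolding fits_def
    by (metis Suc_leD fun_upd_apply length_Cons)
  have 1: "sexec m (pop r) \<sigma> ?s1" using Cons.prems s by (intro sexec_pop[where g = g]) auto
  have l: "length (?s1 r') < m" using s Cons.prems(3,4) by (auto simp del: set_simps)
  have 2: "sexec m (push r' g) ?s1 ?s2" using Cons.prems l f1 by (intro sexec_push) auto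
  have f2: "fits m ?s2" using f1 Cons.prems(3,4) s unfolding fits_def by (metis Suc_leI l fun_upd_apply length_Cons)
  have "sexec m (transfer r r') ?s2 (?s2(r := [], r' := rev (?s2 r) @ ?s2 r'))"
    using Cons.prems s f2 by (intro Cons.hyps) auto
  also have "?s2(r := [], r' := rev (?s2 r) @ ?s2 r') = \<sigma>(r := [], r' := rev (\<sigma> r) @ \<sigma> r')"
    using Cons.prems(4) s by (auto simp: fun_eq_iff)
  finally have 3: "sexec m (transfer r r') ?s2 (\<sigma>(r := [], r' := rev (\<sigma> r) @ \<sigma> r'))" .
  have t: "top_of \<sigma> r = g" "g = 1 \<or> g = 2" using s Cons.prems(2) by (auto simp: top_of_def)
  have "sexec m (Ite r (\<lambda>g. g = 2) (Seq (pop r) (push r' 2)) (Seq (pop r) (push r' 1))) \<sigma> ?s2"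
    using sexec_Seq[OF 1 2] Cons.prems(5,6) t by (intro sexec_Ite) auto
  with 3 t Cons.prems(5,6) show ?case unfolding transfer_def
    by (intro sexec_LoopT[OF _ _ _ _ 3[unfolded transfer_def]]) auto
qed

lemma sexec_transfer2:
  assumes "fits m \<sigma>" "set (\<sigma> r) \<subseteq> {1, 2}" "length (\<sigma> r) + length (\<sigma> r') \<le> m" "length (\<sigma> r) + length (\<sigma> r'') \<le> m"
    "r \<noteq> r'" "r \<noteq> r''" "r' \<noteq> r''" "1 \<le> r" "r < 4" "1 \<le> r'" "r' < 4" "1 \<le> r''" "r'' < 4"
  shows "sexec m (transfer2 r r' r'') \<sigma> (\<sigma>(r := [], r' := rev (\<sigma> r) @ \<sigma> r', r'' := rev (\<sigma> r) @ \<sigma> r''))"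
  using assms
proof (induction "\<sigma> r" arbitrary: \<sigma>)
  case Nil
  then have eq: "\<sigma>(r := [], r' := rev (\<sigma> r) @ \<sigma> r', r'' := rev (\<sigma> r) @ \<sigma> r'') = \<sigma>" by (auto simp: fun_eq_iff)
  show ?case unfolding transfer2_def eq by (rule sexec_LoopF) (use Nil in \<open>auto simp: top_of_def\<close>)
next
  case (Cons g xs)
  let ?s1 = "\<sigma>(r := xs)"
  let ?s2 = "?s1(r' := g # ?s1 r')"
  let ?s3 = "?s2(r'' := g # ?s2 r'')"
  have s: "\<sigma> r = g # xs" using Cons by simp
  have f1: "fits m ?s1" using Cons.prems(1) s unfolding fits_def
    by (metis Suc_leD fun_upd_apply length_Cons)
  have 1: "sexec m (pop r) \<sigma> ?s1" using Cons.prems s by (intro sexec_pop[where g = g]) auto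
  have l: "length (?s1 r') < m" using s Cons.prems(3,5) by (auto simp del: set_simps)
  have 2: "sexec m (push r' g) ?s1 ?s2" using Cons.prems l f1 by (intro sexec_push) auto
  have f2: "fits m ?s2" using f1 s unfolding fits_def by (metis Suc_leI l fun_upd_apply length_Cons)
  have l2: "length (?s2 r'') < m" using s Cons.prems(4,6,7) by (auto simp del: set_simps)
  have 3: "sexec m (push r'' g) ?s2 ?s3" using Cons.prems l2 f2 by (intro sexec_push) auto
  have f3: "fits m ?s3" using f2 s unfolding fits_def by (metis Suc_leI l2 fun_upd_apply length_Cons)
  have "sexec m (transfer2 r r' r'') ?s3 (?s3(r := [], r' := rev (?s3 r) @ ?s3 r', r'' := rev (?s3 r) @ ?s3 r''))"
    using Cons.prems s f3 by (intro Cons.hyps) auto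
  also have "?s3(r := [], r' := rev (?s3 r) @ ?s3 r', r'' := rev (?s3 r) @ ?s3 r'') =
      \<sigma>(r := [], r' := rev (\<sigma> r) @ \<sigma> r', r'' := rev (\<sigma> r) @ \<sigma> r'')"
    using Cons.prems(5-7) s by (auto simp: fun_eq_iff)
  finally have 4: "sexec m (transfer2 r r' r'') ?s3 (\<sigma>(r := [], r' := rev (\<sigma> r) @ \<sigma> r', r'' := rev (\<sigma> r) @ \<sigma> r''))" .
  have t: "top_of \<sigma> r = g" "g = 1 \<or> g = 2" using s Cons.prems(2) by (auto simp: top_of_def)
  have "sexec m (Ite r (\<lambda>g. g = 2) (Seq (pop r) (Seq (push r' 2) (push r'' 2)))
      (Seq (pop r) (Seq (push r' 1) (push r'' 1)))) \<sigma> ?s3"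
    using sexec_Seq[OF 1 sexec_Seq[OF 2 3]] Cons.prems(8,9) t by (intro sexec_Ite) auto
  with t Cons.prems(8,9) show ?case unfolding transfer2_def
    by (intro sexec_LoopT[OF _ _ _ _ 4[unfolded transfer2_def]]) auto
qed

lemma sexec_clear:
  assumes "fits m \<sigma>" "0 \<notin> set (\<sigma> r)" "1 \<le> r" "r < 5"
  shows "sexec m (clear r) \<sigma> (\<sigma>(r := []))"
  using assms
proof (induction "\<sigma> r" arbitrary: \<sigma>)
  case Nil
  then have eq: "\<sigma>(r := []) = \<sigma>" by (auto simp: fun_eq_iff)
  show ?case unfolding clear_def eq by (rule sexec_LoopF) (use Nil in \<open>auto simp: top_of_def\<close>)
next
  case (Cons g xs)
  let ?s1 = "\<sigma>(r := xs)"
  have s: "\<sigma> r = g # xs" using Cons by simp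
  have f1: "fits m ?s1" using Cons.prems(1) s unfolding fits_def
    by (metis Suc_leD fun_upd_apply length_Cons)
  have 1: "sexec m (pop r) \<sigma> ?s1" using Cons.prems s by (intro sexec_pop[where g = g]) auto
  have "sexec m (clear r) ?s1 (?s1(r := []))" using Cons.prems s f1 by (intro Cons.hyps) auto
  then have 2: "sexec m (clear r) ?s1 (\<sigma>(r := []))" by simp
  have "top_of \<sigma> r \<noteq> 0" using s Cons.prems(2) by (auto simp: top_of_def)
  then show ?case using Cons.prems(3,4) 1 2 unfolding clear_def
    by (intro sexec_LoopT[OF _ _ _ 1 2[unfolded clear_def]]) auto
qed

text \<open>Between operations only stack 1 is in use.\<close>

definition stk :: "nat list \<Rightarrow> stacks" where
  "stk xs = (\<lambda>_. [])(1 := xs)"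

text \<open>Every transfer reverses. After \<open>transfer2\<close> the copy on stack 3 has the
  right order, and only an even number of transfers brings it to stack 1 in this order; hence the
  detour over stack 2.\<close>

definition dup :: com where "dup = Seq (shift 1 2) (Seq (transfer2 2 1 3) (Seq (transfer 3 2) (transfer 2 1)))"
definition swap :: com where "swap = Seq (shift 1 2) (Seq (shift 1 3) (Seq (transfer 2 1) (transfer 3 1)))"
definition drop1 :: com where "drop1 = Seq (shift 1 2) (clear 2)"

lemma wf_shift [simp]: "wf_com (shift r r')" by (simp add: shift_def)
lemma wf_transfer [simp]: "wf_com (transfer r r')" by (simp add: transfer_def)
lemma wf_transfer2 [simp]: "wf_com (transfer2 r r' r'')" by (simp add: transfer2_def)
lemma wf_clear [simp]: "wf_com (clear r)" by (simp add: clear_def)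
lemma wf_dup [simp]: "wf_com dup" by (simp add: dup_def)
lemma wf_swap [simp]: "wf_com swap" by (simp add: swap_def)
lemma wf_drop1 [simp]: "wf_com drop1" by (simp add: drop1_def)

lemma fits_upd: "fits m \<sigma> \<Longrightarrow> length xs \<le> m \<Longrightarrow> fits m (\<sigma>(r := xs))"
  by (simp add: fits_def)

lemma fits_stk: "length xs \<le> m \<Longrightarrow> fits m (stk xs)"
  by (simp add: fits_def stk_def)

lemma sexec_drop1:
  assumes "length (code t @ rest) \<le> m"
  shows "sexec m drop1 (stk (code t @ rest)) (stk rest)"
proof -
  have 0: "0 \<notin> set (code t)" using code_symbols[of t] by force
  let ?s = "(stk (code t @ rest))(1 := rest, 2 := rev (code t) @ stk (code t @ rest) 2)"
  have 1: "sexec m (shift 1 2) (stk (code t @ rest)) ?s"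
    using assms by (intro sexec_shift fits_stk) (auto simp: stk_def)
  have "sexec m (clear 2) ?s (?s(2 := []))"
    using assms 0 by (intro sexec_clear fits_upd fits_stk) (auto simp: stk_def)
  also have "?s(2 := []) = stk rest" by (auto simp: stk_def fun_eq_iff)
  finally show ?thesis unfolding drop1_def by (rule sexec_Seq[OF 1])
qed

lemma sexec_swap:
  assumes "length (code a @ code b @ rest) \<le> m"
  shows "sexec m swap (stk (code a @ code b @ rest)) (stk (code b @ code a @ rest))"
proof -
  note sym = code_symbols[of a] code_symbols[of b]
  let ?s0 = "stk (code a @ code b @ rest)"
  let ?s1 = "?s0(1 := code b @ rest, 2 := rev (code a) @ ?s0 2)"
  let ?s2 = "?s1(1 := rest, 3 := rev (code b) @ ?s1 3)"
  let ?s3 = "?s2(2 := [], 1 := rev (?s2 2) @ ?s2 1)"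
  let ?s4 = "?s3(3 := [], 1 := rev (?s3 3) @ ?s3 1)"
  have f0: "fits m ?s0" using assms by (intro fits_stk) auto
  have f1: "fits m ?s1" using assms by (intro fits_upd f0) (auto simp: stk_def)
  have f2: "fits m ?s2" using assms by (intro fits_upd f1) (auto simp: stk_def)
  have f3: "fits m ?s3" using assms by (intro fits_upd f2) (auto simp: stk_def)
  have 1: "sexec m (shift 1 2) ?s0 ?s1"
    using assms by (intro sexec_shift f0) (auto simp: stk_def)
  have 2: "sexec m (shift 1 3) ?s1 ?s2"
    using assms by (intro sexec_shift f1) (auto simp: stk_def)
  have 3: "sexec m (transfer 2 1) ?s2 ?s3"
    using assms sym by (intro sexec_transfer f2) (auto simp: stk_def)
  have 4: "sexec m (transfer 3 1) ?s3 ?s4"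
    using assms sym by (intro sexec_transfer f3) (auto simp: stk_def)
  have "?s4 = stk (code b @ code a @ rest)" by (auto simp: stk_def fun_eq_iff)
  with sexec_Seq[OF 1 sexec_Seq[OF 2 sexec_Seq[OF 3 4]]] show ?thesis unfolding swap_def by simp
qed

lemma sexec_dup:
  assumes "length (code t @ code t @ rest) \<le> m"
  shows "sexec m dup (stk (code t @ rest)) (stk (code t @ code t @ rest))"
proof -
  note sym = code_symbols[of t]
  let ?s0 = "stk (code t @ rest)"
  let ?s1 = "?s0(1 := rest, 2 := rev (code t) @ ?s0 2)"
  let ?s2 = "?s1(2 := [], 1 := rev (?s1 2) @ ?s1 1, 3 := rev (?s1 2) @ ?s1 3)"
  let ?s3 = "?s2(3 := [], 2 := rev (?s2 3) @ ?s2 2)"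
  let ?s4 = "?s3(2 := [], 1 := rev (?s3 2) @ ?s3 1)"
  have f0: "fits m ?s0" using assms by (intro fits_stk) auto
  have f1: "fits m ?s1" using assms by (intro fits_upd f0) (auto simp: stk_def)
  have f2: "fits m ?s2" using assms by (intro fits_upd f1) (auto simp: stk_def)
  have f3: "fits m ?s3" using assms by (intro fits_upd f2) (auto simp: stk_def)
  have 1: "sexec m (shift 1 2) ?s0 ?s1"
    using assms by (intro sexec_shift f0) (auto simp: stk_def)
  have 2: "sexec m (transfer2 2 1 3) ?s1 ?s2"
    using assms sym by (intro sexec_transfer2 f1) (auto simp: stk_def)
  have 3: "sexec m (transfer 3 2) ?s2 ?s3"
    using assms sym by (intro sexec_transfer f2) (auto simp: stk_def)
  have 4: "sexec m (transfer 2 1) ?s3 ?s4"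
    using assms sym by (intro sexec_transfer f3) (auto simp: stk_def)
  have "?s4 = stk (code t @ code t @ rest)" by (auto simp: stk_def fun_eq_iff)
  with sexec_Seq[OF 1 sexec_Seq[OF 2 sexec_Seq[OF 3 4]]] show ?thesis unfolding dup_def by simp
qed


section \<open>Functions computable in polynomial space\<close>

text \<open>Values of all types are handled through one representation, so that programs for trees
  serve every type, and a function that does not change the tree costs nothing. Injectivity makes
  equality decidable on trees.\<close>

class enc =
  fixes tr :: "'a \<Rightarrow> tree"
  assumes tr_inj: "tr x = tr y \<Longrightarrow> x = y"

definition ser :: "'a::enc \<Rightarrow> nat list" where "ser x = code (tr x)"

definition sz :: "'a::enc \<Rightarrow> nat" where "sz x = length (ser x)"

lemma sz_pos [simp]: "0 < sz x" by (simp add: sz_def ser_def)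

lemma one_le_sz [simp]: "Suc 0 \<le> sz x" using sz_pos[of x] by linarith

instantiation tree :: enc begin
definition "tr (t::tree) = t"
instance by standard (simp add: tr_tree_def)
end

text \<open>The first symbol of the code tells the two values apart, 2 meaning \<open>True\<close>.
  Conditionals, loops and the acceptance condition of the machine read just this symbol.\<close>

instantiation bool :: enc begin
definition "tr b = (if b then Node Leaf Leaf else Leaf)"
instance by standard (simp add: tr_bool_def split: if_splits)
end

instantiation prod :: (enc, enc) enc begin
definition "tr p = Node (tr (fst p)) (tr (snd p))"
instance by standard (auto simp: tr_prod_def prod_eq_iff dest: tr_inj)
end

text \<open>A nonempty list has the tree of the pair of its head and tail; \<open>hd\<close>,
  \<open>tl\<close> and Cons are therefore the projections and pairing again.\<close>

instantiation list :: (enc) enc begin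
primrec tr_list where
  "tr_list [] = Leaf"
| "tr_list (x # xs) = Node (tr x) (tr_list xs)"
instance
proof
  fix xs ys :: "'a list"
  show "tr xs = tr ys \<Longrightarrow> xs = ys"
  proof (induction xs arbitrary: ys)
    case Nil then show ?case by (cases ys) auto
  next
    case (Cons x xs) then show ?case by (cases ys) (auto dest: tr_inj)
  qed
qed
end

definition bits_val :: "bool list \<Rightarrow> nat" where
  "bits_val bs = foldr (\<lambda>b n. of_bool b + 2 * n) bs 0"

lemma bits_val_simps [simp]: "bits_val [] = 0" "bits_val (b # bs) = of_bool b + 2 * bits_val bs"
  by (simp_all add: bits_val_def)

lemma bits_val_binary [simp]: "bits_val (binary_bits n) = n"
proof (induction n rule: less_induct)
  case (less n)
  show ?case
    by (cases "n = 0"; subst binary_bits.simps) (use less[of "n div 2"] in \<open>auto simp: of_bool_def\<close>)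
qed

text \<open>Binary notation: values of polynomial size may be exponentially large numbers, as the
  resources other than the diminishing one require.\<close>

instantiation nat :: enc begin
definition "tr n = tr (binary_bits n)"
instance by standard (metis bits_val_binary tr_inj tr_nat_def)
end

lemma ser_list [simp]: "ser [] = [1]" "ser (x # xs) = 2 # ser x @ ser xs"
  by (simp_all add: ser_def)

lemma ser_pair [simp]: "ser (x, y) = 2 # ser x @ ser y"
  by (simp add: ser_def tr_prod_def)

lemma ser_bool [simp]: "ser True = [2, 1, 1]" "ser False = [1]"
  by (simp_all add: ser_def tr_bool_def)

lemma sz_list [simp]: "sz [] = 1" "sz (x # xs) = Suc (sz x + sz xs)"
  by (simp_all add: sz_def)

lemma sz_pair [simp]: "sz (x, y) = Suc (sz x + sz y)"
  by (simp add: sz_def)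

lemma sz_bool [simp]: "sz True = 3" "sz False = 1"
  by (simp_all add: sz_def)

lemma sz_bool_le: "sz (b::bool) \<le> 3" by (cases b) auto

lemma sz_append: "sz (xs @ ys) + 1 = sz xs + sz ys"
  by (induction xs) auto

lemma length_le_sz: "length xs \<le> sz xs"
  by (induction xs) (auto simp: le_Suc_eq)

lemma sz_mem: "x \<in> set xs \<Longrightarrow> sz x \<le> sz xs"
  by (induction xs) auto

lemma sz_list_bound: "(\<And>x. x \<in> set xs \<Longrightarrow> sz x \<le> B) \<Longrightarrow> sz xs \<le> Suc (length xs * Suc B)"
proof (induction xs)
  case (Cons x xs)
  then have "sz x \<le> B" "sz xs \<le> Suc (length xs * Suc B)" by auto
  then show ?case by simp
qed simp


subsection \<open>Polynomially bounded functions\<close>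

definition pol :: "(nat \<Rightarrow> nat) \<Rightarrow> bool" where
  "pol q \<longleftrightarrow> (\<exists>p. \<forall>n. q n \<le> poly p n)"

lemma poly_nat_mono: "m \<le> n \<Longrightarrow> poly (p::nat poly) m \<le> poly p n"
  by (induction p) (auto intro: mult_le_mono add_mono)

lemma pol_poly [intro]: "pol (poly p)" unfolding pol_def by auto

lemma pol_id [intro, simp]: "pol (\<lambda>n. n)"
  unfolding pol_def by (intro exI[of _ "[:0, 1:]"]) auto

lemma pol_const [intro, simp]: "pol (\<lambda>n. c)"
  unfolding pol_def by (intro exI[of _ "[:c:]"]) auto

lemma pol_add [intro]: "pol f \<Longrightarrow> pol g \<Longrightarrow> pol (\<lambda>n. f n + g n)"
  unfolding pol_def by (metis add_mono poly_add)

lemma pol_mult [intro]: "pol f \<Longrightarrow> pol g \<Longrightarrow> pol (\<lambda>n. f n * g n)"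
  unfolding pol_def by (metis mult_le_mono poly_mult)

lemma pol_Suc [intro]: "pol f \<Longrightarrow> pol (\<lambda>n. Suc (f n))"
  using pol_add[of f "\<lambda>_. 1"] by simp

lemma pol_comp [intro]: "pol f \<Longrightarrow> pol (\<lambda>n. poly p (f n))"
  unfolding pol_def by (metis poly_nat_mono poly_pcompose)


subsection \<open>Basic closure properties\<close>

text \<open>Polynomial space on \<open>D\<close>. The content \<open>rest\<close> below the
  argument, and the height \<open>m\<close> that the stack has anyway, are not charged; only
  \<open>poly p (sz x)\<close> is added. A program can thus be used in any context, and the costs of
  consecutive programs add up. Outside \<open>D\<close> nothing is asked, not even
  termination.\<close>

definition ps :: "'a::enc set \<Rightarrow> ('a \<Rightarrow> 'b::enc) \<Rightarrow> bool" where
  "ps D f \<longleftrightarrow> (\<exists>c p. wf_com c \<and> (\<forall>x\<in>D. \<forall>rest m. sz x + length rest \<le> m \<longrightarrow>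
     sexec (m + poly p (sz x)) c (stk (ser x @ rest)) (stk (ser (f x) @ rest))))"

lemma psI:
  assumes "wf_com c" "pol q"
    "\<And>x rest m. x \<in> D \<Longrightarrow> sz x + length rest \<le> m \<Longrightarrow>
       sexec (m + q (sz x)) c (stk (ser x @ rest)) (stk (ser (f x) @ rest))"
  shows "ps D f"
proof -
  from assms(2) obtain p where "q n \<le> poly p n" for n unfolding pol_def by auto
  with assms(1,3) show ?thesis unfolding ps_def
    by (intro exI[of _ c] exI[of _ p]) (meson add_left_mono sexec_mono)
qed

lemma psE:
  assumes "ps D f"
  obtains c p where "wf_com c" "\<And>x rest m. x \<in> D \<Longrightarrow> sz x + length rest \<le> m \<Longrightarrow>
       sexec (m + poly p (sz x)) c (stk (ser x @ rest)) (stk (ser (f x) @ rest))"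
  using assms unfolding ps_def by blast

lemma sexec_length:
  assumes "sexec m c \<sigma> (stk xs)" shows "length xs \<le> m"
proof -
  have "exec m c (on_tapes (\<lambda>_. 0, 0) \<sigma>) (on_tapes (\<lambda>_. 0, 0) (stk xs))"
    using assms by (auto simp: sexec_def)
  from exec_end[OF this] show ?thesis
    by (auto simp: heads_within_def on_tapes_def tape_of_def stk_def dest!: spec[of _ 1])
qed

text \<open>The result lies on stack 1, whose height is a head position; so its size obeys the space
  bound. Closure under composition rests on this.\<close>

lemma ps_size:
  assumes "ps D f" obtains p where "\<And>x. x \<in> D \<Longrightarrow> sz (f x) \<le> poly p (sz x)"
proof -
  from assms obtain c p where "x \<in> D \<Longrightarrow> sz x + length rest \<le> m \<Longrightarrow>
       sexec (m + poly p (sz x)) c (stk (ser x @ rest)) (stk (ser (f x) @ rest))" for x rest m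
    by (rule psE) blast
  note c = this
  have "sz (f x) \<le> sz x + poly p (sz x)" if "x \<in> D" for x
    using sexec_length[OF c[OF that, of "[]" "sz x"]] by (simp add: sz_def)
  then show ?thesis using that[of "[:0, 1:] + p"] by simp
qed

lemma ps_subset: "ps D f \<Longrightarrow> D' \<subseteq> D \<Longrightarrow> ps D' f"
  unfolding ps_def by (meson subsetD)

lemma ps_cong: "ps D f \<Longrightarrow> (\<And>x. x \<in> D \<Longrightarrow> f x = g x) \<Longrightarrow> ps D g"
  unfolding ps_def by simp

lemma ps_cast:
  assumes "\<And>x. x \<in> D \<Longrightarrow> tr (f x) = tr x" shows "ps D f"
proof (rule psI)
  show "wf_com Skip" by simp
  show "pol (\<lambda>_. 0)" by simp
  fix x and rest :: "nat list" and m assume "x \<in> D" "sz x + length rest \<le> m"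
  then show "sexec (m + 0) Skip (stk (ser x @ rest)) (stk (ser (f x) @ rest))"
    using assms[of x] by (auto intro!: sexec_Skip fits_stk simp: ser_def sz_def)
qed

lemma ps_id: "ps D (\<lambda>x. x)"
  by (rule ps_cast) simp

lemma ps_comp_on:
  assumes "ps D g" "ps D' f" "\<And>x. x \<in> D \<Longrightarrow> g x \<in> D'"
  shows "ps D (\<lambda>x. f (g x))"
proof -
  obtain c p where g: "wf_com c" "\<And>x rest m. x \<in> D \<Longrightarrow> sz x + length rest \<le> m \<Longrightarrow>
       sexec (m + poly p (sz x)) c (stk (ser x @ rest)) (stk (ser (g x) @ rest))"
    using assms(1) by (rule psE) blast
  obtain c' p' where f: "wf_com c'" "\<And>x rest m. x \<in> D' \<Longrightarrow> sz x + length rest \<le> m \<Longrightarrow>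
       sexec (m + poly p' (sz x)) c' (stk (ser x @ rest)) (stk (ser (f x) @ rest))"
    using assms(2) by (rule psE) blast
  obtain s where s: "\<And>x. x \<in> D \<Longrightarrow> sz (g x) \<le> poly s (sz x)"
    using ps_size[OF assms(1)] by blast
  show ?thesis
  proof (rule psI[where c = "Seq c c'" and q = "\<lambda>n. poly p n + poly p' (poly s n)"])
    show "wf_com (Seq c c')" using f g by simp
    show "pol (\<lambda>n. poly p n + poly p' (poly s n))" by (intro pol_add pol_comp pol_poly)
    fix x and rest :: "nat list" and m assume x: "x \<in> D" "sz x + length rest \<le> m"
    have 1: "sexec (m + poly p (sz x)) c (stk (ser x @ rest)) (stk (ser (g x) @ rest))"
      using g x by blast
    have "sz (g x) + length rest \<le> m + poly p (sz x)"
      using sexec_length[OF 1] by (simp add: sz_def)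
    from f(2)[OF assms(3)[OF x(1)] this]
    have 2: "sexec (m + poly p (sz x) + poly p' (sz (g x))) c' (stk (ser (g x) @ rest)) (stk (ser (f (g x)) @ rest))" .
    have "poly p' (sz (g x)) \<le> poly p' (poly s (sz x))" using s[OF x(1)] by (rule poly_nat_mono)
    then show "sexec (m + (poly p (sz x) + poly p' (poly s (sz x)))) (Seq c c') (stk (ser x @ rest)) (stk (ser (f (g x)) @ rest))"
      using 1 2 by (intro sexec_Seq[where \<sigma>' = "stk (ser (g x) @ rest)"]) (auto elim!: sexec_mono)
  qed
qed

lemma ps_comp: "ps UNIV f \<Longrightarrow> ps D g \<Longrightarrow> ps D (\<lambda>x. f (g x))"
  by (rule ps_comp_on) auto

lemma stk_upd: "(stk xs)(Suc 0 := ys) = stk ys" "stk xs (Suc 0) = xs"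
  by (auto simp: stk_def fun_eq_iff)

lemma sexec_push1: "length xs < m \<Longrightarrow> sexec m (push 1 g) (stk xs) (stk (g # xs))"
  using sexec_push[OF fits_stk[of xs m], of 1 g] by (simp add: stk_upd)

lemma sexec_pop1: "length xs < m \<Longrightarrow> sexec m (pop 1) (stk (g # xs)) (stk xs)"
  using sexec_pop[OF fits_stk[of "g # xs" m], of 1 g xs] by (simp add: stk_upd)

text \<open>Stated on trees, so that it yields \<open>fst\<close>, \<open>hd\<close>, the tag of a
  \<open>data\<close> value and the left subtree alike.\<close>

lemma ps_left:
  assumes "\<And>x. x \<in> D \<Longrightarrow> \<exists>t. tr x = Node (tr (f x)) t" shows "ps D f"
proof (rule psI[where c = "Seq (pop 1) (Seq swap drop1)" and q = "\<lambda>_. 0"])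
  fix x and rest :: "nat list" and m assume x: "x \<in> D" "sz x + length rest \<le> m"
  obtain t where t: "tr x = Node (tr (f x)) t" using assms[OF x(1)] by auto
  let ?l = "code (tr (f x))"
  have m: "length (2 # ?l @ code t @ rest) \<le> m" using x by (simp add: sz_def ser_def t)
  have "sexec m (pop 1) (stk (2 # ?l @ code t @ rest)) (stk (?l @ code t @ rest))"
    using m by (intro sexec_pop1) auto
  moreover have "sexec m swap (stk (?l @ code t @ rest)) (stk (code t @ ?l @ rest))"
    using m by (intro sexec_swap) auto
  moreover have "sexec m drop1 (stk (code t @ ?l @ rest)) (stk (?l @ rest))"
    using m by (intro sexec_drop1) auto
  ultimately show "sexec (m + 0) (Seq (pop 1) (Seq swap drop1)) (stk (ser x @ rest)) (stk (ser (f x) @ rest))"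
    by (auto simp: ser_def t intro: sexec_Seq)
qed auto

lemma ps_right:
  assumes "\<And>x. x \<in> D \<Longrightarrow> \<exists>t. tr x = Node t (tr (f x))" shows "ps D f"
proof (rule psI[where c = "Seq (pop 1) drop1" and q = "\<lambda>_. 0"])
  fix x and rest :: "nat list" and m assume x: "x \<in> D" "sz x + length rest \<le> m"
  obtain t where t: "tr x = Node t (tr (f x))" using assms[OF x(1)] by auto
  let ?l = "code (tr (f x))"
  have m: "length (2 # code t @ ?l @ rest) \<le> m" using x by (simp add: sz_def ser_def t)
  have "sexec m (pop 1) (stk (2 # code t @ ?l @ rest)) (stk (code t @ ?l @ rest))"
    using m by (intro sexec_pop1) auto
  moreover have "sexec m drop1 (stk (code t @ ?l @ rest)) (stk (?l @ rest))"
    using m by (intro sexec_drop1) auto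
  ultimately show "sexec (m + 0) (Seq (pop 1) drop1) (stk (ser x @ rest)) (stk (ser (f x) @ rest))"
    by (auto simp: ser_def t intro: sexec_Seq)
qed auto

text \<open>While one component is computed, the copy of the argument or the finished component
  waits in \<open>rest\<close>. The second component comes first because it has to end up below the
  other.\<close>

lemma ps_pair:
  assumes "ps D f" "ps D g" shows "ps D (\<lambda>x. (f x, g x))"
proof -
  obtain c p where f: "wf_com c" "\<And>x rest m. x \<in> D \<Longrightarrow> sz x + length rest \<le> m \<Longrightarrow>
       sexec (m + poly p (sz x)) c (stk (ser x @ rest)) (stk (ser (f x) @ rest))"
    using assms(1) by (rule psE) blast
  obtain c' p' where g: "wf_com c'" "\<And>x rest m. x \<in> D \<Longrightarrow> sz x + length rest \<le> m \<Longrightarrow>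
       sexec (m + poly p' (sz x)) c' (stk (ser x @ rest)) (stk (ser (g x) @ rest))"
    using assms(2) by (rule psE) blast
  show ?thesis
  proof (rule psI[where c = "Seq dup (Seq c' (Seq swap (Seq c (push 1 2))))" and q = "\<lambda>n. n + poly p' n + poly p n + 1"])
    show "wf_com (Seq dup (Seq c' (Seq swap (Seq c (push 1 2)))))" using f g by simp
    show "pol (\<lambda>n. n + poly p' n + poly p n + 1)" by (intro pol_add pol_poly pol_id pol_const)
    fix x and rest :: "nat list" and m assume x: "x \<in> D" "sz x + length rest \<le> m"
    let ?m = "m + (sz x + poly p' (sz x) + poly p (sz x) + 1)"
    let ?m1 = "m + sz x + poly p' (sz x)"
    have 1: "sexec ?m dup (stk (ser x @ rest)) (stk (ser x @ ser x @ rest))"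
      using x unfolding ser_def by (intro sexec_dup) (simp add: sz_def ser_def)
    have 2: "sexec ?m1 c' (stk (ser x @ ser x @ rest)) (stk (ser (g x) @ ser x @ rest))"
      using x by (intro g(2)) (simp_all add: sz_def)
    have m1: "length (ser (g x) @ ser x @ rest) \<le> ?m1" by (rule sexec_length[OF 2])
    have 3: "sexec ?m1 swap (stk (ser (g x) @ ser x @ rest)) (stk (ser x @ ser (g x) @ rest))"
      using m1 unfolding ser_def by (intro sexec_swap) (simp add: sz_def ser_def)
    have 4: "sexec (?m1 + poly p (sz x)) c (stk (ser x @ ser (g x) @ rest)) (stk (ser (f x) @ ser (g x) @ rest))"
      using x m1 by (intro f(2)) (simp_all add: sz_def)
    have 5: "sexec ?m (push 1 2) (stk (ser (f x) @ ser (g x) @ rest)) (stk (2 # ser (f x) @ ser (g x) @ rest))"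
      using sexec_length[OF 4] by (intro sexec_push1) simp
    have "sexec ?m (Seq dup (Seq c' (Seq swap (Seq c (push 1 2))))) (stk (ser x @ rest)) (stk (2 # ser (f x) @ ser (g x) @ rest))"
      by (intro sexec_Seq[OF 1] sexec_Seq[OF sexec_mono[OF 2]] sexec_Seq[OF sexec_mono[OF 3]] sexec_Seq[OF sexec_mono[OF 4]] 5) simp_all
    then show "sexec ?m (Seq dup (Seq c' (Seq swap (Seq c (push 1 2))))) (stk (ser x @ rest)) (stk (ser (f x, g x) @ rest))"
      by simp
  qed
qed

primrec pushes :: "nat list \<Rightarrow> com" where
  "pushes [] = Skip"
| "pushes (g # gs) = Seq (pushes gs) (push 1 g)"

lemma wf_pushes: "wf_com (pushes gs) \<longleftrightarrow> (\<forall>g\<in>set gs. g < 6)"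
  by (induction gs) auto

lemma sexec_pushes: "length (gs @ xs) \<le> m \<Longrightarrow> sexec m (pushes gs) (stk xs) (stk (gs @ xs))"
  by (induction gs) (auto intro!: sexec_Skip fits_stk sexec_Seq[OF _ sexec_push1[simplified]])

lemma wf_pushes_ser [simp]: "wf_com (pushes (ser x))"
  using code_symbols[of "tr x"] by (auto simp: wf_pushes ser_def)

lemma ps_const: "ps D (\<lambda>_. c)"
proof (rule psI[where c = "Seq drop1 (pushes (ser c))" and q = "\<lambda>_. sz c"])
  fix x and rest :: "nat list" and m assume x: "x \<in> D" "sz x + length rest \<le> m"
  have "sexec (m + sz c) drop1 (stk (ser x @ rest)) (stk rest)"
    using x unfolding ser_def by (intro sexec_drop1) (simp add: sz_def ser_def)
  moreover have "sexec (m + sz c) (pushes (ser c)) (stk rest) (stk (ser c @ rest))"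
    using x by (intro sexec_pushes) (simp add: sz_def)
  ultimately show "sexec (m + sz c) (Seq drop1 (pushes (ser c))) (stk (ser x @ rest)) (stk (ser c @ rest))"
    by (rule sexec_Seq)
qed auto

lemma top_stk [simp]: "top_of (stk (g # xs)) 1 = g" "top_of (stk (g # xs)) (Suc 0) = g"
  by (simp_all add: top_of_def stk_def)

text \<open>A branch has to be computable only where it is taken. This admits partial operations
  such as \<open>hd\<close>, and the search that is run on valid instances only.\<close>

lemma ps_if:
  assumes "ps D b" "ps (D \<inter> {x. b x}) f" "ps (D \<inter> {x. \<not> b x}) g"
  shows "ps D (\<lambda>x. if b x then f x else g x)"
proof -
  obtain cb pb where b: "wf_com cb" "\<And>x rest m. x \<in> D \<Longrightarrow> sz x + length rest \<le> m \<Longrightarrow>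
       sexec (m + poly pb (sz x)) cb (stk (ser x @ rest)) (stk (ser (b x) @ rest))"
    using assms(1) by (rule psE) blast
  obtain cf pf where f: "wf_com cf" "\<And>x rest m. x \<in> D \<inter> {x. b x} \<Longrightarrow> sz x + length rest \<le> m \<Longrightarrow>
       sexec (m + poly pf (sz x)) cf (stk (ser x @ rest)) (stk (ser (f x) @ rest))"
    using assms(2) by (rule psE) blast
  obtain cg pg where g: "wf_com cg" "\<And>x rest m. x \<in> D \<inter> {x. \<not> b x} \<Longrightarrow> sz x + length rest \<le> m \<Longrightarrow>
       sexec (m + poly pg (sz x)) cg (stk (ser x @ rest)) (stk (ser (g x) @ rest))"
    using assms(3) by (rule psE) blast
  let ?c = "Seq dup (Seq cb (Ite 1 (\<lambda>s. s = 2) (Seq drop1 cf) (Seq drop1 cg)))"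
  show ?thesis
  proof (rule psI[where c = ?c and q = "\<lambda>n. n + poly pb n + poly pf n + poly pg n"])
    show "wf_com ?c" using b f g by simp
    show "pol (\<lambda>n. n + poly pb n + poly pf n + poly pg n)" by (intro pol_add pol_poly pol_id)
    fix x and rest :: "nat list" and m assume x: "x \<in> D" "sz x + length rest \<le> m"
    let ?m = "m + (sz x + poly pb (sz x) + poly pf (sz x) + poly pg (sz x))"
    have 1: "sexec ?m dup (stk (ser x @ rest)) (stk (ser x @ ser x @ rest))"
      using x unfolding ser_def by (intro sexec_dup) (simp add: sz_def ser_def)
    have 2: "sexec (m + sz x + poly pb (sz x)) cb (stk (ser x @ ser x @ rest)) (stk (ser (b x) @ ser x @ rest))"
      using x by (intro b(2)) (simp_all add: sz_def)
    have 3: "sexec ?m drop1 (stk (ser (b x) @ ser x @ rest)) (stk (ser x @ rest))"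
      using sexec_length[OF 2] unfolding ser_def by (intro sexec_drop1) auto
    have 4: "sexec ?m (if b x then cf else cg) (stk (ser x @ rest)) (stk (ser (if b x then f x else g x) @ rest))"
      using f(2)[of x rest m] g(2)[of x rest m] x by (auto elim!: sexec_mono)
    have 5: "top_of (stk (ser (b x) @ ser x @ rest)) 1 = (if b x then 2 else 1)" by simp
    have "sexec ?m (Ite 1 (\<lambda>s. s = 2) (Seq drop1 cf) (Seq drop1 cg)) (stk (ser (b x) @ ser x @ rest)) (stk (ser (if b x then f x else g x) @ rest))"
      using sexec_Seq[OF 3 4] by (intro sexec_Ite) (auto simp: 5 split: if_splits)
    then show "sexec ?m ?c (stk (ser x @ rest)) (stk (ser (if b x then f x else g x) @ rest))"
      by (intro sexec_Seq[OF 1] sexec_Seq[OF sexec_mono[OF 2]]) simp_all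
  qed
qed

lemma ps_is_Node:
  assumes "\<And>x. x \<in> D \<Longrightarrow> f x \<longleftrightarrow> tr x \<noteq> Leaf" shows "ps D f"
proof -
  let ?c = "Ite 1 (\<lambda>s. s = 2) (Seq drop1 (pushes (ser True))) (Seq drop1 (pushes (ser False)))"
  show ?thesis
  proof (rule psI[where c = ?c and q = "\<lambda>_. 3"])
    fix x and rest :: "nat list" and m assume x: "x \<in> D" "sz x + length rest \<le> m"
    have 1: "sexec (m + 3) drop1 (stk (ser x @ rest)) (stk rest)"
      using x unfolding ser_def by (intro sexec_drop1) (simp add: sz_def ser_def)
    have 2: "sexec (m + 3) (pushes (ser b)) (stk rest) (stk (ser b @ rest))" for b :: bool
      using x sz_bool_le[of b] by (intro sexec_pushes) (simp add: sz_def)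
    have 3: "top_of (stk (ser x @ rest)) 1 = (if f x then 2 else 1)"
      using assms[OF x(1)] by (cases "tr x") (simp_all add: ser_def)
    show "sexec (m + 3) ?c (stk (ser x @ rest)) (stk (ser (f x) @ rest))"
      using sexec_Seq[OF 1 2[of "f x"]] 3 by (intro sexec_Ite; cases "f x"; simp del: ser_bool pushes.simps)
  qed (auto simp: wf_pushes)
qed

text \<open>The source of all iteration. The number \<open>N x\<close> of rounds may be exponential
  and is never computed: the test \<open>t\<close> ends the loop, and only the sizes of the iterates
  matter.\<close>

lemma ps_funpow:
  assumes t: "ps E t" and g: "ps (E \<inter> {x. t x}) g" and q: "pol q"
    and run: "\<And>x i. x \<in> D \<Longrightarrow> i \<le> N x \<Longrightarrow> (g ^^ i) x \<in> E \<and> sz ((g ^^ i) x) \<le> q (sz x) \<and> (t ((g ^^ i) x) \<longleftrightarrow> i < N x)"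
  shows "ps D (\<lambda>x. (g ^^ N x) x)"
proof -
  obtain ct pt where t: "wf_com ct" "\<And>x rest m. x \<in> E \<Longrightarrow> sz x + length rest \<le> m \<Longrightarrow>
       sexec (m + poly pt (sz x)) ct (stk (ser x @ rest)) (stk (ser (t x) @ rest))"
    using t by (rule psE) blast
  obtain cg pg where g: "wf_com cg" "\<And>x rest m. x \<in> E \<inter> {x. t x} \<Longrightarrow> sz x + length rest \<le> m \<Longrightarrow>
       sexec (m + poly pg (sz x)) cg (stk (ser x @ rest)) (stk (ser (g x) @ rest))"
    using g by (rule psE) blast
  obtain p where p: "\<And>n. q n \<le> poly p n" using q unfolding pol_def by auto
  let ?body = "Seq drop1 (Seq cg (Seq dup ct))"
  let ?loop = "Loop 1 (\<lambda>s. s = 2) ?body"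
  let ?c = "Seq dup (Seq ct (Seq ?loop drop1))"
  let ?q = "\<lambda>n. poly p n + poly p n + poly pt (poly p n) + poly pg (poly p n)"
  show ?thesis
  proof (rule psI[where c = ?c and q = ?q])
    show "wf_com ?c" using t g by simp
    show "pol ?q" by (intro pol_add pol_poly pol_comp)
    fix x and rest :: "nat list" and m assume x: "x \<in> D" "sz x + length rest \<le> m"
    let ?m = "m + ?q (sz x)"
    define y where "y i = (g ^^ i) x" for i
    have yE: "y i \<in> E" and ysz: "sz (y i) \<le> poly p (sz x)" and yt: "t (y i) \<longleftrightarrow> i < N x" if "i \<le> N x" for i
      using run[OF x(1) that] p[of "sz x"] unfolding y_def by auto
    have test: "sexec ?m (Seq dup ct) (stk (ser (y i) @ rest)) (stk (ser (t (y i)) @ ser (y i) @ rest))" if i: "i \<le> N x" for i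
    proof -
      have 1: "sexec ?m dup (stk (ser (y i) @ rest)) (stk (ser (y i) @ ser (y i) @ rest))"
        using x ysz[OF i] unfolding ser_def by (intro sexec_dup) (simp add: sz_def ser_def)
      have "sexec (m + poly p (sz x) + poly p (sz x) + poly pt (sz (y i))) ct (stk (ser (y i) @ ser (y i) @ rest)) (stk (ser (t (y i)) @ ser (y i) @ rest))"
        using x ysz[OF i] yE[OF i] by (intro t(2)) (simp_all add: sz_def)
      then have 2: "sexec ?m ct (stk (ser (y i) @ ser (y i) @ rest)) (stk (ser (t (y i)) @ ser (y i) @ rest))"
        by (rule sexec_mono) (use poly_nat_mono[OF ysz[OF i], of pt] in simp)
      from 1 2 show ?thesis by (rule sexec_Seq)
    qed
    have drop: "sexec ?m drop1 (stk (ser (t (y i)) @ ser (y i) @ rest)) (stk (ser (y i) @ rest))" if i: "i \<le> N x" for i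
      using sexec_length[OF test[OF i]] unfolding ser_def by (intro sexec_drop1) auto
    have "sexec ?m ?loop (stk (ser (t (y i)) @ ser (y i) @ rest)) (stk (ser (t (y (N x))) @ ser (y (N x)) @ rest))" if i: "i \<le> N x" for i
      using i
    proof (induction i rule: inc_induct)
      case base
      have "fits ?m (stk (ser (t (y (N x))) @ ser (y (N x)) @ rest))"
        by (intro fits_stk sexec_length[OF test]) simp
      then show ?case using yt[of "N x"] by (intro sexec_LoopF) auto
    next
      case (step i)
      have "sexec (m + poly p (sz x) + poly pg (sz (y i))) cg (stk (ser (y i) @ rest)) (stk (ser (y (Suc i)) @ rest))"
        using x ysz[of i] yE[of i] yt[of i] step.hyps g(2)[of "y i" rest] by (simp add: y_def)
      then have 2: "sexec ?m cg (stk (ser (y i) @ rest)) (stk (ser (y (Suc i)) @ rest))"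
        by (rule sexec_mono) (use poly_nat_mono[OF ysz[of i], of pg] step.hyps in simp)
      have "sexec ?m (Seq dup ct) (stk (ser (y (Suc i)) @ rest)) (stk (ser (t (y (Suc i))) @ ser (y (Suc i)) @ rest))"
        using step.hyps by (intro test) simp
      from sexec_Seq[OF drop sexec_Seq[OF 2 this]] step.hyps
      have "sexec ?m ?body (stk (ser (t (y i)) @ ser (y i) @ rest)) (stk (ser (t (y (Suc i))) @ ser (y (Suc i)) @ rest))"
        by simp
      then show ?case using yt[of i] step.hyps by (intro sexec_LoopT[OF _ _ _ _ step.IH]) auto
    qed
    from this[of 0] have 3: "sexec ?m ?loop (stk (ser (t (y 0)) @ ser (y 0) @ rest)) (stk (ser (t (y (N x))) @ ser (y (N x)) @ rest))"
      by simp
    \<comment> \<open>The entry test was treated as the unit \<open>Seq dup ct\<close>, whereas the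
      program is bracketed to the right.\<close>
    have assoc: "sexec ?m (Seq a (Seq b d)) \<sigma> \<sigma>''" if "sexec ?m (Seq a b) \<sigma> \<sigma>'" "sexec ?m d \<sigma>' \<sigma>''" for a b d \<sigma> \<sigma>' \<sigma>''
      using that unfolding sexec_def by (fastforce elim: exec.cases intro: exec_Seq)
    have "sexec ?m ?c (stk (ser (y 0) @ rest)) (stk (ser (y (N x)) @ rest))"
      using test[of 0] sexec_Seq[OF 3 drop[of "N x"]] by (intro assoc) auto
    then show "sexec ?m ?c (stk (ser x @ rest)) (stk (ser ((g ^^ N x) x) @ rest))"
      by (simp add: y_def)
  qed
qed


subsection \<open>Expressions\<close>

named_theorems ps_intros

declare ps_id [ps_intros] ps_const [ps_intros] ps_pair [ps_intros]

lemma ps_retype: "ps D g \<Longrightarrow> (\<And>x. x \<in> D \<Longrightarrow> tr (f x) = tr (g x)) \<Longrightarrow> ps D f"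
  unfolding ps_def by (simp add: ser_def)

lemma ps_comp2: "ps UNIV (\<lambda>p. f (fst p) (snd p)) \<Longrightarrow> ps D g \<Longrightarrow> ps D h \<Longrightarrow> ps D (\<lambda>x. f (g x) (h x))"
  using ps_comp[OF _ ps_pair, of "\<lambda>p. f (fst p) (snd p)"] by simp

lemma ps_comp3: "ps UNIV (\<lambda>p. f (fst p) (fst (snd p)) (snd (snd p))) \<Longrightarrow> ps D g \<Longrightarrow> ps D h \<Longrightarrow> ps D k \<Longrightarrow>
    ps D (\<lambda>x. f (g x) (h x) (k x))"
  using ps_comp2[of "\<lambda>a p. f a (fst p) (snd p)" D g "\<lambda>x. (h x, k x)"] by (simp add: ps_pair)

lemma ps_comp4: "ps UNIV (\<lambda>p. f (fst p) (fst (snd p)) (fst (snd (snd p))) (snd (snd (snd p)))) \<Longrightarrow>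
    ps D g \<Longrightarrow> ps D h \<Longrightarrow> ps D k \<Longrightarrow> ps D l \<Longrightarrow> ps D (\<lambda>x. f (g x) (h x) (k x) (l x))"
  using ps_comp3[of "\<lambda>a b p. f a b (fst p) (snd p)" D g h "\<lambda>x. (k x, l x)"] by (simp add: ps_pair)

lemma ps_fst [ps_intros]: "ps D f \<Longrightarrow> ps D (\<lambda>x. fst (f x))"
  by (rule ps_comp[rotated], assumption, rule ps_left) (auto simp: tr_prod_def)

lemma ps_snd [ps_intros]: "ps D f \<Longrightarrow> ps D (\<lambda>x. snd (f x))"
  by (rule ps_comp[rotated], assumption, rule ps_right) (auto simp: tr_prod_def)

lemma ps_If [ps_intros]: "ps D b \<Longrightarrow> ps D f \<Longrightarrow> ps D g \<Longrightarrow> ps D (\<lambda>x. if b x then f x else g x)"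
  by (intro ps_if) (auto elim: ps_subset)

lemma ps_conj [ps_intros]: "ps D f \<Longrightarrow> ps D g \<Longrightarrow> ps D (\<lambda>x. f x \<and> g x)"
  by (rule ps_cong[OF ps_If[OF _ _ ps_const[of _ False], of D f g]]) auto

lemma ps_disj [ps_intros]: "ps D f \<Longrightarrow> ps D g \<Longrightarrow> ps D (\<lambda>x. f x \<or> g x)"
  by (rule ps_cong[OF ps_If[OF _ ps_const[of _ True], of D f g]]) auto

lemma ps_imp [ps_intros]: "ps D f \<Longrightarrow> ps D g \<Longrightarrow> ps D (\<lambda>x. f x \<longrightarrow> g x)"
  by (rule ps_cong[OF ps_If[OF _ _ ps_const[of _ True], of D f g]]) auto

lemma ps_not [ps_intros]: "ps D f \<Longrightarrow> ps D (\<lambda>x. \<not> f x)"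
  by (rule ps_cong[OF ps_If[OF _ ps_const[of _ False] ps_const[of _ True], of D f]]) auto

lemma ps_Cons [ps_intros]: "ps D f \<Longrightarrow> ps D g \<Longrightarrow> ps D (\<lambda>x. f x # g x)"
  by (rule ps_retype[OF ps_pair]) (auto simp: tr_prod_def)

lemma ps_hd: "ps (- {[]}) hd"
  by (rule ps_left) (auto simp: neq_Nil_conv)

lemma ps_tl: "ps (- {[]}) tl"
  by (rule ps_right) (auto simp: neq_Nil_conv)

lemma ps_neq_Nil [ps_intros]: "ps D f \<Longrightarrow> ps D (\<lambda>x. f x \<noteq> [])"
proof (rule ps_comp[where f = "\<lambda>l. l \<noteq> []"], rule ps_is_Node)
  show "l \<noteq> [] \<longleftrightarrow> tr l \<noteq> Leaf" for l :: "'b list" by (cases l) auto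
qed

lemma ps_eq_Nil [ps_intros]: "ps D f \<Longrightarrow> ps D (\<lambda>x. f x = [])"
  using ps_not[OF ps_neq_Nil] by auto

text \<open>The variables bound by the pattern become components of a tuple, and the body is a
  function of that tuple. The rules for \<open>map\<close>, \<open>filter\<close> and bounded
  quantifiers use the same device.\<close>

lemma ps_case_list [ps_intros]:
  assumes "ps D l" "ps D f" "ps UNIV (\<lambda>p. g (fst p) (fst (snd p)) (snd (snd p)))"
  shows "ps D (\<lambda>x. case l x of [] \<Rightarrow> f x | y # ys \<Rightarrow> g x y ys)"
proof -
  let ?E = "D \<inter> {x. \<not> l x = []}"
  have "ps ?E (\<lambda>x. hd (l x))" "ps ?E (\<lambda>x. tl (l x))"
    by (rule ps_comp_on[OF ps_subset[OF assms(1)] ps_hd] ps_comp_on[OF ps_subset[OF assms(1)] ps_tl]; auto)+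
  then have "ps ?E (\<lambda>x. g x (hd (l x)) (tl (l x)))"
    by (intro ps_comp3[OF assms(3)] ps_id)
  then have "ps D (\<lambda>x. if l x = [] then f x else g x (hd (l x)) (tl (l x)))"
    using assms(1,2) by (intro ps_if ps_eq_Nil) (auto elim: ps_subset)
  then show ?thesis by (rule ps_cong) (auto split: list.split)
qed

lemma ps_case_prod [ps_intros]:
  "ps D (\<lambda>x. g x (fst (f x)) (snd (f x))) \<Longrightarrow> ps D (\<lambda>x. case f x of (a, b) \<Rightarrow> g x a b)"
  by (simp add: case_prod_beta)


subsection \<open>Recursion on lists\<close>

text \<open>Reversal comes first because structural recursion, proved from it, consumes a list from
  its last element.\<close>

lemma ps_rev [ps_intros]:
  fixes l :: "'d::enc \<Rightarrow> 'a::enc list"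
  shows "ps D l \<Longrightarrow> ps D (\<lambda>x. rev (l x))"
proof -
  let ?g = "\<lambda>s. (tl (fst s), hd (fst s) # snd s) :: 'a list \<times> 'a list"
  let ?t = "\<lambda>s::'a list \<times> 'a list. fst s \<noteq> []"
  have iter: "(?g ^^ i) (l, a) = (drop i l, rev (take i l) @ a)" if "i \<le> length l" for i and l a :: "'a list"
    using that
  proof (induction i)
    case (Suc i)
    then show ?case by (simp add: drop_Suc tl_drop hd_drop_conv_nth take_Suc_conv_app_nth)
  qed simp
  have sz: "sz (drop i l) + sz (rev (take i l)) \<le> Suc (sz l)" for i and l :: "'a list"
  proof -
    have r: "sz (rev xs) = sz xs" for xs :: "'a list"
    proof (induction xs)
      case (Cons a xs)
      then show ?case using sz_append[of "rev xs" "[a]"] by simp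
    qed simp
    show ?thesis using sz_append[of "take i l" "drop i l"] by (simp add: r)
  qed
  have "ps (UNIV \<inter> {s. ?t s}) (\<lambda>s. hd (fst s))" "ps (UNIV \<inter> {s. ?t s}) (\<lambda>s. tl (fst s))"
    by (rule ps_comp_on[OF ps_fst[OF ps_id] ps_hd] ps_comp_on[OF ps_fst[OF ps_id] ps_tl]; simp)+
  then have g: "ps (UNIV \<inter> {s. ?t s}) ?g" by (intro ps_intros)
  have "ps {s. snd s = []} (\<lambda>s. (?g ^^ length (fst s)) s)"
  proof (rule ps_funpow[OF _ g, where q = "\<lambda>n. n + 2"])
    show "ps UNIV ?t" by (intro ps_intros)
    show "pol (\<lambda>n. n + 2)" by (intro pol_add) auto
    fix x :: "'a list \<times> 'a list" and i assume "x \<in> {s. snd s = []}" "i \<le> length (fst x)"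
    then show "(?g ^^ i) x \<in> UNIV \<and> sz ((?g ^^ i) x) \<le> sz x + 2 \<and> (?t ((?g ^^ i) x) \<longleftrightarrow> i < length (fst x))"
      using sz[of i "fst x"] by (cases x) (auto simp: iter)
  qed
  from ps_snd[OF this] have "ps {s :: 'a list \<times> 'a list. snd s = []} (\<lambda>s. rev (fst s) :: 'a list)"
    by (rule ps_cong) (auto simp: iter)
  from ps_comp_on[OF ps_pair[OF ps_id ps_const] this]
  have "ps UNIV (rev :: 'a list \<Rightarrow> 'a list)" by simp
  then show "ps D l \<Longrightarrow> ps D (\<lambda>x. rev (l x))" by (rule ps_comp[of rev])
qed

lemma sz_drop: "sz (drop i xs) \<le> sz xs"
  using sz_append[of "take i xs" "drop i xs"] sz_pos[of "take i xs"] unfolding append_take_drop_id by linarith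

lemma sz_take: "sz (take i xs) \<le> sz xs"
  using sz_append[of "take i xs" "drop i xs"] sz_pos[of "drop i xs"] unfolding append_take_drop_id by linarith

lemma sz_rev [simp]: "sz (rev xs) = sz xs"
proof (induction xs)
  case (Cons a xs)
  then show ?case using sz_append[of "rev xs" "[a]"] by simp
qed simp

text \<open>The loop state holds the suffix treated so far with its value, and the remaining prefix
  reversed. Working from the end, the value for \<open>xs\<close> is at hand when
  \<open>x # xs\<close> is reached. The size bound on \<open>r\<close> must be assumed: a step
  computable in polynomial space could still double its result in each round.\<close>

lemma ps_primrec:
  fixes r :: "'e::enc \<Rightarrow> 'x::enc list \<Rightarrow> 'r::enc"
  assumes Nil: "\<And>e. r e [] = a e" and Cons: "\<And>e x xs. r e (x # xs) = g e x xs (r e xs)"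
    and a: "ps UNIV a"
    and g: "ps UNIV (\<lambda>p. g (fst p) (fst (snd p)) (fst (snd (snd p))) (snd (snd (snd p))))"
    and q: "pol q" and bound: "\<And>e xs. sz (r e xs) \<le> q (sz (e, xs))"
    and l: "ps D l" and e: "ps D e"
  shows "ps D (\<lambda>x. r (e x) (l x))"
proof -
  obtain p where p: "\<And>n. q n \<le> poly p n" using q unfolding pol_def by auto
  let ?g = "\<lambda>s. (fst s, (hd (snd (snd s)) # fst (fst (snd s)),
      g (fst s) (hd (snd (snd s))) (fst (fst (snd s))) (snd (fst (snd s)))), tl (snd (snd s)))
      :: 'e \<times> ('x list \<times> 'r) \<times> 'x list"
  let ?t = "\<lambda>s::'e \<times> ('x list \<times> 'r) \<times> 'x list. snd (snd s) \<noteq> []"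
  let ?D = "{s :: 'e \<times> ('x list \<times> 'r) \<times> 'x list. \<exists>e xs. s = (e, ([], r e []), rev xs)}"
  have iter: "(?g ^^ i) (e, ([], r e []), rev xs) =
      (e, (drop (length xs - i) xs, r e (drop (length xs - i) xs)), rev (take (length xs - i) xs))"
    if "i \<le> length xs" for i e xs
    using that
  proof (induction i)
    case (Suc i)
    let ?k = "length xs - Suc i"
    have k: "length xs - i = Suc ?k" "?k < length xs" using Suc.prems by auto
    have d: "drop ?k xs = xs ! ?k # drop (Suc ?k) xs" using k by (simp add: Cons_nth_drop_Suc)
    have t: "rev (take (Suc ?k) xs) = xs ! ?k # rev (take ?k xs)" using k(2) by (simp add: take_Suc_conv_app_nth)
    show ?case using Suc k by (simp add: d t Cons)
  qed simp
  have hd: "ps (UNIV \<inter> {s. ?t s}) (\<lambda>s. hd (snd (snd s)))" "ps (UNIV \<inter> {s. ?t s}) (\<lambda>s. tl (snd (snd s)))"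
    by (rule ps_comp_on[OF ps_snd[OF ps_snd[OF ps_id]] ps_hd] ps_comp_on[OF ps_snd[OF ps_snd[OF ps_id]] ps_tl]; simp)+
  then have G: "ps (UNIV \<inter> {s. ?t s}) ?g" by (intro ps_intros ps_comp4[OF g])
  have "ps ?D (\<lambda>s. (?g ^^ length (snd (snd s))) s)"
  proof (rule ps_funpow[OF _ G, where q = "\<lambda>n. 3 * n + poly p n + 4"])
    show "ps UNIV ?t" by (intro ps_intros)
    show "pol (\<lambda>n. 3 * n + poly p n + 4)" by (intro pol_add pol_mult) auto
    fix s :: "'e \<times> ('x list \<times> 'r) \<times> 'x list" and i assume s: "s \<in> ?D" "i \<le> length (snd (snd s))"
    then obtain e xs where xs: "s = (e, ([], r e []), rev xs)" "i \<le> length xs" by auto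
    let ?k = "length xs - i"
    have "sz (r e (drop ?k xs)) \<le> poly p (sz (e, drop ?k xs))" using bound p order_trans by blast
    also have "\<dots> \<le> poly p (sz s)" using sz_drop[of ?k xs] by (intro poly_nat_mono) (simp add: xs)
    finally have "sz ((?g ^^ i) s) \<le> 3 * sz s + poly p (sz s) + 4"
      using sz_drop[of ?k xs] sz_take[of ?k xs] by (simp add: xs iter)
    then show "(?g ^^ i) s \<in> UNIV \<and> sz ((?g ^^ i) s) \<le> 3 * sz s + poly p (sz s) + 4 \<and>
        (?t ((?g ^^ i) s) \<longleftrightarrow> i < length (snd (snd s)))"
      using xs by (auto simp: iter)
  qed
  from ps_snd[OF ps_fst[OF ps_snd[OF this]]]
  have "ps ?D (\<lambda>s. r (fst s) (rev (snd (snd s))))"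
    by (rule ps_cong) (auto simp: iter)
  have "ps D (\<lambda>x. (e x, ([], r (e x) []), rev (l x)))"
    unfolding Nil by (intro ps_intros ps_comp[OF a] e l)
  from ps_comp_on[OF this \<open>ps ?D (\<lambda>s. r (fst s) (rev (snd (snd s))))\<close>]
  show ?thesis by auto
qed

lemma ps_append [ps_intros]:
  fixes f g :: "'a::enc \<Rightarrow> 'b::enc list"
  assumes f: "ps D f" and g: "ps D g" shows "ps D (\<lambda>x. f x @ g x)"
proof -
  have bound: "sz (xs @ e) \<le> sz (e, xs)" for e xs :: "'b list"
    using sz_append[of xs e] by simp
  show ?thesis
    by (rule ps_primrec[where r = "\<lambda>e xs. xs @ e" and a = "\<lambda>e. e" and g = "\<lambda>e x xs r. x # r" and q = "\<lambda>n. n", OF _ _ _ _ _ bound f g]) (rule ps_intros | simp)+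
qed

lemma ps_size_UNIV: "ps UNIV f \<Longrightarrow> \<exists>p. \<forall>x. sz (f x) \<le> poly p (sz x)"
  by (rule ps_size) auto

lemma ps_map [ps_intros]:
  assumes f: "ps UNIV (\<lambda>p. f (fst p) (snd p))" and l: "ps D l"
  shows "ps D (\<lambda>x. map (f x) (l x))"
proof -
  from ps_size_UNIV[OF f] obtain p where "\<forall>x. sz (f (fst x) (snd x)) \<le> poly p (sz x)" ..
  then have p: "sz (f (fst x) (snd x)) \<le> poly p (sz x)" for x by blast
  let ?q = "\<lambda>n. Suc (n * Suc (poly p n))"
  have pol: "pol ?q" by (intro pol_Suc pol_mult) auto
  have bound: "sz (map (f e) xs) \<le> ?q (sz (e, xs))" for e xs
  proof -
    let ?n = "sz (e, xs)"
    have "sz (map (f e) xs) \<le> Suc (length (map (f e) xs) * Suc (poly p ?n))"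
    proof (rule sz_list_bound)
      fix y assume "y \<in> set (map (f e) xs)"
      then obtain x where x: "x \<in> set xs" "y = f e x" by auto
      have "sz y \<le> poly p (sz (e, x))" using p[of "(e, x)"] x by simp
      also have "\<dots> \<le> poly p ?n" using sz_mem[OF x(1)] by (intro poly_nat_mono) simp
      finally show "sz y \<le> poly p ?n" .
    qed
    also have "\<dots> \<le> Suc (?n * Suc (poly p ?n))"
      unfolding length_map Suc_le_mono by (intro mult_le_mono1) (use length_le_sz[of xs] in simp)
    finally show ?thesis .
  qed
  show ?thesis
    by (rule ps_primrec[where r = "\<lambda>e xs. map (f e) xs" and a = "\<lambda>e. []" and g = "\<lambda>e x xs r. f e x # r",
          OF _ _ _ _ pol bound l ps_id])
      (rule ps_intros ps_comp2[OF f] | simp)+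
qed

lemma sz_filter: "sz (filter P xs) \<le> sz xs"
  by (induction xs) auto

lemma ps_filter [ps_intros]:
  assumes f: "ps UNIV (\<lambda>p. P (fst p) (snd p))" and l: "ps D l"
  shows "ps D (\<lambda>x. filter (P x) (l x))"
proof -
  have bound: "sz (filter (P e) xs) \<le> sz (e, xs)" for e xs
    using sz_filter[of "P e" xs] by simp
  show ?thesis
    by (rule ps_primrec[where r = "\<lambda>e xs. filter (P e) xs" and a = "\<lambda>e. []" and g = "\<lambda>e x xs r. if P e x then x # r else r"
        and q = "\<lambda>n. n", OF _ _ _ _ _ bound l ps_id]) (rule ps_intros ps_comp2[OF f] | simp)+
qed

lemma ps_ball [ps_intros]:
  assumes f: "ps UNIV (\<lambda>p. P (fst p) (snd p))" and l: "ps D l"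
  shows "ps D (\<lambda>x. \<forall>y\<in>set (l x). P x y)"
proof -
  have bound: "sz (\<forall>y\<in>set xs. P e y) \<le> 3" for e xs by (rule sz_bool_le)
  show ?thesis
    by (rule ps_primrec[where r = "\<lambda>e xs. \<forall>y\<in>set xs. P e y" and a = "\<lambda>e. True" and g = "\<lambda>e x xs r. P e x \<and> r"
        and q = "\<lambda>n. 3", OF _ _ _ _ _ bound l ps_id]) (rule ps_intros ps_comp2[OF f] | simp)+
qed

lemma ps_bex [ps_intros]:
  assumes f: "ps UNIV (\<lambda>p. P (fst p) (snd p))" and l: "ps D l"
  shows "ps D (\<lambda>x. \<exists>y\<in>set (l x). P x y)"
  using ps_not[OF ps_ball[of "\<lambda>x y. \<not> P x y", OF ps_not[OF f] l]] by simp

lemma sz_concat: "sz (concat xss) \<le> sz xss"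
proof (induction xss)
  case (Cons xs xss)
  then show ?case using sz_append[of xs "concat xss"] by simp
qed simp

lemma ps_concat [ps_intros]:
  assumes l: "ps D l"
  shows "ps D (\<lambda>x. concat (l x))"
proof -
  have bound: "sz (concat xss) \<le> sz (e, xss)" for e :: 'a and xss :: "'b list list"
    using sz_concat[of xss] by simp
  show ?thesis
    by (rule ps_primrec[where r = "\<lambda>e xs. concat xs" and a = "\<lambda>e. []" and g = "\<lambda>e x xs r. x @ r"
        and q = "\<lambda>n. n", OF _ _ _ _ _ bound l ps_id]) (rule ps_intros | simp)+
qed

lemma sz_zip: "sz (zip xs ys) \<le> sz xs + sz ys"
  by (induction xs ys rule: list_induct2') auto

text \<open>In a recursion on one list the other one would be a fixed parameter, so the unread part
  of the second list is carried in the accumulator of a fold. Since \<open>foldr\<close> starts at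
  the last element, it gets the reversed list and delivers the reversed result.\<close>

lemma ps_zip [ps_intros]:
  fixes f :: "'a::enc \<Rightarrow> 'b::enc list" and g :: "'a \<Rightarrow> 'c::enc list"
  assumes f: "ps D f" and g: "ps D g"
  shows "ps D (\<lambda>x. zip (f x) (g x))"
proof -
  let ?g = "\<lambda>x acc. case snd acc of [] \<Rightarrow> acc | y # ys \<Rightarrow> ((x, y) # fst acc, ys)"
  have zip_take: "zip xs (take (length xs) zs) = zip xs zs" for xs :: "'b list" and zs :: "'c list"
    by (induction xs zs rule: list_induct2') auto
  have eq: "foldr ?g xs ([], zs) = (rev (zip (rev xs) zs), drop (length xs) zs)" for xs :: "'b list" and zs :: "'c list"
  proof (induction xs)
    case (Cons x xs)
    have "zip (rev xs @ [x]) zs = zip (rev xs) zs @ zip [x] (drop (length xs) zs)"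
      using zip_take[of "rev xs" zs] by (simp add: zip_append1)
    moreover have "drop (Suc (length xs)) zs = tl (drop (length xs) zs)"
      by (simp add: drop_Suc tl_drop)
    ultimately show ?case using Cons.IH by (cases "drop (length xs) zs") auto
  qed simp
  have bound: "sz (foldr ?g xs ([], e)) \<le> sz (e, xs) + sz (e, xs)" for e :: "'c list" and xs :: "'b list"
    using sz_zip[of "rev xs" e] sz_drop[of "length xs" e] by (simp add: eq)
  have "ps D (\<lambda>x. foldr ?g (rev (f x)) ([], g x))"
    by (rule ps_primrec[where r = "\<lambda>e xs. foldr ?g xs ([], e)" and a = "\<lambda>e. ([], e)" and g = "\<lambda>e x xs r. ?g x r"
        and q = "\<lambda>n. n + n", OF _ _ _ _ _ bound ps_rev[OF f] g]) (rule ps_intros pol_add | simp)+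
  from ps_rev[OF ps_fst[OF this]] show ?thesis by (simp add: eq)
qed


subsection \<open>Natural numbers\<close>

primrec bits_Suc :: "bool list \<Rightarrow> bool list" where
  "bits_Suc [] = [True]"
| "bits_Suc (b # bs) = (if b then False # bits_Suc bs else True # bs)"

primrec bits_pred :: "bool list \<Rightarrow> bool list" where
  "bits_pred [] = []"
| "bits_pred (b # bs) = (if b then if bs = [] then [] else False # bs else True # bits_pred bs)"

primrec strip :: "bool list \<Rightarrow> bool list" where
  "strip [] = []"
| "strip (b # bs) = (if strip bs = [] \<and> \<not> b then [] else b # strip bs)"

lemma binary_bits_0 [simp]: "binary_bits 0 = []"
  by (simp add: binary_bits.simps)

lemma binary_bits_double: "binary_bits (of_bool b + 2 * n) = (if n = 0 \<and> \<not> b then [] else b # binary_bits n)"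
  by (subst binary_bits.simps) auto

lemma binary_bits_bits_val: "binary_bits (bits_val bs) = strip bs"
proof (induction bs)
  case (Cons b bs)
  moreover have "bits_val bs = 0 \<longleftrightarrow> strip bs = []"
    by (subst Cons.IH[symmetric]) (subst binary_bits.simps, simp)
  ultimately show ?case by (simp add: binary_bits_double)
qed simp

lemma binary_bits_induct:
  assumes "P 0" "\<And>b n. n \<noteq> 0 \<or> b \<Longrightarrow> P n \<Longrightarrow> P (of_bool b + 2 * n)" shows "P (n::nat)"
proof (induction n rule: less_induct)
  case (less n)
  show ?case
  proof (cases "n = 0")
    case False
    have "n = of_bool (odd n) + 2 * (n div 2)" by (auto simp: of_bool_def)
    moreover have "n div 2 \<noteq> 0 \<or> odd n" using False by (cases n) auto
    ultimately show ?thesis using assms(2)[of "n div 2" "odd n"] less[of "n div 2"] False by force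
  qed (simp add: assms)
qed

lemma binary_bits_Suc: "binary_bits (Suc n) = bits_Suc (binary_bits n)"
proof (induction n rule: binary_bits_induct)
  case 1 then show ?case by (simp add: binary_bits.simps)
next
  case (2 b n)
  have "Suc (of_bool b + 2 * n) = (if b then of_bool False + 2 * Suc n else of_bool True + 2 * n)" by auto
  then show ?case using 2 by (auto simp only: binary_bits_double if_cancel split: if_splits) auto
qed

lemma binary_bits_pred: "binary_bits (n - 1) = bits_pred (binary_bits n)"
proof (induction n rule: binary_bits_induct)
  case (2 b n)
  have n: "binary_bits n = [] \<longleftrightarrow> n = 0" by (subst binary_bits.simps) simp
  have "of_bool b + 2 * n - 1 = (if b then of_bool False + 2 * n else of_bool True + 2 * (n - 1))"
    using 2(1) by auto
  then show ?case using 2 n by (auto simp only: binary_bits_double split: if_splits) auto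
qed simp

lemma tr_nat_eqI: "binary_bits n = bs \<Longrightarrow> tr n = tr bs"
  unfolding tr_nat_def by simp

lemma ps_binary_bits [ps_intros]: "ps D f \<Longrightarrow> ps D (\<lambda>x. binary_bits (f x))"
  by (rule ps_retype[of D f]) (simp_all only: tr_nat_def)

lemma sz_bits_Suc: "sz (bits_Suc bs) \<le> sz bs + 4"
  by (induction bs) auto

lemma sz_bits_pred: "sz (bits_pred bs) \<le> 3 * sz bs"
  by (induction bs) (auto simp: sz_def ser_def tr_bool_def)

lemma sz_strip: "sz (strip bs) \<le> sz bs"
  by (induction bs) auto

lemma ps_bits_Suc: assumes l: "ps D f" shows "ps D (\<lambda>x. bits_Suc (f x))"
proof -
  have bound: "sz (bits_Suc bs) \<le> sz (e, bs) + 4" for e :: 'a and bs using sz_bits_Suc[of bs] by simp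
  show ?thesis
    by (rule ps_primrec[where r = "\<lambda>e. bits_Suc" and a = "\<lambda>e. [True]" and g = "\<lambda>e b bs r. if b then False # r else True # bs"
      and q = "\<lambda>n. n + 4", OF _ _ _ _ _ bound l ps_id]) (rule ps_intros pol_add | simp)+
qed

lemma ps_bits_pred: assumes l: "ps D f" shows "ps D (\<lambda>x. bits_pred (f x))"
proof -
  have bound: "sz (bits_pred bs) \<le> 3 * sz (e, bs)" for e :: 'a and bs using sz_bits_pred[of bs] by simp
  show ?thesis
    by (rule ps_primrec[where r = "\<lambda>e. bits_pred" and a = "\<lambda>e. []"
      and g = "\<lambda>e b bs r. if b then if bs = [] then [] else False # bs else True # r"
      and q = "\<lambda>n. 3 * n", OF _ _ _ _ _ bound l ps_id]) (rule ps_intros pol_mult | simp)+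
qed

lemma ps_strip: assumes l: "ps D f" shows "ps D (\<lambda>x. strip (f x))"
proof -
  have bound: "sz (strip bs) \<le> sz (e, bs)" for e :: 'a and bs using sz_strip[of bs] by simp
  show ?thesis
    by (rule ps_primrec[where r = "\<lambda>e. strip" and a = "\<lambda>e. []"
      and g = "\<lambda>e b bs r. if r = [] \<and> \<not> b then [] else b # r"
      and q = "\<lambda>n. n", OF _ _ _ _ _ bound l ps_id]) (rule ps_intros | simp)+
qed

lemma ps_Suc [ps_intros]: "ps D f \<Longrightarrow> ps D (\<lambda>x. Suc (f x))"
  by (rule ps_retype[OF ps_bits_Suc[OF ps_binary_bits[of D f]]]) (simp_all add: tr_nat_eqI binary_bits_Suc)

lemma ps_pred: "ps D f \<Longrightarrow> ps D (\<lambda>x. f x - Suc 0)"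
  by (rule ps_retype[OF ps_bits_pred[OF ps_binary_bits[of D f]]]) (simp_all add: tr_nat_eqI binary_bits_pred[simplified])

lemma ps_bits_val [ps_intros]: "ps D f \<Longrightarrow> ps D (\<lambda>x. bits_val (f x))"
  by (rule ps_retype[OF ps_strip[of D f]]) (simp_all add: tr_nat_eqI binary_bits_bits_val)

lemma ps_neq_0: "ps D f \<Longrightarrow> ps D (\<lambda>x. f x \<noteq> (0::nat))"
proof -
  have "n \<noteq> 0 \<longleftrightarrow> binary_bits n \<noteq> []" for n :: nat by (subst binary_bits.simps) simp
  then show "ps D f \<Longrightarrow> ps D (\<lambda>x. f x \<noteq> 0)"
    using ps_neq_Nil[OF ps_binary_bits, of D f] by simp
qed

lemma length_binary_bits: "length (binary_bits n) \<le> k \<longleftrightarrow> n < 2 ^ k"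
proof (induction n arbitrary: k rule: binary_bits_induct)
  case (2 b n)
  have b: "binary_bits (of_bool b + 2 * n) = b # binary_bits n"
    using 2(1) by (auto simp: binary_bits_double)
  show ?case
  proof (cases k)
    case 0
    then show ?thesis using 2(1) unfolding b by (cases b) simp_all
  next
    case (Suc k')
    have "of_bool b + 2 * n < 2 ^ k \<longleftrightarrow> n < 2 ^ k'"
      unfolding Suc by (cases b; simp; linarith)
    then show ?thesis using 2(2)[of k'] Suc unfolding b by simp
  qed
qed simp

lemma sz_nat: "sz (n::nat) \<le> 4 * length (binary_bits n) + 1" "2 * length (binary_bits n) + 1 \<le> sz n"
proof -
  have "sz bs \<le> 4 * length bs + 1" "2 * length bs + 1 \<le> sz bs" for bs :: "bool list"
    by (induction bs; use sz_bool_le in \<open>auto simp: sz_def ser_def tr_bool_def\<close>)+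
  moreover have "sz n = sz (binary_bits n)" by (simp add: sz_def ser_def tr_nat_def[symmetric])
  ultimately show "sz (n::nat) \<le> 4 * length (binary_bits n) + 1" "2 * length (binary_bits n) + 1 \<le> sz n" by simp_all
qed

lemma sz_nat_less: "(n::nat) < 2 ^ k \<Longrightarrow> sz n \<le> 4 * k + 1"
  using sz_nat(1)[of n] length_binary_bits[of n k] by simp

lemma less_2_sz: "(n::nat) < 2 ^ sz n"
proof -
  have "n < 2 ^ length (binary_bits n)" using length_binary_bits by blast
  also have "\<dots> \<le> 2 ^ sz n" using sz_nat(2)[of n] by (intro power_increasing) auto
  finally show ?thesis .
qed

text \<open>The size is not monotone, since a zero bit takes less room than a one bit. Going through
  the number of bits costs the factor 4.\<close>

lemma sz_nat_mono: "(m::nat) \<le> n \<Longrightarrow> sz m \<le> 4 * sz n + 1"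
  by (rule sz_nat_less) (use less_2_sz[of n] in linarith)

lemma sz_nat_add: "(m::nat) \<le> a + b \<Longrightarrow> sz m \<le> 4 * (sz a + sz b) + 1"
proof (rule sz_nat_less)
  assume "m \<le> a + b"
  also have "a + b < 2 ^ sz a + 2 ^ sz b" using less_2_sz by (intro add_strict_mono) auto
  also have "\<dots> \<le> 2 ^ sz a * 2 ^ sz b"
  proof -
    have le: "x + y \<le> x * y" if "2 \<le> x" "2 \<le> y" for x y :: nat
      using mult_le_mono1[OF that(1), of y] mult_le_mono2[OF that(2), of x] by linarith
    have "(2::nat) \<le> 2 ^ sz x" for x :: nat
      using power_increasing[of 1 "sz x" "2::nat"] by simp
    then show ?thesis by (intro le)
  qed
  finally show "m < 2 ^ (sz a + sz b)" by (simp add: power_add)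
qed

text \<open>Units are moved one by one. This takes exponentially many rounds, but the two numbers
  never exceed the sum, and space is all that counts.\<close>

lemma ps_add [ps_intros]: "ps D f \<Longrightarrow> ps D g \<Longrightarrow> ps D (\<lambda>x. f x + (g x :: nat))"
proof (rule ps_comp2[where f = "(+)"])
  let ?g = "\<lambda>s::nat \<times> nat. (Suc (fst s), snd s - Suc 0)"
  have iter: "(?g ^^ i) (a, b) = (a + i, b - i)" for i a b by (induction i) auto
  have "ps UNIV (\<lambda>s. (?g ^^ snd s) s)"
  proof (rule ps_funpow[where t = "\<lambda>s. snd s \<noteq> 0" and E = UNIV and q = "\<lambda>n. 8 * n + 5"])
    show "pol (\<lambda>n. 8 * n + 5)" by (intro pol_add pol_mult) auto
    fix s :: "nat \<times> nat" and i assume "i \<le> snd s"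
    then show "(?g ^^ i) s \<in> UNIV \<and> sz ((?g ^^ i) s) \<le> 8 * sz s + 5 \<and> (snd ((?g ^^ i) s) \<noteq> 0 \<longleftrightarrow> i < snd s)"
      using sz_nat_add[of "fst s + i" "fst s" "snd s"] sz_nat_mono[of "snd s - i" "snd s"]
      by (cases s) (auto simp: iter)
  qed (rule ps_intros ps_pred ps_neq_0)+
  from ps_fst[OF this] show "ps UNIV (\<lambda>s::nat \<times> nat. fst s + snd s)"
    by (rule ps_cong) (auto simp: iter)
qed

lemma ps_diff [ps_intros]: "ps D f \<Longrightarrow> ps D g \<Longrightarrow> ps D (\<lambda>x. f x - (g x :: nat))"
proof (rule ps_comp2[where f = "(-)"])
  let ?g = "\<lambda>s::nat \<times> nat. (fst s - Suc 0, snd s - Suc 0)"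
  have iter: "(?g ^^ i) (a, b) = (a - i, b - i)" for i a b by (induction i) auto
  have "ps UNIV (\<lambda>s. (?g ^^ snd s) s)"
  proof (rule ps_funpow[where t = "\<lambda>s. snd s \<noteq> 0" and E = UNIV and q = "\<lambda>n. 8 * n + 5"])
    show "pol (\<lambda>n. 8 * n + 5)" by (intro pol_add pol_mult) auto
    fix s :: "nat \<times> nat" and i assume "i \<le> snd s"
    then show "(?g ^^ i) s \<in> UNIV \<and> sz ((?g ^^ i) s) \<le> 8 * sz s + 5 \<and> (snd ((?g ^^ i) s) \<noteq> 0 \<longleftrightarrow> i < snd s)"
      using sz_nat_mono[of "fst s - i" "fst s"] sz_nat_mono[of "snd s - i" "snd s"]
      by (cases s) (auto simp: iter)
  qed (rule ps_intros ps_pred ps_neq_0)+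
  from ps_fst[OF this] show "ps UNIV (\<lambda>s::nat \<times> nat. fst s - snd s)"
    by (rule ps_cong) (auto simp: iter)
qed

lemma ps_le [ps_intros]: "ps D f \<Longrightarrow> ps D g \<Longrightarrow> ps D (\<lambda>x. f x \<le> (g x :: nat))"
  using ps_not[OF ps_neq_0[OF ps_diff]] by simp

lemma ps_less [ps_intros]: "ps D f \<Longrightarrow> ps D g \<Longrightarrow> ps D (\<lambda>x. f x < (g x :: nat))"
  unfolding less_eq_Suc_le by (intro ps_intros)

lemma length_le_sz_nat: "sz (length xs) \<le> 4 * sz xs + 1"
  by (rule sz_nat_less) (use length_le_sz[of xs] less_exp[of "sz xs"] in linarith)

lemma ps_length [ps_intros]: assumes l: "ps D l" shows "ps D (\<lambda>x. length (l x))"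
proof -
  have bound: "sz (length xs) \<le> 4 * sz (e, xs) + 1" for e :: 'a and xs :: "'b list" using length_le_sz_nat[of xs] by simp
  show ?thesis
    by (rule ps_primrec[where r = "\<lambda>e. length" and a = "\<lambda>e. 0" and g = "\<lambda>e x xs. Suc"
      and q = "\<lambda>n. 4 * n + 1", OF _ _ _ _ _ bound l ps_id]) (rule ps_intros pol_add pol_mult | simp)+
qed


subsection \<open>Work lists and equality\<close>

text \<open>For predicates defined by recursion into a value of arbitrary branching. As they are
  plain conjunctions, a list of the parts still to be checked replaces a call stack. Replacing an
  item by its parts lowers the measure, which therefore bounds both the run and the list; the factor
  2 in \<open>sz x < 2 * \<mu> e x\<close> pays for the list cell of each item.\<close>

lemma ps_worklist:
  fixes \<mu> :: "'e::enc \<Rightarrow> 'x::enc \<Rightarrow> nat"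
  assumes bad: "ps UNIV (\<lambda>p. bad (fst p) (snd p))" and nxt: "ps UNIV (\<lambda>p. nxt (fst p) (snd p))"
    and decr: "\<And>e x. \<not> bad e x \<Longrightarrow> sum_list (map (\<mu> e) (nxt e x)) < \<mu> e x"
    and sz: "\<And>e x. sz x < 2 * \<mu> e x" and q: "pol q" "\<And>e x. \<mu> e x \<le> q (sz (e, x))"
    and good: "\<And>e x. good e x \<longleftrightarrow> \<not> bad e x \<and> (\<forall>y\<in>set (nxt e x). good e y)"
    and f: "ps D f" and g: "ps D g"
  shows "ps D (\<lambda>x. good (f x) (g x))"
proof (rule ps_comp2[OF _ f g])
  obtain p where p: "\<And>n. q n \<le> poly p n" using q unfolding pol_def by auto
  define B where "B s \<longleftrightarrow> (case snd s of [] \<Rightarrow> True | x # xs \<Rightarrow> bad (fst s) x)" for s :: "'e \<times> 'x list"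
  define h where "h s = (fst s, nxt (fst s) (hd (snd s)) @ tl (snd s))" for s :: "'e \<times> 'x list"
  define M where "M s = sum_list (map (\<mu> (fst s)) (snd s))" for s :: "'e \<times> 'x list"
  define A where "A s \<longleftrightarrow> (\<forall>x\<in>set (snd s). good (fst s) x)" for s :: "'e \<times> 'x list"
  have size: "sz s \<le> Suc (sz (fst s) + Suc (2 * M s))" for s :: "'e \<times> 'x list"
  proof -
    have "sz xs \<le> Suc (2 * sum_list (map (\<mu> e) xs))" for e xs
    proof (induction xs)
      case (Cons x xs) then show ?case using sz[of x e] by simp
    qed simp
    then show ?thesis by (cases s) (simp add: M_def)
  qed
  have M: "M (h s) < M s" if "\<not> B s" for s
    using decr[of "fst s" "hd (snd s)"] that by (auto simp: M_def B_def h_def split: list.splits)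
  have A: "A (h s) \<longleftrightarrow> A s" if "\<not> B s" for s
    using good[of "fst s" "hd (snd s)"] that by (auto simp: A_def B_def h_def split: list.splits)
  have "\<exists>N. \<forall>i\<le>N. (\<not> B ((h ^^ i) s) \<longleftrightarrow> i < N) \<and> M ((h ^^ i) s) \<le> M s \<and> fst ((h ^^ i) s) = fst s \<and>
     (A ((h ^^ i) s) \<longleftrightarrow> A s)" for s
  proof (induction "M s" arbitrary: s rule: less_induct)
    case less
    show ?case
    proof (cases "B s")
      case True
      then show ?thesis by (intro exI[of _ 0]) auto
    next
      case False
      from less[OF M[OF False]] obtain N where N: "\<And>i. i \<le> N \<Longrightarrow> (\<not> B ((h ^^ i) (h s)) \<longleftrightarrow> i < N) \<and>
         M ((h ^^ i) (h s)) \<le> M (h s) \<and> fst ((h ^^ i) (h s)) = fst (h s) \<and> (A ((h ^^ i) (h s)) \<longleftrightarrow> A (h s))" by blast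
      show ?thesis
      proof (intro exI[of _ "Suc N"] allI impI)
        fix i assume i: "i \<le> Suc N"
        show "(\<not> B ((h ^^ i) s) \<longleftrightarrow> i < Suc N) \<and> M ((h ^^ i) s) \<le> M s \<and> fst ((h ^^ i) s) = fst s \<and> (A ((h ^^ i) s) \<longleftrightarrow> A s)"
        proof (cases i)
          case 0
          then show ?thesis using False by simp
        next
          case (Suc j)
          have eq: "(h ^^ i) s = (h ^^ j) (h s)" unfolding Suc by (simp only: funpow_Suc_right o_apply)
          have "j \<le> N" using i Suc by simp
          from N[OF this] show ?thesis unfolding eq using M[OF False] A[OF False] Suc by (simp add: h_def)
        qed
      qed
    qed
  qed
  then obtain N where N: "\<And>s i. i \<le> N s \<Longrightarrow> (\<not> B ((h ^^ i) s) \<longleftrightarrow> i < N s) \<and> M ((h ^^ i) s) \<le> M s \<and> fst ((h ^^ i) s) = fst s \<and>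
     (A ((h ^^ i) s) \<longleftrightarrow> A s)" by metis
  let ?D = "{s :: 'e \<times> 'x list. \<exists>e x. s = (e, [x])}"
  have "ps ?D (\<lambda>s. (h ^^ N s) s)"
  proof (rule ps_funpow[where t = "\<lambda>s. \<not> B s" and E = UNIV and q = "\<lambda>n. Suc (n + Suc (2 * poly p n))"])
    show "ps UNIV (\<lambda>s. \<not> B s)" unfolding B_def by (intro ps_intros ps_comp2[OF bad])
    let ?E = "UNIV \<inter> {s :: 'e \<times> 'x list. \<not> B s}"
    have "ps ?E (\<lambda>s. hd (snd s))" "ps ?E (\<lambda>s. tl (snd s))"
      by (rule ps_comp_on[OF ps_snd[OF ps_id] ps_hd] ps_comp_on[OF ps_snd[OF ps_id] ps_tl]; auto simp: B_def split: list.splits)+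
    then show "ps ?E h" unfolding h_def by (intro ps_intros ps_comp2[OF nxt])
    show "pol (\<lambda>n. Suc (n + Suc (2 * poly p n)))" by (intro pol_Suc pol_add pol_mult) auto
    fix s i assume s: "s \<in> ?D" and i: "i \<le> N s"
    then obtain e x where x: "s = (e, [x])" by auto
    have "sz ((h ^^ i) s) \<le> Suc (sz e + Suc (2 * M ((h ^^ i) s)))"
      using size[of "(h ^^ i) s"] N[OF i] x by simp
    also have "M s = \<mu> e x" by (simp add: M_def x)
    then have "Suc (sz e + Suc (2 * M ((h ^^ i) s))) \<le> Suc (sz e + Suc (2 * \<mu> e x))" using N[OF i] by simp
    also have "\<mu> e x \<le> poly p (sz s)"
      using q(2)[of e x] p[of "sz (e, x)"] poly_nat_mono[of "sz (e, x)" "sz s" p] x by simp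
    finally show "(h ^^ i) s \<in> UNIV \<and> sz ((h ^^ i) s) \<le> Suc (sz s + Suc (2 * poly p (sz s))) \<and> (\<not> B ((h ^^ i) s) \<longleftrightarrow> i < N s)"
      using N[OF i] x by simp
  qed
  then have "ps ?D (\<lambda>s. snd ((h ^^ N s) s) = [])" by (intro ps_eq_Nil ps_snd)
  then have 1: "ps ?D (\<lambda>s. good (fst s) (hd (snd s)))"
  proof (rule ps_cong)
    fix s assume s: "s \<in> ?D"
    have "B ((h ^^ N s) s)" "A ((h ^^ N s) s) \<longleftrightarrow> A s" "fst ((h ^^ N s) s) = fst s" using N[of "N s" s] by auto
    moreover have "A s \<longleftrightarrow> good (fst s) (hd (snd s))" using s by (auto simp: A_def)
    ultimately show "(snd ((h ^^ N s) s) = []) = good (fst s) (hd (snd s))"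
      using good[of "fst s" "hd (snd ((h ^^ N s) s))"] by (cases "snd ((h ^^ N s) s)") (auto simp: A_def B_def)
  qed
  have "ps UNIV (\<lambda>p. (\<lambda>s. good (fst s) (hd (snd s))) (fst p, [snd p]))"
    by (rule ps_comp_on[OF _ 1]) (rule ps_intros | auto)+
  then show "ps UNIV (\<lambda>p. good (fst p) (snd p))" by simp
qed

section \<open>Equality of values\<close>

primrec left :: "tree \<Rightarrow> tree" where "left Leaf = Leaf" | "left (Node a b) = a"
primrec right :: "tree \<Rightarrow> tree" where "right Leaf = Leaf" | "right (Node a b) = b"

lemma neq_Leaf: "t \<noteq> Leaf \<longleftrightarrow> (\<exists>a b. t = Node a b)" by (cases t) auto

lemma ps_tree_Node: "ps D f \<Longrightarrow> ps D (\<lambda>x. f x \<noteq> Leaf)"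
  by (rule ps_comp[where f = "\<lambda>t. t \<noteq> Leaf"], rule ps_is_Node) (simp_all add: tr_tree_def)

lemma ps_tree_left: "ps D f \<Longrightarrow> ps D (\<lambda>x. left (f x))"
proof (rule ps_comp[where f = left])
  have "ps UNIV (\<lambda>t. if t \<noteq> Leaf then left t else Leaf)"
    by (intro ps_if ps_tree_Node ps_id ps_const ps_left) (auto simp: tr_tree_def neq_Leaf)
  then show "ps UNIV left" by (rule ps_cong) auto
qed

lemma ps_tree_right: "ps D f \<Longrightarrow> ps D (\<lambda>x. right (f x))"
proof (rule ps_comp[where f = right])
  have "ps UNIV (\<lambda>t. if t \<noteq> Leaf then right t else Leaf)"
    by (intro ps_if ps_tree_Node ps_id ps_const ps_right) (auto simp: tr_tree_def neq_Leaf)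
  then show "ps UNIV right" by (rule ps_cong) auto
qed

lemma sz_tree [simp]: "sz Leaf = 1" "sz (Node a b) = Suc (sz a + sz b)"
  by (simp_all add: sz_def ser_def tr_tree_def)

text \<open>By injectivity of \<open>tr\<close> it suffices to compare trees, for all types at once.
  The work list holds pairs of subtrees, and a pair of which exactly one is a leaf is a mismatch.
  The parameter of type \<open>bool\<close> is a dummy.\<close>

lemma ps_eq [ps_intros]:
  fixes f g :: "'a::enc \<Rightarrow> 'b::enc"
  assumes "ps D f" "ps D g" shows "ps D (\<lambda>x. f x = g x)"
proof -
  let ?bad = "\<lambda>(e::bool) p. (fst p \<noteq> Leaf) \<noteq> (snd p \<noteq> Leaf)"
  let ?nxt = "\<lambda>(e::bool) p. if fst p \<noteq> Leaf then [(left (fst p), left (snd p)), (right (fst p), right (snd p))] else []"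
  have "ps D (\<lambda>x. (\<lambda>e p. fst p = snd p) True (tr (f x), tr (g x)))"
  proof (rule ps_worklist[where bad = ?bad and nxt = ?nxt and \<mu> = "\<lambda>e p. sz (fst p) + sz (snd p)" and q = "\<lambda>n. n" and f = "\<lambda>_. True"])
    show "ps UNIV (\<lambda>p. ?nxt (fst p) (snd p))"
      by (intro ps_intros ps_tree_Node ps_tree_left ps_tree_right)
    have "ps UNIV (\<lambda>p::bool \<times> tree \<times> tree. if fst (snd p) \<noteq> Leaf then \<not> snd (snd p) \<noteq> Leaf else snd (snd p) \<noteq> Leaf)"
      by (intro ps_intros ps_tree_Node)
    then show "ps UNIV (\<lambda>p. ?bad (fst p) (snd p))" by (rule ps_cong) auto
    have "ps D (\<lambda>x. tr (f x))" "ps D (\<lambda>x. tr (g x))"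
      by (rule ps_retype[OF assms(1)] ps_retype[OF assms(2)]; simp add: tr_tree_def)+
    then show "ps D (\<lambda>x. (tr (f x), tr (g x)))" by (rule ps_pair)
    fix e :: bool and p :: "tree \<times> tree"
    show "\<not> ?bad e p \<Longrightarrow> sum_list (map (\<lambda>p. sz (fst p) + sz (snd p)) (?nxt e p)) < sz (fst p) + sz (snd p)"
      by (cases p; cases "fst p"; cases "snd p") auto
    show "(fst p = snd p) \<longleftrightarrow> \<not> ?bad e p \<and> (\<forall>y\<in>set (?nxt e p). fst y = snd y)"
      by (cases p; cases "fst p"; cases "snd p") auto
    show "sz p < 2 * (sz (fst p) + sz (snd p))"
      using sz_pos[of "fst p"] sz_pos[of "snd p"] by (cases p) (simp del: sz_pos)
    show "sz (fst p) + sz (snd p) \<le> sz (e, p)" by (cases p) simp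
  qed (auto intro: ps_const)
  then show ?thesis by (rule ps_cong) (auto dest: tr_inj)
qed


section \<open>Evaluation of NAND trees\<close>

text \<open>
  \<open>evals ch n x v\<close>: the tree with root \<open>x\<close> and children function \<open>ch\<close> has height at most \<open>n\<close>,
  and reading every node as the NAND of its children gives the root the value \<open>v\<close>.
\<close>

inductive evals :: "('n \<Rightarrow> 'n list) \<Rightarrow> nat \<Rightarrow> 'n \<Rightarrow> bool \<Rightarrow> bool" for ch where
  evals: "(\<And>c. c \<in> set (ch x) \<Longrightarrow> evals ch n c (f c)) \<Longrightarrow> v = (\<exists>c\<in>set (ch x). \<not> f c) \<Longrightarrow> evals ch (Suc n) x v"

lemma evals_mono: "evals ch n x v \<Longrightarrow> n \<le> m \<Longrightarrow> evals ch m x v"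
proof (induction arbitrary: m rule: evals.induct)
  case (evals x n f v)
  then obtain k where "m = Suc k" "n \<le> k" by (cases m) auto
  with evals show ?case using evals.intros[of ch x k f v] by auto
qed

text \<open>Iteration of \<open>h\<close> under the test \<open>t\<close> with an invariant
  \<open>P\<close>, without a count of steps, so that pieces of a run can be concatenated.\<close>

inductive path :: "('s \<Rightarrow> 's) \<Rightarrow> ('s \<Rightarrow> bool) \<Rightarrow> ('s \<Rightarrow> bool) \<Rightarrow> 's \<Rightarrow> 's \<Rightarrow> bool" for h t P where
  path_refl: "P s \<Longrightarrow> path h t P s s"
| path_step: "t s \<Longrightarrow> P s \<Longrightarrow> path h t P (h s) s' \<Longrightarrow> path h t P s s'"

lemma path_trans: "path h t P s s' \<Longrightarrow> path h t P s' s'' \<Longrightarrow> path h t P s s''"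
  by (induction rule: path.induct) (auto intro: path.intros)

lemma path_funpow: "path h t P s s' \<Longrightarrow> \<exists>k. (h ^^ k) s = s' \<and> (\<forall>i<k. t ((h ^^ i) s)) \<and> (\<forall>i\<le>k. P ((h ^^ i) s))"
proof (induction rule: path.induct)
  case (path_refl s)
  then show ?case by (intro exI[of _ 0]) auto
next
  case (path_step s s')
  then obtain k where k: "(h ^^ k) (h s) = s'" "\<forall>i<k. t ((h ^^ i) (h s))" "\<forall>i\<le>k. P ((h ^^ i) (h s))" by blast
  have eq: "(h ^^ Suc i) s = (h ^^ i) (h s)" for i by (simp only: funpow_Suc_right o_apply)
  show ?case
  proof (intro exI[of _ "Suc k"] conjI allI impI)
    show "(h ^^ Suc k) s = s'" using k eq by simp
    show "t ((h ^^ i) s)" if "i < Suc k" for i using that k(2) path_step.hyps(1) eq by (cases i) auto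
    show "P ((h ^^ i) s)" if "i \<le> Suc k" for i using that k(3) path_step.hyps(2) eq by (cases i) auto
  qed
qed

text \<open>
  Depth-first evaluation.  A stack entry is the list of the children of some node that are still
  to be evaluated.  An empty entry on top says that its node is false, so that the parent is true
  and is dropped as well.  Started with \<open>[[x]]\<close>, the search stops with \<open>[[]]\<close> if \<open>x\<close> is true
  and with \<open>[]\<close> otherwise.
\<close>

definition dfs_step :: "('n \<Rightarrow> 'n list) \<Rightarrow> 'n list list \<Rightarrow> 'n list list" where
  "dfs_step ch st = (case st of [] \<Rightarrow> [] | fr # rest \<Rightarrow> (case fr of [] \<Rightarrow> (case rest of [] \<Rightarrow> [] | _ # r \<Rightarrow> r)
      | x # xs \<Rightarrow> ch x # xs # rest))"

definition running :: "'n list list \<Rightarrow> bool" where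
  "running st \<longleftrightarrow> st \<noteq> [] \<and> st \<noteq> [[]]"

text \<open>If \<open>x\<close> is true, its parent is still undecided and the siblings
  \<open>xs\<close> remain; if it is false, the parent is true, its frame goes, and
  \<open>rest\<close> starts with the siblings of the parent. The outcome for a node thus has the
  same form as for its children, which makes the induction work. One frame is needed per level of
  the tree.\<close>

lemma dfs_path:
  fixes ch :: "'n::enc \<Rightarrow> 'n list"
  assumes "evals ch n x v" "G x"
    and G: "\<And>y. G y \<Longrightarrow> sz (ch y) \<le> B \<and> (\<forall>c\<in>set (ch y). G c)"
    and "length rest + 1 + n \<le> L" "sz (x # xs) \<le> B" "\<forall>fr\<in>set rest. sz fr \<le> B"
  shows "path (dfs_step ch) running (\<lambda>st. length st \<le> L \<and> (\<forall>fr\<in>set st. sz fr \<le> B))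
    ((x # xs) # rest) (if v then xs # rest else rest)"
  using assms(1,2,4-)
proof (induction arbitrary: xs rest rule: evals.induct)
  case (evals x n f v)
  let ?path = "path (dfs_step ch) running (\<lambda>st. length st \<le> L \<and> (\<forall>fr\<in>set st. sz fr \<le> B))"
  have fr: "\<forall>fr\<in>set (xs # rest). sz fr \<le> B" using evals.prems by auto
  \<comment> \<open>The frame of \<open>x\<close> shrinks while its children are evaluated, so the
    inner induction is over any list of children still to be tried.\<close>
  have "?path (cs # xs # rest) (if \<exists>c\<in>set cs. \<not> f c then xs # rest else rest)"
    if "set cs \<subseteq> set (ch x)" "sz cs \<le> B" for cs
    using that
  proof (induction cs)
    case Nil
    have "?path rest rest" using evals.prems by (intro path_refl) auto
    then have "?path (dfs_step ch ([] # xs # rest)) rest" by (simp add: dfs_step_def)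
    then have "?path ([] # xs # rest) rest"
      by (rule path_step[rotated 2]) (use evals.prems Nil fr in \<open>auto simp: running_def\<close>)
    then show ?case by simp
  next
    case (Cons c cs)
    have 1: "?path ((c # cs) # xs # rest) (if f c then cs # xs # rest else xs # rest)"
      using Cons.prems evals.prems G[OF evals.prems(1)] fr by (intro evals.IH) auto
    have 2: "?path (cs # xs # rest) (if \<exists>c\<in>set cs. \<not> f c then xs # rest else rest)"
      using Cons by auto
    show ?case using 1 path_trans[OF _ 2, of "(c # cs) # xs # rest"] by (cases "f c") simp_all
  qed
  from this[of "ch x"] have "?path (dfs_step ch ((x # xs) # rest)) (if v then xs # rest else rest)"
    using G[OF evals.prems(1)] evals.hyps by (simp add: dfs_step_def)
  then show ?case by (rule path_step[rotated 2]) (use evals.prems in \<open>auto simp: running_def\<close>)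
qed

text \<open>The number of frames is bounded by the height, and a frame by the size of a list of
  children. This bound is asked only under an invariant \<open>G\<close> that passes from a node to
  its children, as arbitrary nodes could have ever larger children.\<close>

lemma ps_evals:
  fixes ch :: "'a::enc \<Rightarrow> 'n::enc \<Rightarrow> 'n list"
  assumes ch: "ps UNIV (\<lambda>p. ch (fst p) (snd p))" and r: "ps D r"
    and ev: "\<And>x. x \<in> D \<Longrightarrow> evals (ch x) (n x) (r x) (v x)"
    and n: "pol qn" "\<And>x. x \<in> D \<Longrightarrow> n x \<le> qn (sz x)"
    and G: "\<And>x. x \<in> D \<Longrightarrow> G x (r x)"
    and B: "pol qB" "\<And>x y. x \<in> D \<Longrightarrow> G x y \<Longrightarrow> sz (ch x y) \<le> qB (sz x) \<and> (\<forall>c\<in>set (ch x y). G x c)"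
  shows "ps D v"
proof -
  obtain pn where pn: "\<And>n. qn n \<le> poly pn n" using n unfolding pol_def by auto
  obtain pB where pB: "\<And>n. qB n \<le> poly pB n" using B unfolding pol_def by auto
  obtain pr where pr: "\<And>x. x \<in> D \<Longrightarrow> sz (r x) \<le> poly pr (sz x)" using ps_size[OF r] by blast
  define h where "h s = (fst s, dfs_step (ch (fst s)) (snd s))" for s :: "'a \<times> 'n list list"
  define t where "t s \<longleftrightarrow> running (snd s)" for s :: "'a \<times> 'n list list"
  let ?D = "{s. \<exists>x\<in>D. s = (x, [[r x]])}"
  let ?q = "\<lambda>n. Suc (n + Suc ((poly pn n + 1) * Suc (poly pB n + poly pr n + 2)))"
  have h: "(h ^^ i) (x, st) = (x, (dfs_step (ch x) ^^ i) st)" for i x st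
    by (induction i) (auto simp: h_def)
  have "\<exists>k. (dfs_step (ch x) ^^ k) [[r x]] = (if v x then [[]] else []) \<and>
      (\<forall>i<k. running ((dfs_step (ch x) ^^ i) [[r x]])) \<and>
      (\<forall>i\<le>k. sz ((dfs_step (ch x) ^^ i) [[r x]]) \<le> Suc ((poly pn (sz x) + 1) * Suc (poly pB (sz x) + poly pr (sz x) + 2)))"
    if x: "x \<in> D" for x
  proof -
    \<comment> \<open>The summands \<open>poly pr (sz x) + 2\<close> are for the first frame
      \<open>[r x]\<close>, which is not a list of children.\<close>
    let ?B = "poly pB (sz x) + poly pr (sz x) + 2" and ?L = "poly pn (sz x) + 1"
    have G': "sz (ch x y) \<le> ?B \<and> (\<forall>c\<in>set (ch x y). G x c)" if "G x y" for y
      using B(2)[OF x that] pB[of "sz x"] by auto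
    have "path (dfs_step (ch x)) running (\<lambda>st. length st \<le> ?L \<and> (\<forall>fr\<in>set st. sz fr \<le> ?B))
      ((r x # []) # []) (if v x then [] # [] else [])"
    proof (rule dfs_path[OF ev[OF x] G[OF x] G'])
      show "length [] + 1 + n x \<le> ?L" using n(2)[OF x] pn[of "sz x"] by auto
      show "sz [r x] \<le> ?B" using pr[OF x] by simp
    qed auto
    from path_funpow[OF this] obtain k where k: "(dfs_step (ch x) ^^ k) [[r x]] = (if v x then [[]] else [])"
      "\<forall>i<k. running ((dfs_step (ch x) ^^ i) [[r x]])"
      "\<forall>i\<le>k. length ((dfs_step (ch x) ^^ i) [[r x]]) \<le> ?L \<and> (\<forall>fr\<in>set ((dfs_step (ch x) ^^ i) [[r x]]). sz fr \<le> ?B)"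
      by blast
    have "sz st \<le> Suc (?L * Suc ?B)" if "length st \<le> ?L" "\<forall>fr\<in>set st. sz fr \<le> ?B" for st :: "'n list list"
      using sz_list_bound[of st ?B] that mult_le_mono1[of "length st" ?L "Suc ?B"] by auto
    with k show ?thesis by blast
  qed
  then obtain k where k: "\<And>x. x \<in> D \<Longrightarrow> (dfs_step (ch x) ^^ k x) [[r x]] = (if v x then [[]] else [])"
      "\<And>x i. x \<in> D \<Longrightarrow> i < k x \<Longrightarrow> running ((dfs_step (ch x) ^^ i) [[r x]])"
      "\<And>x i. x \<in> D \<Longrightarrow> i \<le> k x \<Longrightarrow> sz ((dfs_step (ch x) ^^ i) [[r x]]) \<le>
         Suc ((poly pn (sz x) + 1) * Suc (poly pB (sz x) + poly pr (sz x) + 2))"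
    by metis
  have "ps ?D (\<lambda>s. (h ^^ k (fst s)) s)"
  proof (rule ps_funpow[where E = UNIV and t = t and q = ?q])
    show "ps UNIV t" unfolding t_def running_def
      by (intro ps_conj ps_neq_Nil ps_not ps_eq ps_snd ps_id ps_const)
    show "ps (UNIV \<inter> {x. t x}) h" unfolding h_def dfs_step_def
      by (rule ps_intros ps_comp2[OF ch])+
    show "pol ?q" by (intro pol_Suc pol_add pol_mult) auto
    fix s i assume s: "s \<in> ?D" and i: "i \<le> k (fst s)"
    then obtain x where x: "x \<in> D" "s = (x, [[r x]])" by auto
    have mono: "poly p (sz x) \<le> poly p (sz s)" for p using x by (intro poly_nat_mono) simp
    have "sz (snd ((h ^^ i) s)) \<le> Suc ((poly pn (sz x) + 1) * Suc (poly pB (sz x) + poly pr (sz x) + 2))"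
      using k(3)[OF x(1)] i x by (simp add: h)
    also have "\<dots> \<le> Suc ((poly pn (sz s) + 1) * Suc (poly pB (sz s) + poly pr (sz s) + 2))"
      unfolding Suc_le_mono by (intro mult_le_mono add_mono mono) (use mono[of pB] mono[of pr] in auto)
    finally have "sz ((h ^^ i) s) \<le> ?q (sz s)" using x by (simp add: h)
    moreover have "t ((h ^^ i) s) \<longleftrightarrow> i < k (fst s)"
    proof (cases "i < k (fst s)")
      case False
      then have "i = k x" using i x by simp
      then show ?thesis using k(1)[OF x(1)] x by (simp add: t_def h running_def)
    qed (use k(2)[OF x(1)] x in \<open>simp add: t_def h\<close>)
    ultimately show "(h ^^ i) s \<in> UNIV \<and> sz ((h ^^ i) s) \<le> ?q (sz s) \<and> (t ((h ^^ i) s) \<longleftrightarrow> i < k (fst s))" by simp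
  qed
  from ps_neq_Nil[OF ps_snd[OF this]] have v: "ps ?D (\<lambda>s. v (fst s))"
    by (rule ps_cong) (auto simp: h k split: if_splits)
  have "ps D (\<lambda>x. (x, [[r x]]))" by (intro ps_intros r)
  from ps_comp_on[OF this v] have "ps D (\<lambda>x. (\<lambda>s. v (fst s)) (x, [[r x]]))" by blast
  then show ?thesis by simp
qed


section \<open>Decoding\<close>

lemma tr_list_foldr: "tr xs = foldr (\<lambda>x. Node (tr x)) xs Leaf"
  by (induction xs) auto

text \<open>The \<open>foldr\<close> is the tree of the list \<open>ds\<close>, written out because
  the instance for lists presupposes the one being defined. A value thus has the tree of a pair of a
  tag and a list.\<close>

instantiation data :: enc begin
primrec tr_data :: "data \<Rightarrow> tree" where
  "tr_data (Bits bs) = Node (tr False) (tr bs)"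
| "tr_data (Lst ds) = Node (tr True) (foldr Node (map tr_data ds) Leaf)"
instance
proof
  have inj: "map f xs = map f ys" if "foldr Node (map f xs) Leaf = foldr Node (map f ys) Leaf" for f :: "data \<Rightarrow> tree" and xs ys
    using that by (induction xs ys rule: list_induct2') auto
  have ft: "tr False \<noteq> tr True" by (simp add: tr_bool_def)
  fix d d' :: data
  show "tr d = tr d' \<Longrightarrow> d = d'"
  proof (induction d arbitrary: d')
    case (Bits bs)
    then show ?case using ft by (cases d') (auto dest: tr_inj)
  next
    case (Lst ds)
    then obtain ds' where ds': "d' = Lst ds'" using ft by (cases d') auto
    then have "map tr ds = map tr ds'" using Lst.prems by (auto dest: inj)
    then have "ds = ds'" using Lst.IH by (auto simp: list_eq_iff_nth_eq map_equality_iff)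
    then show ?case using ds' by simp
  qed
qed
end

lemma tr_data_eq: "tr (Bits bs) = tr (False, bs)" "tr (Lst ds) = tr (True, ds)"
  by (simp_all add: tr_prod_def tr_list_foldr foldr_map comp_def)

lemma sz_data [simp]: "sz (Bits bs) = sz bs + 2" "sz (Lst ds) = sz ds + 4"
  by (simp_all add: sz_def ser_def tr_data_eq[simplified])
    (simp_all add: tr_prod_def tr_bool_def)

primrec is_Lst :: "data \<Rightarrow> bool" where "is_Lst (Bits bs) = False" | "is_Lst (Lst ds) = True"
primrec bits_of :: "data \<Rightarrow> bool list" where "bits_of (Bits bs) = bs" | "bits_of (Lst ds) = []"
primrec items :: "data \<Rightarrow> data list" where "items (Bits bs) = []" | "items (Lst ds) = ds"

lemma ps_Bits [ps_intros]: "ps D f \<Longrightarrow> ps D (\<lambda>x. Bits (f x))"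
  by (rule ps_retype[OF ps_pair[OF ps_const[of D False], of f]]) (simp_all only: tr_data_eq)

lemma ps_Lst [ps_intros]: "ps D f \<Longrightarrow> ps D (\<lambda>x. Lst (f x))"
  by (rule ps_retype[OF ps_pair[OF ps_const[of D True], of f]]) (simp_all only: tr_data_eq)

lemma ps_is_Lst [ps_intros]: "ps D f \<Longrightarrow> ps D (\<lambda>x. is_Lst (f x))"
proof (rule ps_comp[where f = is_Lst], rule ps_left)
  show "\<exists>t. tr d = Node (tr (is_Lst d)) t" for d by (cases d) auto
qed

lemma ps_bits_of [ps_intros]: "ps D f \<Longrightarrow> ps D (\<lambda>x. bits_of (f x))"
proof (rule ps_comp[where f = bits_of])
  have "ps (UNIV \<inter> {d. \<not> is_Lst d}) bits_of"
  proof (rule ps_right)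
    show "d \<in> UNIV \<inter> {d. \<not> is_Lst d} \<Longrightarrow> \<exists>t. tr d = Node t (tr (bits_of d))" for d by (cases d) auto
  qed
  then have "ps UNIV (\<lambda>d. if is_Lst d then [] else bits_of d)"
    by (intro ps_if ps_is_Lst ps_id ps_const)
  then show "ps UNIV bits_of" by (rule ps_cong) (case_tac x; simp)
qed

lemma ps_items [ps_intros]: "ps D f \<Longrightarrow> ps D (\<lambda>x. items (f x))"
proof (rule ps_comp[where f = items])
  have "ps (UNIV \<inter> {d. is_Lst d}) items"
  proof (rule ps_right)
    show "d \<in> UNIV \<inter> {d. is_Lst d} \<Longrightarrow> \<exists>t. tr d = Node t (tr (items d))" for d
      by (cases d) (auto simp: tr_list_foldr foldr_map comp_def)
  qed
  then have "ps UNIV (\<lambda>d. if is_Lst d then items d else [])"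
    by (intro ps_if ps_is_Lst ps_id ps_const)
  then show "ps UNIV items" by (rule ps_cong) (case_tac x; simp)
qed

lemma ps_tl0 [ps_intros]: "ps D f \<Longrightarrow> ps D (\<lambda>x. tl (f x))"
  unfolding tl_def by (intro ps_intros)

text \<open>Total, with a default for data of the wrong shape. This is harmless because the check of
  an instance compares the data with what is rebuilt from the parts read.\<close>

definition item :: "nat \<Rightarrow> data \<Rightarrow> data" where
  "item i d = (case drop i (items d) of [] \<Rightarrow> Bits [] | x # _ \<Rightarrow> x)"

lemma ps_drop: "ps D l \<Longrightarrow> ps D (\<lambda>x. drop i (l x))"
proof (induction i arbitrary: l)
  case (Suc i)
  from Suc.IH[OF ps_tl0[OF Suc.prems]] show ?case by (simp add: drop_Suc)
qed simp

lemma ps_item [ps_intros]: "ps D f \<Longrightarrow> ps D (\<lambda>x. item i (f x))"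
  unfolding item_def by (intro ps_intros ps_drop)

lemma item_Lst [simp]: "item 0 (Lst (x # xs)) = x" "item (Suc i) (Lst (x # xs)) = item i (Lst xs)"
  "item (numeral k) (Lst (x # xs)) = item (pred_numeral k) (Lst xs)"
  by (simp_all add: item_def)

lemma sz_item: "sz (item i d) \<le> sz d"
proof (cases d)
  case (Lst ds)
  show ?thesis
  proof (cases "drop i ds")
    case (Cons x xs)
    then have "x \<in> set ds" by (metis in_set_dropD list.set_intros(1))
    then show ?thesis using Lst Cons sz_mem[of x ds] by (simp add: item_def)
  qed (simp add: item_def Lst)
qed (simp add: item_def)


section \<open>Parsing of words\<close>

definition parse_step :: "nat \<Rightarrow> data list list \<Rightarrow> data list list" where
  "parse_step c st = (case st of [] \<Rightarrow> [] | cur # rest \<Rightarrow>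
     if c = 3 then (Bits [] # cur) # rest
     else if c = 5 then [] # cur # rest
     else if c = 4 then (case rest of [] \<Rightarrow> [] | up # r \<Rightarrow> (Lst cur # up) # r)
     else if c = 1 \<or> c = 2 then
       (case cur of [] \<Rightarrow> [] | d # ds \<Rightarrow> if is_Lst d then [] else (Bits ((c = 2) # bits_of d) # ds) # rest)
     else [])"

text \<open>
  A word is read from right to left, so that each item is complete when its opening symbol is
  reached.  The stack holds the items read so far, one list per open bracket; the empty stack
  signals an error.
\<close>

definition parse :: "nat list \<Rightarrow> data list list" where
  "parse w = foldr parse_step w [[]]"

definition decode :: "nat list \<Rightarrow> data" where
  "decode w = (case parse w of [] \<Rightarrow> Bits [] | fr # rest \<Rightarrow>
     if rest = [] then (case fr of [] \<Rightarrow> Bits [] | d # ds \<Rightarrow> if ds = [] then d else Bits []) else Bits [])"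

lemma parse_step_simps [simp]:
  "parse_step 3 (cur # rest) = (Bits [] # cur) # rest" "parse_step 5 (cur # rest) = [] # cur # rest"
  "parse_step 4 (cur # up # r) = (Lst cur # up) # r"
  "parse_step 2 ((Bits bs # ds) # rest) = (Bits (True # bs) # ds) # rest"
  "parse_step (Suc 0) ((Bits bs # ds) # rest) = (Bits (False # bs) # ds) # rest"
  by (simp_all add: parse_step_def)

lemma foldr_parse_word: "foldr parse_step (word d) (cur # rest) = (d # cur) # rest"
proof (induction d arbitrary: cur rest)
  case (Bits bs)
  show ?case by (induction bs) auto
next
  case (Lst ds)
  then have "foldr parse_step (concat (map word ds)) (cur # rest) = (ds @ cur) # rest" for cur rest
    by (induction ds arbitrary: cur rest) auto
  then show ?case by simp
qed

lemma decode_word [simp]: "decode (word d) = d"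
  by (simp add: decode_def parse_def foldr_parse_word)

text \<open>The part of the word that a parser stack stands for, with one symbol 5 for each bracket
  still open. Nothing is lost in parsing, so a nonempty stack determines the word read.\<close>

fun flat :: "data list list \<Rightarrow> nat list" where
  "flat [] = []"
| "flat [cur] = concat (map word cur)"
| "flat (cur # up # rest) = concat (map word cur) @ 5 # flat (up # rest)"

lemma flat_Cons: "flat ((d # cur) # rest) = word d @ flat (cur # rest)"
  by (cases rest) auto

lemma flat_parse: "parse w \<noteq> [] \<Longrightarrow> flat (parse w) = w"
proof (induction w)
  case (Cons c w)
  let ?st = "parse w"
  have p: "parse (c # w) = parse_step c ?st" by (simp add: parse_def)
  obtain cur rest where st: "?st = cur # rest"
    using Cons.prems unfolding p by (cases ?st) (auto simp: parse_step_def)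
  then have IH: "flat (cur # rest) = w" using Cons.IH by simp
  have "c = 3 \<or> c = 5 \<or> c = 4 \<or> c = 1 \<or> c = 2"
    using Cons.prems unfolding p st by (auto simp: parse_step_def split: if_splits)
  then consider "c = 3" | "c = 5" | up r where "c = 4" "rest = up # r"
    | bs ds where "c = 1 \<or> c = 2" "cur = Bits bs # ds"
    using Cons.prems unfolding p st
    by (cases rest; cases cur; cases "hd cur") (auto simp: parse_step_def split: if_splits)
  then show ?case
  proof cases
    case 3
    then show ?thesis unfolding p st using IH by (simp add: parse_step_def flat_Cons)
  next
    case 4
    then show ?thesis unfolding p st using IH by (auto simp: parse_step_def flat_Cons)
  next
    case 1
    then show ?thesis unfolding p st using IH by (simp add: flat_Cons)
  next
    case 2
    then show ?thesis unfolding p st using IH by simp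
  qed
qed (simp add: parse_def)

text \<open>Needed for words not known to be encodings: if the decoded data are accepted, the word
  itself must belong to the language. The form \<open>Lst ds\<close> excludes
  \<open>Bits []\<close>, the answer to a failed parse.\<close>

lemma word_decode: assumes "decode w = Lst ds" shows "w = word (Lst ds)"
proof -
  have "parse w = [[Lst ds]]"
    using assms by (auto simp: decode_def split: list.splits if_splits)
  then show ?thesis using flat_parse[of w] by simp
qed

lemma set_word: "set (word d) \<subseteq> {1..5}"
  by (induction d) auto

lemma sz_bits_of: "\<not> is_Lst d \<Longrightarrow> sz d = sz (bits_of d) + 2"
  by (cases d) auto

lemma sz_parse_step: "sz (parse_step c st) \<le> sz st + 4"
  by (auto simp: parse_step_def sz_bits_of split: list.split)

lemma ps_parse [ps_intros]: assumes l: "ps D l" shows "ps D (\<lambda>x. parse (l x))"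
proof -
  have bound: "sz (parse xs) \<le> 4 * sz (e, xs)" for e :: 'a and xs
  proof -
    have "sz (parse xs) \<le> 3 + 4 * length xs"
    proof (induction xs)
      case (Cons c xs)
      then show ?case using sz_parse_step[of c "parse xs"] by (simp add: parse_def)
    qed (simp add: parse_def)
    then show ?thesis using length_le_sz[of xs] by simp
  qed
  have step: "ps UNIV (\<lambda>p. parse_step (fst p) (snd p))"
    unfolding parse_step_def by (intro ps_intros)
  show ?thesis
    by (rule ps_primrec[where r = "\<lambda>e. parse" and a = "\<lambda>e. [[]]" and g = "\<lambda>e c cs. parse_step c"
          and q = "\<lambda>n. 4 * n", OF _ _ _ _ _ bound l ps_id])
      (rule ps_intros ps_comp2[OF step] pol_mult | simp add: parse_def)+
qed

lemma ps_decode [ps_intros]: "ps D l \<Longrightarrow> ps D (\<lambda>x. decode (l x))"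
  unfolding decode_def by (rule ps_intros | assumption)+

section \<open>Components of an encoded structure\<close>

definition dnat :: "data \<Rightarrow> nat" where "dnat d = bits_val (bits_of d)"
definition nats :: "data \<Rightarrow> nat list" where "nats d = map dnat (items d)"
definition bset :: "nat list \<Rightarrow> data" where "bset l = Lst (map binary l)"

text \<open>Integers remain pairs of sign and magnitude, so that comparison and payment need only
  arithmetic on natural numbers.\<close>

definition dint :: "data \<Rightarrow> bool \<times> nat" where
  "dint d = (case bits_of d of [] \<Rightarrow> (False, 0) | b # bs \<Rightarrow> (b, bits_val bs))"
definition bint :: "bool \<times> nat \<Rightarrow> data" where "bint z = Bits (fst z # binary_bits (snd z))"

definition agents :: "data \<Rightarrow> nat list" where "agents D = nats (item 0 D)"
definition res :: "data \<Rightarrow> nat" where "res D = length (bits_of (item 1 D))"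
definition sts :: "data \<Rightarrow> nat list" where "sts D = nats (item 2 D)"
definition acts :: "data \<Rightarrow> nat list" where "acts D = nats (item 3 D)"
definition vals :: "data \<Rightarrow> (nat \<times> nat list) list" where
  "vals D = map (\<lambda>d. (dnat (item 0 d), nats (item 1 d))) (items (item 4 D))"
definition avails :: "data \<Rightarrow> ((nat \<times> nat) \<times> nat list) list" where
  "avails D = map (\<lambda>d. ((dnat (item 0 d), dnat (item 1 d)), nats (item 2 d))) (items (item 5 D))"
definition costs :: "data \<Rightarrow> ((nat \<times> nat) \<times> (bool \<times> nat) list) list" where
  "costs D = map (\<lambda>d. ((dnat (item 0 d), dnat (item 1 d)), map dint (items (item 2 d)))) (items (item 6 D))"
definition deltas :: "data \<Rightarrow> ((nat \<times> nat list) \<times> nat) list" where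
  "deltas D = map (\<lambda>d. ((dnat (item 0 d), nats (item 1 d)), dnat (item 2 d))) (items (item 7 D))"

lemma ps_binary [ps_intros]: "ps D f \<Longrightarrow> ps D (\<lambda>x. binary (f x))"
  unfolding binary_def by (rule ps_intros | assumption)+
lemma ps_dnat [ps_intros]: "ps D f \<Longrightarrow> ps D (\<lambda>x. dnat (f x))"
  unfolding dnat_def by (rule ps_intros | assumption)+
lemma ps_nats [ps_intros]: "ps D f \<Longrightarrow> ps D (\<lambda>x. nats (f x))"
  unfolding nats_def by (rule ps_intros | assumption)+
lemma ps_bset [ps_intros]: "ps D f \<Longrightarrow> ps D (\<lambda>x. bset (f x))"
  unfolding bset_def by (rule ps_intros | assumption)+
lemma ps_dint [ps_intros]: "ps D f \<Longrightarrow> ps D (\<lambda>x. dint (f x))"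
  unfolding dint_def by (rule ps_intros | assumption)+
lemma ps_bint [ps_intros]: "ps D f \<Longrightarrow> ps D (\<lambda>x. bint (f x))"
  unfolding bint_def by (rule ps_intros | assumption)+
lemma ps_agents [ps_intros]: "ps D f \<Longrightarrow> ps D (\<lambda>x. agents (f x))"
  unfolding agents_def by (rule ps_intros | assumption)+
lemma ps_res [ps_intros]: "ps D f \<Longrightarrow> ps D (\<lambda>x. res (f x))"
  unfolding res_def by (rule ps_intros | assumption)+
lemma ps_sts [ps_intros]: "ps D f \<Longrightarrow> ps D (\<lambda>x. sts (f x))"
  unfolding sts_def by (rule ps_intros | assumption)+
lemma ps_acts [ps_intros]: "ps D f \<Longrightarrow> ps D (\<lambda>x. acts (f x))"
  unfolding acts_def by (rule ps_intros | assumption)+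
lemma ps_vals [ps_intros]: "ps D f \<Longrightarrow> ps D (\<lambda>x. vals (f x))"
  unfolding vals_def by (rule ps_intros | assumption)+
lemma ps_avails [ps_intros]: "ps D f \<Longrightarrow> ps D (\<lambda>x. avails (f x))"
  unfolding avails_def by (rule ps_intros | assumption)+
lemma ps_costs [ps_intros]: "ps D f \<Longrightarrow> ps D (\<lambda>x. costs (f x))"
  unfolding costs_def by (rule ps_intros | assumption)+
lemma ps_deltas [ps_intros]: "ps D f \<Longrightarrow> ps D (\<lambda>x. deltas (f x))"
  unfolding deltas_def by (rule ps_intros | assumption)+


section \<open>Checking instances\<close>

text \<open>Lookup of a list-valued entry with default \<open>[]\<close>. Concatenation makes it
  total; if the keys are distinct, at most one block contributes.\<close>

definition look :: "('k \<times> 'v list) list \<Rightarrow> 'k \<Rightarrow> 'v list" where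
  "look l k = concat (map snd (filter (\<lambda>p. fst p = k) l))"

lemma ps_look [ps_intros]: "ps D f \<Longrightarrow> ps D g \<Longrightarrow> ps D (\<lambda>x. look (f x) (g x))"
  proof (rule ps_comp2[where f = look])
  show "ps UNIV (\<lambda>x. look (fst x) (snd x))" unfolding look_def by (intro ps_intros)
qed

lemma ps_member [ps_intros]: "ps D f \<Longrightarrow> ps D g \<Longrightarrow> ps D (\<lambda>x. f x \<in> set (g x))"
proof (rule ps_comp2[where f = "\<lambda>x l. x \<in> set l"])
  have "ps UNIV (\<lambda>p::'b \<times> 'b list. \<exists>y\<in>set (snd p). fst p = y)" by (intro ps_intros)
  then show "ps UNIV (\<lambda>p::'b \<times> 'b list. fst p \<in> set (snd p))" by (rule ps_cong) auto
qed

primrec strict :: "nat list \<Rightarrow> bool" where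
  "strict [] \<longleftrightarrow> True"
| "strict (x # xs) \<longleftrightarrow> (\<forall>y\<in>set xs. x < y) \<and> strict xs"

lemma ps_strict [ps_intros]: assumes l: "ps D l" shows "ps D (\<lambda>x. strict (l x))"
proof -
  have bound: "sz (strict xs) \<le> 3" for e :: 'a and xs by (rule sz_bool_le)
  show ?thesis
    by (rule ps_primrec[where r = "\<lambda>e. strict" and a = "\<lambda>e. True" and g = "\<lambda>e x xs r. (\<forall>y\<in>set xs. x < y) \<and> r"
          and q = "\<lambda>n. 3", OF _ _ _ _ _ bound l ps_id])
      (rule ps_intros | simp)+
qed

text \<open>
  The first elements of the product, as many as the list \<open>c\<close> has.  Cutting off every
  intermediate result keeps them small even if the factors do not come from a valid instance.
\<close>

primrec cut_product :: "bool list \<Rightarrow> nat list list \<Rightarrow> nat list list" where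
  "cut_product c [] = [[]]"
| "cut_product c (xs # xss) =
     map snd (zip c (concat (map (\<lambda>x. map (\<lambda>ys. x # ys) (cut_product c xss)) xs)))"

lemma map_snd_zip_take: "map snd (zip c l) = take (length c) l"
  by (induction c l rule: list_induct2') auto

text \<open>With equal block lengths, either the first block alone supplies the first
  \<open>n\<close> elements, or the inner cut leaves every block unchanged.\<close>

lemma take_concat_blocks:
  assumes "\<And>x. length (f x) = k"
  shows "take n (concat (map (\<lambda>x. take n (f x)) xs)) = take n (concat (map f xs))"
proof (cases "n \<le> k")
  case True
  then show ?thesis using assms by (cases xs) auto
next
  case False
  then show ?thesis using assms by simp
qed

lemma cut_product: "c \<noteq> [] \<Longrightarrow> cut_product c xss = take (length c) (product_lists xss)"
proof (induction xss)
  case (Cons xs xss)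
  have "cut_product c (xs # xss) =
      take (length c) (concat (map (\<lambda>x. take (length c) (map (\<lambda>ys. x # ys) (product_lists xss))) xs))"
    using Cons by (simp add: map_snd_zip_take take_map)
  also have "\<dots> = take (length c) (concat (map (\<lambda>x. map (\<lambda>ys. x # ys) (product_lists xss)) xs))"
    by (rule take_concat_blocks[where k = "length (product_lists xss)"]) simp
  finally show ?case by simp
qed (cases c; simp)

lemma ps_cut_product [ps_intros]:
  assumes c: "ps D c" and l: "ps D l" shows "ps D (\<lambda>x. cut_product (c x) (l x))"
proof -
  have el: "ys \<in> set (cut_product c xss) \<Longrightarrow> sz ys \<le> sz xss" for c ys xss
  proof (induction xss arbitrary: ys)
    case (Cons xs xss)
    then have "ys \<in> set (concat (map (\<lambda>x. map (\<lambda>ys. x # ys) (cut_product c xss)) xs))"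
      by (auto simp: map_snd_zip_take dest: in_set_takeD)
    then obtain x zs where x: "x \<in> set xs" "zs \<in> set (cut_product c xss)" "ys = x # zs" by auto
    then show ?case using Cons.IH[of zs] sz_mem[of x xs] by simp
  qed simp
  have len: "length (cut_product c xss) \<le> Suc (length c)" for c xss
    by (cases xss) (auto simp: map_snd_zip_take)
  have bound: "sz (cut_product c xss) \<le> Suc (Suc (sz (c, xss)) * Suc (sz (c, xss)))" for c xss
  proof -
    have "sz (cut_product c xss) \<le> Suc (length (cut_product c xss) * Suc (sz xss))"
      using el by (rule sz_list_bound)
    also have "\<dots> \<le> Suc (Suc (sz (c, xss)) * Suc (sz (c, xss)))"
      unfolding Suc_le_mono
      by (intro mult_le_mono) (use len[of c xss] length_le_sz[of c] in auto)
    finally show ?thesis .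
  qed
  have pol: "pol (\<lambda>n. Suc (Suc n * Suc n))" by (intro pol_Suc pol_mult) auto
  show ?thesis
    by (rule ps_primrec[where r = cut_product and a = "\<lambda>e. [[]]"
          and g = "\<lambda>c xs xss r. map snd (zip c (concat (map (\<lambda>x. map (\<lambda>ys. x # ys) r) xs)))",
          OF _ _ _ _ pol bound l c])
      (rule ps_intros | simp)+
qed

definition normal_form :: "data \<Rightarrow> data" where
  "normal_form D = Lst [bset (agents D), Bits (bits_of (item 1 D)), bset (sts D), bset (acts D),
     Lst (map (\<lambda>p. Lst [binary (fst p), bset (snd p)]) (vals D)),
     Lst (map (\<lambda>p. Lst [binary (fst (fst p)), binary (snd (fst p)), bset (snd p)]) (avails D)),
     Lst (map (\<lambda>p. Lst [binary (fst (fst p)), binary (snd (fst p)), Lst (map bint (snd p))]) (costs D)),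
     Lst (map (\<lambda>p. Lst [binary (fst (fst p)), bset (snd (fst p)), binary (snd p)]) (deltas D))]"

text \<open>The keys of each table must come in exactly the order in which the encoding lists them.
  The counter given to \<open>cut_product\<close> is one longer than the transition table: a product
  that has been cut off is then longer than the table and the comparison fails, while a product that
  fits is not cut. A negative sign with magnitude 0 is refused because \<open>signed_binary\<close>
  never produces it; together with the sign of the first entry this also gives a first cost of at
  most -1.\<close>

definition ok_cgs :: "data \<Rightarrow> bool" where
  "ok_cgs D \<longleftrightarrow> D = normal_form D \<and> (\<forall>b\<in>set (bits_of (item 1 D)). b) \<and>
     strict (agents D) \<and> agents D \<noteq> [] \<and> 1 \<le> res D \<and>
     strict (sts D) \<and> sts D \<noteq> [] \<and> strict (acts D) \<and> acts D \<noteq> [] \<and>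
     strict (map fst (vals D)) \<and> (\<forall>p\<in>set (vals D). strict (snd p) \<and> (\<forall>s\<in>set (snd p). s \<in> set (sts D))) \<and>
     map fst (avails D) = concat (map (\<lambda>s. map (\<lambda>a. (s, a)) (agents D)) (sts D)) \<and>
     (\<forall>p\<in>set (avails D). strict (snd p) \<and> snd p \<noteq> [] \<and> (\<forall>x\<in>set (snd p). x \<in> set (acts D))) \<and>
     map fst (costs D) = concat (map (\<lambda>s. map (\<lambda>x. (s, x))
       (filter (\<lambda>x. \<exists>a\<in>set (agents D). x \<in> set (look (avails D) (s, a))) (acts D))) (sts D)) \<and>
     (\<forall>p\<in>set (costs D). length (snd p) = res D \<and> (\<forall>z\<in>set (snd p). fst z \<longrightarrow> snd z \<noteq> 0) \<and>
       (case snd p of [] \<Rightarrow> False | z # _ \<Rightarrow> fst z)) \<and>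
     map fst (deltas D) = concat (map (\<lambda>s. map (\<lambda>xs. (s, xs))
       (cut_product (True # map (\<lambda>_. True) (deltas D)) (map (\<lambda>a. look (avails D) (s, a)) (agents D)))) (sts D)) \<and>
     (\<forall>p\<in>set (deltas D). snd p \<in> set (sts D))"

lemma ps_normal_form [ps_intros]: "ps D f \<Longrightarrow> ps D (\<lambda>x. normal_form (f x))"
  unfolding normal_form_def by (rule ps_intros | assumption)+

lemma ps_ok_cgs [ps_intros]: "ps D f \<Longrightarrow> ps D (\<lambda>x. ok_cgs (f x))"
  proof (rule ps_comp[where f = ok_cgs])
  show "ps UNIV (\<lambda>x. ok_cgs x)" unfolding ok_cgs_def by (intro ps_intros)
qed

section \<open>Formulas and instances\<close>

definition ok_bounds :: "data \<Rightarrow> data \<Rightarrow> bool" where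
  "ok_bounds D b \<longleftrightarrow>
     b = Lst (map (\<lambda>x. Lst [binary (dnat (item 0 x)), Lst (map (\<lambda>y. Bits (bits_of y)) (items (item 1 x)))]) (items b)) \<and>
     strict (map (\<lambda>x. dnat (item 0 x)) (items b)) \<and>
     (\<forall>x\<in>set (items b). dnat (item 0 x) \<in> set (agents D) \<and> length (items (item 1 x)) = res D \<and>
        (\<forall>y\<in>set (items (item 1 x)). \<forall>t\<in>set (bits_of y). t))"

lemma ps_ok_bounds [ps_intros]: "ps D f \<Longrightarrow> ps D g \<Longrightarrow> ps D (\<lambda>x. ok_bounds (f x) (g x))"
  proof (rule ps_comp2[where f = ok_bounds])
  show "ps UNIV (\<lambda>x. ok_bounds (fst x) (snd x))" unfolding ok_bounds_def by (intro ps_intros)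
qed

definition ok_node :: "data \<Rightarrow> data \<Rightarrow> bool" where
  "ok_node D d \<longleftrightarrow>
     d = Lst [binary 0, binary (dnat (item 1 d))] \<and> dnat (item 1 d) \<in> set (map fst (vals D)) \<or>
     d = Lst [binary 1, item 1 d] \<or> d = Lst [binary 2, item 1 d, item 2 d] \<or>
     ok_bounds D (item 1 d) \<and> (d = Lst [binary 3, item 1 d, item 2 d] \<or>
       d = Lst [binary 4, item 1 d, item 2 d, item 3 d] \<or> d = Lst [binary 5, item 1 d, item 2 d, item 3 d])"

text \<open>The test \<open>is_Lst\<close> ensures that the results are smaller than
  \<open>d\<close> even if \<open>d\<close> is no formula, as termination of \<open>ok_fm\<close>
  requires; an item of \<open>Bits []\<close> would be \<open>Bits []\<close> again.\<close>

definition subs :: "data \<Rightarrow> data list" where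
  "subs d = (if \<not> is_Lst d then [] else if dnat (item 0 d) = 0 then [] else if dnat (item 0 d) = 1 then [item 1 d]
     else if dnat (item 0 d) = 2 then [item 1 d, item 2 d] else if dnat (item 0 d) = 3 then [item 2 d]
     else [item 2 d, item 3 d])"

lemma size_item: "is_Lst d \<Longrightarrow> size (item i d) < size d"
proof (cases d)
  case (Lst ds)
  show ?thesis
  proof (cases "drop i ds")
    case (Cons x xs)
    then have "x \<in> set ds" by (metis in_set_dropD list.set_intros(1))
    then have "size x \<le> size_list size ds" by (simp add: size_list_estimation')
    then show ?thesis using Lst Cons by (simp add: item_def)
  qed (simp add: item_def Lst)
qed simp

function ok_fm :: "data \<Rightarrow> data \<Rightarrow> bool" where
  "ok_fm D d \<longleftrightarrow> ok_node D d \<and> (\<forall>y\<in>set (subs d). ok_fm D y)"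
  by auto
termination
  by (relation "Wellfounded.measure (\<lambda>(D, d). size d)") (auto simp: subs_def size_item split: if_splits)

declare ok_fm.simps [simp del]

lemma dnat_binary [simp]: "dnat (binary n) = n"
  by (simp add: dnat_def binary_def)

lemma ps_subs: "ps D f \<Longrightarrow> ps D (\<lambda>x. subs (f x))"
  unfolding subs_def by (rule ps_intros | assumption)+

lemma subs_Lst:
  "subs (Lst [binary 0, x]) = []" "subs (Lst [binary 1, x]) = [x]" "subs (Lst [binary 2, x, y]) = [x, y]"
  "subs (Lst [binary 3, b, x]) = [x]" "subs (Lst [binary 4, b, x, y]) = [x, y]" "subs (Lst [binary 5, b, x, y]) = [x, y]"
  by (simp_all add: subs_def)

lemma ok_node_cases:
  assumes "ok_node D d"
  obtains p where "d = Lst [binary 0, binary p]" "p \<in> set (map fst (vals D))"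
  | x where "d = Lst [binary 1, x]"
  | x y where "d = Lst [binary 2, x, y]"
  | b x where "d = Lst [binary 3, b, x]" "ok_bounds D b"
  | b x y where "d = Lst [binary 4, b, x, y]" "ok_bounds D b"
  | b x y where "d = Lst [binary 5, b, x, y]" "ok_bounds D b"
  using assms unfolding ok_node_def by blast

lemma ps_ok_fm [ps_intros]: assumes f: "ps D f" and g: "ps D g" shows "ps D (\<lambda>x. ok_fm (f x) (g x))"
proof (rule ps_worklist[where bad = "\<lambda>D d. \<not> ok_node D d" and nxt = "\<lambda>D d. subs d" and \<mu> = "\<lambda>D. sz" and q = "\<lambda>n. n", OF _ _ _ _ _ _ _ f g])
  show "ps UNIV (\<lambda>p. \<not> ok_node (fst p) (snd p))"
    unfolding ok_node_def by (intro ps_intros)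
  show "ps UNIV (\<lambda>p::data \<times> data. subs (snd p))" by (intro ps_subs ps_intros)
  show "sum_list (map sz (subs d)) < sz d" if "\<not> \<not> ok_node D d" for D d
  proof -
    from that have "ok_node D d" by simp
    then show ?thesis by (cases rule: ok_node_cases) (auto simp: subs_Lst subs_Lst(2)[unfolded One_nat_def])
  qed
  show "ok_fm D d \<longleftrightarrow> \<not> \<not> ok_node D d \<and> (\<forall>y\<in>set (subs d). ok_fm D y)" for D d
    using ok_fm.simps[of D d] by simp
qed auto

definition ok_inst :: "data \<Rightarrow> bool" where
  "ok_inst d \<longleftrightarrow> d = Lst [item 0 d, binary (dnat (item 1 d)), item 2 d] \<and> ok_cgs (item 0 d) \<and>
     dnat (item 1 d) \<in> set (sts (item 0 d)) \<and> ok_fm (item 0 d) (item 2 d)"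

lemma ps_ok_inst [ps_intros]: "ps D f \<Longrightarrow> ps D (\<lambda>x. ok_inst (f x))"
  unfolding ok_inst_def by (rule ps_intros | assumption)+


section \<open>The evaluation tree of an instance\<close>

type_synonym endow = "(nat \<times> nat list) list"
type_synonym position = "data \<times> nat \<times> endow"

text \<open>
  A position consists of a formula, a state and, for the coalition modalities, what the members
  of the coalition own.  The node \<open>(True, [b])\<close> of the tree stands for the position \<open>b\<close>, the
  node \<open>(False, l)\<close> for the NAND of the positions in \<open>l\<close>.
\<close>

type_synonym node = "bool \<times> position list"

definition bounds :: "data \<Rightarrow> endow" where
  "bounds b = map (\<lambda>x. (dnat (item 0 x), map (\<lambda>y. length (bits_of y)) (items (item 1 x)))) (items b)"

text \<open>Each modality starts afresh with the amounts written in it, whatever is left in the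
  surrounding play. The tags 0 to 2 carry no bounds.\<close>

definition start :: "data \<Rightarrow> nat \<Rightarrow> position" where
  "start d s = (d, s, if dnat (item 0 d) < 3 then [] else bounds (item 1 d))"

text \<open>Joint actions are the lists of actions that occur in the transition table.\<close>

definition moves :: "data \<Rightarrow> nat \<Rightarrow> nat list list" where
  "moves D s = map (\<lambda>p. snd (fst p)) (filter (\<lambda>p. fst (fst p) = s) (deltas D))"

text \<open>A choice of the coalition is represented by any joint action extending it; two joint
  actions represent the same choice iff their \<open>team\<close> lists coincide. The repetitions do
  no harm below an existential quantifier.\<close>

definition team :: "data \<Rightarrow> endow \<Rightarrow> nat list \<Rightarrow> nat list" where
  "team D e xs = map snd (filter (\<lambda>p. fst p \<in> set (map fst e)) (zip (agents D) xs))"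

definition succs :: "data \<Rightarrow> nat \<Rightarrow> endow \<Rightarrow> nat list \<Rightarrow> nat list" where
  "succs D s e xs = map snd (filter (\<lambda>p. fst (fst p) = s \<and> team D e (snd (fst p)) = team D e xs) (deltas D))"

definition cost_vec :: "data \<Rightarrow> nat \<Rightarrow> nat list \<Rightarrow> nat \<Rightarrow> (bool \<times> nat) list" where
  "cost_vec D s xs a = concat (map (\<lambda>p. look (costs D) (s, snd p)) (filter (\<lambda>p. fst p = a) (zip (agents D) xs)))"

definition affordable :: "data \<Rightarrow> nat \<Rightarrow> endow \<Rightarrow> nat list \<Rightarrow> bool" where
  "affordable D s e xs \<longleftrightarrow> (\<forall>p\<in>set e. \<forall>q\<in>set (zip (snd p) (cost_vec D s xs (fst p))).
     fst (snd q) \<longrightarrow> snd (snd q) \<le> fst q)"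

definition pay :: "data \<Rightarrow> nat \<Rightarrow> endow \<Rightarrow> nat list \<Rightarrow> endow" where
  "pay D s e xs = map (\<lambda>p. (fst p, map (\<lambda>q. if fst (snd q) then fst q - snd (snd q) else fst q + snd (snd q))
     (zip (snd p) (cost_vec D s xs (fst p))))) e"

text \<open>Two NAND levels make a position the disjunction, over its options, of the conjunction of
  their positions; so \<open>[(False, [])]\<close> is truth and \<open>[]\<close> is falsity.
  Negation is a single NAND and has a position as its child directly. In a release, an action that
  cannot be paid ends the computation, and then the second formula at the present state is all that
  is required.\<close>

definition options :: "data \<Rightarrow> position \<Rightarrow> node list" where
  "options D b = (case b of (d, s, e) \<Rightarrow>
     if dnat (item 0 d) = 0 then if s \<in> set (look (vals D) (dnat (item 1 d))) then [(False, [])] else []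
     else if dnat (item 0 d) = 1 then [(True, [start (item 1 d) s])]
     else if dnat (item 0 d) = 2 then [(False, [start (item 1 d) s]), (False, [start (item 2 d) s])]
     else if e = [] then [(False, [])]
     else if dnat (item 0 d) = 3 then
       map (\<lambda>xs. (False, map (\<lambda>t. start (item 2 d) t) (succs D s e xs))) (filter (\<lambda>xs. affordable D s e xs) (moves D s))
     else if dnat (item 0 d) = 4 then
       (False, [start (item 3 d) s]) #
       map (\<lambda>xs. (False, start (item 2 d) s # map (\<lambda>t. (d, t, pay D s e xs)) (succs D s e xs)))
         (filter (\<lambda>xs. affordable D s e xs) (moves D s))
     else
       (False, [start (item 3 d) s, start (item 2 d) s]) #
       map (\<lambda>xs. (False, start (item 3 d) s #
           (if affordable D s e xs then map (\<lambda>t. (d, t, pay D s e xs)) (succs D s e xs) else []))) (moves D s))"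

definition children :: "data \<Rightarrow> node \<Rightarrow> node list" where
  "children D x = (if fst x then (case snd x of [] \<Rightarrow> [] | b # _ \<Rightarrow> options D b) else map (\<lambda>b. (True, [b])) (snd x))"

lemma ps_bounds: "ps D f \<Longrightarrow> ps D (\<lambda>x. bounds (f x))"
  unfolding bounds_def by (rule ps_intros | assumption)+

lemma ps_start: "ps D f \<Longrightarrow> ps D g \<Longrightarrow> ps D (\<lambda>x. start (f x) (g x))"
proof (rule ps_comp2[where f = start])
  show "ps UNIV (\<lambda>x. start (fst x) (snd x))" unfolding start_def by (intro ps_intros ps_bounds)
qed

lemma ps_moves: "ps D f \<Longrightarrow> ps D g \<Longrightarrow> ps D (\<lambda>x. moves (f x) (g x))"
proof (rule ps_comp2[where f = moves])
  show "ps UNIV (\<lambda>x. moves (fst x) (snd x))" unfolding moves_def by (intro ps_intros)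
qed

lemma ps_team: "ps D f \<Longrightarrow> ps D g \<Longrightarrow> ps D h \<Longrightarrow> ps D (\<lambda>x. team (f x) (g x) (h x))"
proof (rule ps_comp3[where f = team])
  show "ps UNIV (\<lambda>x. team (fst x) (fst (snd x)) (snd (snd x)))" unfolding team_def by (intro ps_intros)
qed

lemma ps_succs: "ps D f \<Longrightarrow> ps D g \<Longrightarrow> ps D h \<Longrightarrow> ps D k \<Longrightarrow> ps D (\<lambda>x. succs (f x) (g x) (h x) (k x))"
proof (rule ps_comp4[where f = succs])
  show "ps UNIV (\<lambda>x. succs (fst x) (fst (snd x)) (fst (snd (snd x))) (snd (snd (snd x))))"
    unfolding succs_def by (intro ps_intros ps_team)
qed

lemma ps_cost_vec: "ps D f \<Longrightarrow> ps D g \<Longrightarrow> ps D h \<Longrightarrow> ps D k \<Longrightarrow> ps D (\<lambda>x. cost_vec (f x) (g x) (h x) (k x))"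
proof (rule ps_comp4[where f = cost_vec])
  show "ps UNIV (\<lambda>x. cost_vec (fst x) (fst (snd x)) (fst (snd (snd x))) (snd (snd (snd x))))"
    unfolding cost_vec_def by (intro ps_intros)
qed

lemma ps_affordable: "ps D f \<Longrightarrow> ps D g \<Longrightarrow> ps D h \<Longrightarrow> ps D k \<Longrightarrow> ps D (\<lambda>x. affordable (f x) (g x) (h x) (k x))"
proof (rule ps_comp4[where f = affordable])
  show "ps UNIV (\<lambda>x. affordable (fst x) (fst (snd x)) (fst (snd (snd x))) (snd (snd (snd x))))"
    unfolding affordable_def by (intro ps_intros ps_cost_vec)
qed

lemma ps_pay: "ps D f \<Longrightarrow> ps D g \<Longrightarrow> ps D h \<Longrightarrow> ps D k \<Longrightarrow> ps D (\<lambda>x. pay (f x) (g x) (h x) (k x))"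
proof (rule ps_comp4[where f = pay])
  show "ps UNIV (\<lambda>x. pay (fst x) (fst (snd x)) (fst (snd (snd x))) (snd (snd (snd x))))"
    unfolding pay_def by (intro ps_intros ps_cost_vec)
qed

lemma ps_choices: "ps D f \<Longrightarrow> ps D g \<Longrightarrow> ps D (\<lambda>x. options (f x) (g x))"
proof (rule ps_comp2[where f = options])
  show "ps UNIV (\<lambda>x. options (fst x) (snd x))" unfolding options_def
    by (intro ps_intros ps_start ps_moves ps_team ps_succs ps_affordable ps_pay)
qed

lemma ps_children: "ps UNIV (\<lambda>x. children (fst x) (snd x))"
  unfolding children_def by (intro ps_intros ps_choices)


section \<open>The bounded game, one step at a time\<close>

definition can_pay :: "('a, 's, 'p, 'x) cgs \<Rightarrow> 'a set \<Rightarrow> ('a \<Rightarrow> nat \<Rightarrow> nat) \<Rightarrow> 's \<Rightarrow> ('a \<Rightarrow> 'x) \<Rightarrow> bool" where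
  "can_pay M A b s \<sigma> \<longleftrightarrow> (\<forall>a\<in>A. \<forall>j<nres M. consumed M s (\<sigma> a) j \<le> int (b a j))"

text \<open>The remaining amounts as a new bound, so that the rest of a play is itself a play from a
  bound. Where the action can be paid, \<open>nat\<close> truncates nothing.\<close>

definition spend :: "('a, 's, 'p, 'x) cgs \<Rightarrow> ('a \<Rightarrow> nat \<Rightarrow> nat) \<Rightarrow> 's \<Rightarrow> ('a \<Rightarrow> 'x) \<Rightarrow> 'a \<Rightarrow> nat \<Rightarrow> nat" where
  "spend M b s \<sigma> a j = nat (int (b a j) - consumed M s (\<sigma> a) j + produced M s (\<sigma> a) j)"

text \<open>The common form of the three modalities. The property is a parameter because unfolding
  one step turns \<open>Q\<close> into \<open>\<lambda>l. Q (s # l)\<close>.\<close>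

definition win :: "('a, 's, 'p, 'x) cgs \<Rightarrow> 'a set \<Rightarrow> 's \<Rightarrow> ('a \<Rightarrow> nat \<Rightarrow> nat) \<Rightarrow> ('s list \<Rightarrow> bool) \<Rightarrow> bool" where
  "win M A s b Q \<longleftrightarrow> (\<exists>F. strategy M A F \<and> (\<forall>l\<in>out M A s F b. Q l))"

lemma produced_nonneg: "0 \<le> produced M s x j"
  by (simp add: produced_def)

text \<open>After the first step, the accounts are those of a play that starts with the remaining
  amounts and follows the residual strategy. Only members of the coalition and actual resources are
  covered, since \<open>can_pay\<close> says nothing about others.\<close>

lemma endowment_Cons:
  assumes "can_pay M A b s (F [s])" "a \<in> A" "j < nres M"
  shows "endowment M F b (s # l) (Suc i) a j = endowment M (\<lambda>l. F (s # l)) (spend M b s (F [s])) l i a j"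
proof (induction i)
  case 0
  have "consumed M s (F [s] a) j \<le> int (b a j)" using assms by (auto simp: can_pay_def)
  then show ?case using produced_nonneg[of M s "F [s] a" j] by (simp add: spend_def)
next
  case (Suc i)
  then show ?case by simp
qed

lemma all_less_Suc_split: "(\<forall>i. Suc i < Suc n \<longrightarrow> P i) \<longleftrightarrow> (0 < n \<longrightarrow> P 0) \<and> (\<forall>i. Suc i < n \<longrightarrow> P (Suc i))"
  by (cases n) (simp_all add: All_less_Suc2)

lemma b_consistent_single: "b_consistent M A F b [s] \<longleftrightarrow> s \<in> St M"
  by (simp add: b_consistent_def consistent_def)

lemma b_consistent_Cons:
  "b_consistent M A F b (s # t # l) \<longleftrightarrow> s \<in> St M \<and> t \<in> outcomes M A s (F [s]) \<and> can_pay M A b s (F [s]) \<and>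
     b_consistent M A (\<lambda>l. F (s # l)) (spend M b s (F [s])) (t # l)"
proof (cases "can_pay M A b s (F [s])")
  case True
  have len: "length (s # t # l) = Suc (length (t # l))" by simp
  show ?thesis
    unfolding b_consistent_def consistent_def len all_less_Suc_split
    using True endowment_Cons[of M A b s F, OF True] by (auto simp: can_pay_def)
next
  case False
  have "can_pay M A b s (F [s])" if "b_consistent M A F b (s # t # l)"
    using conjunct2[OF that[unfolded b_consistent_def], rule_format, of 0] by (simp add: can_pay_def)
  with False show ?thesis by blast
qed

lemma outcomes_subset: "rb_cgs M \<Longrightarrow> s \<in> St M \<Longrightarrow> outcomes M A s \<sigma> \<subseteq> St M"
  by (auto simp: outcomes_def rb_cgs_def)

lemma joint_actions_ne: "rb_cgs M \<Longrightarrow> A \<subseteq> Agt M \<Longrightarrow> s \<in> St M \<Longrightarrow> joint_actions M A s \<noteq> {}"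
  by (auto simp: joint_actions_def PiE_eq_empty_iff rb_cgs_def)

lemma outcomes_ne:
  assumes "rb_cgs M" "A \<subseteq> Agt M" "s \<in> St M" "\<sigma> \<in> joint_actions M A s"
  shows "outcomes M A s \<sigma> \<noteq> {}"
proof -
  obtain \<tau> where \<tau>: "\<tau> \<in> joint_actions M (Agt M) s" using joint_actions_ne[OF assms(1) _ assms(3), of "Agt M"] by auto
  let ?\<rho> = "\<lambda>a. if a \<in> A then \<sigma> a else \<tau> a"
  have "?\<rho> \<in> joint_actions M (Agt M) s"
    using \<tau> assms(2,4) by (auto simp: joint_actions_def PiE_iff extensional_def)
  moreover have "restrict ?\<rho> A = \<sigma>"
    using assms(4) by (auto simp: joint_actions_def PiE_iff extensional_def fun_eq_iff)
  ultimately show ?thesis unfolding outcomes_def by blast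
qed

text \<open>Outcomes always exist, so only the lack of resources can stop a computation.\<close>

lemma b_maximal_single:
  assumes "rb_cgs M" "A \<subseteq> Agt M" "s \<in> St M" "strategy M A F"
  shows "b_maximal M A F b [s] \<longleftrightarrow> \<not> can_pay M A b s (F [s])"
proof -
  have "F [s] \<in> joint_actions M A s" using assms(3,4) by (auto simp: strategy_def dest!: bspec[of _ _ "[s]"])
  from outcomes_ne[OF assms(1-3) this] outcomes_subset[OF assms(1,3)]
  show ?thesis using assms(3)
    by (auto simp: b_maximal_def b_consistent_single b_consistent_Cons)
qed

lemma b_maximal_Cons:
  assumes "s \<in> St M"
  shows "b_maximal M A F b (s # t # l) \<longleftrightarrow> t \<in> outcomes M A s (F [s]) \<and> can_pay M A b s (F [s]) \<and>
     b_maximal M A (\<lambda>l. F (s # l)) (spend M b s (F [s])) (t # l)"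
  using assms by (auto simp: b_maximal_def b_consistent_Cons)

lemma b_maximal_Nil: "\<not> b_maximal M A F b []"
  by (simp add: b_maximal_def b_consistent_def consistent_def)

lemma out_ne: "l \<in> out M A s F b \<Longrightarrow> l \<noteq> [] \<and> hd l = s"
  by (auto simp: out_def b_maximal_def b_consistent_def consistent_def)

lemma out_unfold:
  assumes "rb_cgs M" "A \<subseteq> Agt M" "s \<in> St M" "strategy M A F"
  shows "out M A s F b = (if can_pay M A b s (F [s])
    then (\<Union>t\<in>outcomes M A s (F [s]). (\<lambda>l. s # l) ` out M A t (\<lambda>l. F (s # l)) (spend M b s (F [s]))) else {[s]})"
proof -
  have "l \<in> out M A s F b \<longleftrightarrow> (if can_pay M A b s (F [s])
    then \<exists>t\<in>outcomes M A s (F [s]). \<exists>l'\<in>out M A t (\<lambda>l. F (s # l)) (spend M b s (F [s])). l = s # l' else l = [s])" for l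
  proof (cases l)
    case Nil
    then show ?thesis by (auto dest: out_ne)
  next
    case (Cons s' l')
    show ?thesis
    proof (cases l')
      case Nil
      then show ?thesis using Cons b_maximal_single[OF assms, of b] by (auto simp: out_def b_maximal_Nil dest: out_ne)
    next
      case Cons': (Cons t l'')
      have "l \<in> out M A s F b \<longleftrightarrow> s' = s \<and> t \<in> outcomes M A s (F [s]) \<and> can_pay M A b s (F [s]) \<and>
          t # l'' \<in> out M A t (\<lambda>l. F (s # l)) (spend M b s (F [s]))"
        using b_maximal_Cons[OF assms(3), of A F b t l''] by (auto simp: out_def Cons Cons')
      moreover have "u = t" if "t # l'' \<in> out M A u G b'" for u G b' using out_ne[OF that] by simp
      ultimately show ?thesis by (auto simp: Cons Cons')
    qed
  qed
  note mem = this
  show ?thesis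
  proof (rule set_eqI)
    fix l
    show "l \<in> out M A s F b \<longleftrightarrow> l \<in> (if can_pay M A b s (F [s])
      then (\<Union>t\<in>outcomes M A s (F [s]). (\<lambda>l. s # l) ` out M A t (\<lambda>l. F (s # l)) (spend M b s (F [s]))) else {[s]})"
      unfolding mem[of l] by (cases "can_pay M A b s (F [s])") auto
  qed
qed

lemma strategy_Cons: "strategy M A F \<Longrightarrow> s \<in> St M \<Longrightarrow> strategy M A (\<lambda>l. F (s # l))"
  unfolding strategy_def by (metis Cons_in_lists_iff last_ConsR list.distinct(1))

lemma endowment_cong:
  assumes "\<And>l'. l' \<noteq> [] \<Longrightarrow> hd l' = hd l \<Longrightarrow> F l' = G l'" "l \<noteq> []"
  shows "endowment M F b l i = endowment M G b l i"
  using assms by (induction i) auto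

lemma b_consistent_cong:
  assumes "\<And>l'. l' \<noteq> [] \<Longrightarrow> hd l' = hd l \<Longrightarrow> F l' = G l'"
  shows "b_consistent M A F b l = b_consistent M A G b l"
proof (cases "l = []")
  case False
  have "F (take (Suc i) l) = G (take (Suc i) l)" for i using assms[of "take (Suc i) l"] False by simp
  then show ?thesis using endowment_cong[of l F G M b, OF assms False] by (simp add: b_consistent_def consistent_def)
qed (simp add: b_consistent_def consistent_def)

lemma out_cong:
  assumes "\<And>l'. l' \<noteq> [] \<Longrightarrow> hd l' = s \<Longrightarrow> F l' = G l'"
  shows "out M A s F b = out M A s G b"
proof -
  have "b_maximal M A F b l = b_maximal M A G b l" if "hd l = s" for l
  proof (cases "l = []")
    case False
    have "b_consistent M A F b l = b_consistent M A G b l"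
      using assms that by (intro b_consistent_cong) auto
    moreover have "b_consistent M A F b (l @ [t]) = b_consistent M A G b (l @ [t])" for t
      using assms that False by (intro b_consistent_cong) auto
    ultimately show ?thesis by (simp add: b_maximal_def)
  qed (simp add: b_maximal_def b_consistent_def consistent_def)
  then show ?thesis by (auto simp: out_def)
qed

lemma strategy_ex:
  assumes "rb_cgs M" "A \<subseteq> Agt M"
  obtains F where "strategy M A F"
proof
  show "strategy M A (\<lambda>l. SOME \<sigma>. \<sigma> \<in> joint_actions M A (last l))"
    unfolding strategy_def using joint_actions_ne[OF assms] by (auto simp: some_in_eq in_lists_conv_set)
qed

text \<open>Strategies see the whole history, including its second state; therefore separately
  chosen strategies for the successors can be glued into one that first plays
  \<open>\<sigma>\<close>.\<close>

lemma win_unfold: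
  assumes "rb_cgs M" "A \<subseteq> Agt M" "s \<in> St M"
  shows "win M A s b Q \<longleftrightarrow> (\<exists>\<sigma>\<in>joint_actions M A s. if can_pay M A b s \<sigma>
    then \<forall>t\<in>outcomes M A s \<sigma>. win M A t (spend M b s \<sigma>) (\<lambda>l. Q (s # l)) else Q [s])" (is "_ \<longleftrightarrow> ?r")
proof
  assume "win M A s b Q"
  then obtain F where F: "strategy M A F" "\<forall>l\<in>out M A s F b. Q l" by (auto simp: win_def)
  have "F [s] \<in> joint_actions M A s" using F(1) assms(3) by (auto simp: strategy_def dest!: bspec[of _ _ "[s]"])
  moreover have "if can_pay M A b s (F [s]) then \<forall>t\<in>outcomes M A s (F [s]). win M A t (spend M b s (F [s])) (\<lambda>l. Q (s # l)) else Q [s]"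
    using F(2) strategy_Cons[OF F(1) assms(3)] unfolding out_unfold[OF assms F(1)] by (auto simp: win_def)
  ultimately show ?r by blast
next
  assume ?r
  then obtain \<sigma> where \<sigma>: "\<sigma> \<in> joint_actions M A s" "if can_pay M A b s \<sigma>
    then \<forall>t\<in>outcomes M A s \<sigma>. win M A t (spend M b s \<sigma>) (\<lambda>l. Q (s # l)) else Q [s]" by blast
  obtain F0 where F0: "strategy M A F0" using strategy_ex[OF assms(1,2)] .
  \<comment> \<open>States that are no outcomes get an arbitrary strategy, so that the family
    \<open>G\<close> is total.\<close>
  have "\<exists>G. strategy M A G \<and> (can_pay M A b s \<sigma> \<longrightarrow> t \<in> outcomes M A s \<sigma> \<longrightarrow>
      (\<forall>l\<in>out M A t G (spend M b s \<sigma>). Q (s # l)))" for t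
  proof (cases "can_pay M A b s \<sigma> \<and> t \<in> outcomes M A s \<sigma>")
    case True
    then show ?thesis using \<sigma>(2) by (simp add: win_def)
  next
    case False
    then show ?thesis using F0 by blast
  qed
  then obtain G where G: "\<And>t. strategy M A (G t)" "\<And>t l. can_pay M A b s \<sigma> \<Longrightarrow> t \<in> outcomes M A s \<sigma> \<Longrightarrow>
      l \<in> out M A t (G t) (spend M b s \<sigma>) \<Longrightarrow> Q (s # l)" by metis
  \<comment> \<open>\<open>F0\<close> answers one-element histories other than \<open>[s]\<close>;
    they do not occur in plays from \<open>s\<close>, but a strategy must be defined on
    them.\<close>
  define F where "F l = (if l = [s] then \<sigma> else if tl l = [] then F0 l else G (hd (tl l)) (tl l))" for l
  have Fs: "F [s] = \<sigma>" by (simp add: F_def)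
  have F: "strategy M A F"
    unfolding strategy_def
  proof (intro ballI impI)
    fix l assume l: "l \<in> lists (St M)" "l \<noteq> []"
    show "F l \<in> joint_actions M A (last l)"
    proof (cases "tl l = []")
      case True
      then show ?thesis using l \<sigma>(1) F0 by (auto simp: F_def strategy_def)
    next
      case False
      then have "tl l \<in> lists (St M)" "last (tl l) = last l" using l by (auto simp: last_tl neq_Nil_conv)
      then show ?thesis using False G(1)[of "hd (tl l)"] by (auto simp: F_def strategy_def)
    qed
  qed
  have "out M A t (\<lambda>l. F (s # l)) b' = out M A t (G t) b'" for t b'
    by (rule out_cong) (auto simp: F_def)
  then have "\<forall>l\<in>out M A s F b. Q l"
    using \<sigma>(2) G(2) unfolding out_unfold[OF assms F] Fs by auto
  with F show "win M A s b Q" by (auto simp: win_def)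
qed

lemma win_cong:
  "(\<And>l. l \<noteq> [] \<Longrightarrow> hd l = s \<Longrightarrow> Q l \<longleftrightarrow> Q' l) \<Longrightarrow> win M A s b Q \<longleftrightarrow> win M A s b Q'"
  unfolding win_def by (metis out_ne)

lemma win_True: "rb_cgs M \<Longrightarrow> A \<subseteq> Agt M \<Longrightarrow> win M A s b (\<lambda>_. True)"
  by (auto simp: win_def elim: strategy_ex)

lemma spend_less:
  assumes "rb_cgs M" "A \<subseteq> Agt M" "s \<in> St M" "\<sigma> \<in> joint_actions M A s" "can_pay M A b s \<sigma>" "a \<in> A"
  shows "spend M b s \<sigma> a 0 < b a 0"
proof -
  have "\<sigma> a \<in> avail M s a" using assms(4,6) by (auto simp: joint_actions_def)
  then have "cost M s (\<sigma> a) 0 \<le> -1" using assms by (auto simp: rb_cgs_def)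
  moreover have "consumed M s (\<sigma> a) 0 \<le> int (b a 0)" using assms by (auto simp: can_pay_def rb_cgs_def)
  ultimately show ?thesis by (simp add: spend_def consumed_def produced_def)
qed

text \<open>Maximal computations exist against every strategy: each paid step lowers the diminishing
  resource of the member \<open>a\<close>, which cannot go on forever.\<close>

lemma win_False:
  assumes "rb_cgs M" "A \<subseteq> Agt M" "a \<in> A" "s \<in> St M"
  shows "\<not> win M A s b (\<lambda>_. False)"
  using assms(4)
proof (induction "b a 0" arbitrary: b s rule: less_induct)
  case less
  show ?case
  proof
    assume "win M A s b (\<lambda>_. False)"
    then obtain \<sigma> where \<sigma>: "\<sigma> \<in> joint_actions M A s" "can_pay M A b s \<sigma>"
      "\<forall>t\<in>outcomes M A s \<sigma>. win M A t (spend M b s \<sigma>) (\<lambda>_. False)"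
      unfolding win_unfold[OF assms(1,2) less.prems] by (auto split: if_splits)
    obtain t where t: "t \<in> outcomes M A s \<sigma>" using outcomes_ne[OF assms(1,2) less.prems \<sigma>(1)] by auto
    moreover have "t \<in> St M" using t outcomes_subset[OF assms(1) less.prems] by auto
    ultimately show False
      using less.hyps[of "spend M b s \<sigma>" t] spend_less[OF assms(1,2) less.prems \<sigma>(1,2) assms(3)] \<sigma>(3) by blast
  qed
qed

text \<open>Once the present state has decided a property, only the existence of a maximal
  computation matters; this is where nonemptiness of the coalition enters.\<close>

lemma win_const:
  assumes "rb_cgs M" "A \<subseteq> Agt M" "A \<noteq> {}" "s \<in> St M"
  shows "win M A s b (\<lambda>_. c) \<longleftrightarrow> c"
  using win_True[OF assms(1,2), of s b] win_False[OF assms(1,2) _ assms(4), of _ b] assms(3) by (cases c) auto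

lemma win_empty:
  assumes "rb_cgs M" "s \<in> St M"
  shows "win M {} s b Q"
proof -
  obtain F where F: "strategy M {} F" using strategy_ex[OF assms(1), of "{}"] by auto
  have "l \<notin> out M {} s F b" for l
    using assms(2) F
  proof (induction l arbitrary: s F b)
    case Nil
    then show ?case by (auto dest: out_ne)
  next
    case (Cons x l)
    have "can_pay M {} b s (F [s])" by (simp add: can_pay_def)
    then show ?case
      using Cons.IH[OF _ strategy_Cons[OF Cons.prems(2,1)]] outcomes_subset[OF assms(1) Cons.prems(1), of "{}" "F [s]"]
      unfolding out_unfold[OF assms(1) _ Cons.prems, of b, simplified] by auto
  qed
  with F show ?thesis by (auto simp: win_def)
qed

section \<open>Expansion laws of the temporal modalities\<close>

definition "untilQ P R l \<longleftrightarrow> (\<exists>i<length l. R (l ! i) \<and> (\<forall>j<i. P (l ! j)))"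
definition "releaseQ P R l \<longleftrightarrow> (\<exists>i<length l. P (l ! i) \<and> (\<forall>j\<le>i. R (l ! j))) \<or> (\<forall>j<length l. R (l ! j))"

lemma sat_win:
  "sat M (Next A b \<phi>) s \<longleftrightarrow> win M A s b (\<lambda>l. length l \<ge> 2 \<and> sat M \<phi> (l ! 1))"
  "sat M (Until A b \<phi> \<psi>) s \<longleftrightarrow> win M A s b (untilQ (sat M \<phi>) (sat M \<psi>))"
  "sat M (Release A b \<phi> \<psi>) s \<longleftrightarrow> win M A s b (releaseQ (sat M \<phi>) (sat M \<psi>))"
  by (simp_all add: win_def untilQ_def releaseQ_def)

lemma untilQ_Cons: "untilQ P R (s # l) \<longleftrightarrow> R s \<or> P s \<and> untilQ P R l"
proof
  assume "untilQ P R (s # l)"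
  then obtain i where "i < length (s # l)" "R ((s # l) ! i)" "\<forall>j<i. P ((s # l) ! j)" by (auto simp: untilQ_def)
  then show "R s \<or> P s \<and> untilQ P R l" by (cases i) (force simp: untilQ_def)+
next
  assume "R s \<or> P s \<and> untilQ P R l"
  then show "untilQ P R (s # l)"
  proof
    assume "P s \<and> untilQ P R l"
    then obtain i where "i < length l" "R (l ! i)" "\<forall>j<i. P (l ! j)" "P s" by (auto simp: untilQ_def)
    then show ?thesis unfolding untilQ_def by (intro exI[of _ "Suc i"]) (auto simp: less_Suc_eq_0_disj)
  qed (auto simp: untilQ_def)
qed

lemma releaseQ_Cons: "releaseQ P R (s # l) \<longleftrightarrow> R s \<and> (P s \<or> releaseQ P R l)"
proof -
  have 1: "(\<exists>i<length (s # l). P ((s # l) ! i) \<and> (\<forall>j\<le>i. R ((s # l) ! j))) \<longleftrightarrow>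
      R s \<and> (P s \<or> (\<exists>i<length l. P (l ! i) \<and> (\<forall>j\<le>i. R (l ! j))))"
  proof
    assume "\<exists>i<length (s # l). P ((s # l) ! i) \<and> (\<forall>j\<le>i. R ((s # l) ! j))"
    then obtain i where i: "i < length (s # l)" "P ((s # l) ! i)" "\<forall>j\<le>i. R ((s # l) ! j)" by auto
    then have "R s" by auto
    then show "R s \<and> (P s \<or> (\<exists>i<length l. P (l ! i) \<and> (\<forall>j\<le>i. R (l ! j))))" using i by (cases i) (force)+
  next
    assume r: "R s \<and> (P s \<or> (\<exists>i<length l. P (l ! i) \<and> (\<forall>j\<le>i. R (l ! j))))"
    then consider "P s" | i where "i < length l" "P (l ! i)" "\<forall>j\<le>i. R (l ! j)" by auto
    then show "\<exists>i<length (s # l). P ((s # l) ! i) \<and> (\<forall>j\<le>i. R ((s # l) ! j))"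
    proof cases
      case 1
      then show ?thesis using r by (intro exI[of _ 0]) auto
    next
      case 2
      then show ?thesis using r by (intro exI[of _ "Suc i"]) (auto simp: nth_Cons split: nat.splits)
    qed
  qed
  have 2: "(\<forall>j<length (s # l). R ((s # l) ! j)) \<longleftrightarrow> R s \<and> (\<forall>j<length l. R (l ! j))"
    by (auto simp: less_Suc_eq_0_disj)
  show ?thesis unfolding releaseQ_def 1 2 by blast
qed

lemma sat_Next:
  assumes "rb_cgs M" "A \<subseteq> Agt M" "A \<noteq> {}" "s \<in> St M"
  shows "sat M (Next A b \<phi>) s \<longleftrightarrow>
    (\<exists>\<sigma>\<in>joint_actions M A s. can_pay M A b s \<sigma> \<and> (\<forall>t\<in>outcomes M A s \<sigma>. sat M \<phi> t))"
proof -
  have "win M A t b' (\<lambda>l. length (s # l) \<ge> 2 \<and> sat M \<phi> ((s # l) ! 1)) \<longleftrightarrow> sat M \<phi> t" if "t \<in> St M" for t b'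
  proof -
    have "win M A t b' (\<lambda>l. length (s # l) \<ge> 2 \<and> sat M \<phi> ((s # l) ! 1)) \<longleftrightarrow> win M A t b' (\<lambda>_. sat M \<phi> t)"
      by (rule win_cong) (auto simp: neq_Nil_conv)
    then show ?thesis using win_const[OF assms(1-3) that] by simp
  qed
  then show ?thesis
    unfolding sat_win win_unfold[OF assms(1,2,4), of b]
    using outcomes_subset[OF assms(1,4)] by (auto simp: subset_iff split: if_splits)
qed

text \<open>The fixpoint law, with the bound updated by the payment. Conditions on \<open>s\<close>
  alone can be pulled out of the quantifiers because joint actions and outcomes exist.\<close>

lemma sat_Until:
  assumes "rb_cgs M" "A \<subseteq> Agt M" "A \<noteq> {}" "s \<in> St M"
  shows "sat M (Until A b \<phi> \<psi>) s \<longleftrightarrow> sat M \<psi> s \<or> sat M \<phi> s \<and>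
    (\<exists>\<sigma>\<in>joint_actions M A s. can_pay M A b s \<sigma> \<and> (\<forall>t\<in>outcomes M A s \<sigma>. sat M (Until A (spend M b s \<sigma>) \<phi> \<psi>) t))"
proof -
  let ?Q = "untilQ (sat M \<phi>) (sat M \<psi>)"
  have c: "win M A t b' (\<lambda>l. ?Q (s # l)) \<longleftrightarrow> sat M \<psi> s \<or> sat M \<phi> s \<and> win M A t b' ?Q" if "t \<in> St M" for t b'
    using win_const[OF assms(1-3) that, of b'] by (cases "sat M \<psi> s"; cases "sat M \<phi> s") (simp_all add: untilQ_Cons)
  have e: "?Q [s] \<longleftrightarrow> sat M \<psi> s" by (simp add: untilQ_def)
  have out: "t \<in> St M" if "t \<in> outcomes M A s \<sigma>" for t \<sigma> using that outcomes_subset[OF assms(1,4)] by blast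
  have ne: "\<exists>t. t \<in> outcomes M A s \<sigma>" if "\<sigma> \<in> joint_actions M A s" for \<sigma> using outcomes_ne[OF assms(1,2,4) that] by blast
  have ja: "\<exists>\<sigma>. \<sigma> \<in> joint_actions M A s" using joint_actions_ne[OF assms(1,2,4)] by blast
  show ?thesis
proof -
    have "win M A s b ?Q \<longleftrightarrow> (\<exists>\<sigma>\<in>joint_actions M A s. if can_pay M A b s \<sigma>
      then \<forall>t\<in>outcomes M A s \<sigma>. sat M \<psi> s \<or> sat M \<phi> s \<and> win M A t (spend M b s \<sigma>) ?Q else sat M \<psi> s)"
      unfolding win_unfold[OF assms(1,2,4), of b] e using c out by (intro bex_cong if_cong ball_cong refl) blast
    then show ?thesis
      unfolding sat_win using ne ja by (cases "sat M \<psi> s"; cases "sat M \<phi> s") auto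
  qed
qed

text \<open>In contrast to until, an action that cannot be paid is a good choice: it ends the
  computation at \<open>s\<close>, and release then asks only for \<open>\<psi>\<close> there. Hence
  an implication where until has a conjunction.\<close>

lemma sat_Release:
  assumes "rb_cgs M" "A \<subseteq> Agt M" "A \<noteq> {}" "s \<in> St M"
  shows "sat M (Release A b \<phi> \<psi>) s \<longleftrightarrow> sat M \<psi> s \<and> (sat M \<phi> s \<or>
    (\<exists>\<sigma>\<in>joint_actions M A s. can_pay M A b s \<sigma> \<longrightarrow> (\<forall>t\<in>outcomes M A s \<sigma>. sat M (Release A (spend M b s \<sigma>) \<phi> \<psi>) t)))"
proof -
  let ?Q = "releaseQ (sat M \<phi>) (sat M \<psi>)"
  have c: "win M A t b' (\<lambda>l. ?Q (s # l)) \<longleftrightarrow> sat M \<psi> s \<and> (sat M \<phi> s \<or> win M A t b' ?Q)" if "t \<in> St M" for t b'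
    using win_const[OF assms(1-3) that, of b'] by (cases "sat M \<psi> s"; cases "sat M \<phi> s") (simp_all add: releaseQ_Cons)
  have e: "?Q [s] \<longleftrightarrow> sat M \<psi> s" by (auto simp: releaseQ_def)
  have out: "t \<in> St M" if "t \<in> outcomes M A s \<sigma>" for t \<sigma> using that outcomes_subset[OF assms(1,4)] by blast
  have ne: "\<exists>t. t \<in> outcomes M A s \<sigma>" if "\<sigma> \<in> joint_actions M A s" for \<sigma> using outcomes_ne[OF assms(1,2,4) that] by blast
  have ja: "\<exists>\<sigma>. \<sigma> \<in> joint_actions M A s" using joint_actions_ne[OF assms(1,2,4)] by blast
  show ?thesis
proof -
    have "win M A s b ?Q \<longleftrightarrow> (\<exists>\<sigma>\<in>joint_actions M A s. if can_pay M A b s \<sigma>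
      then \<forall>t\<in>outcomes M A s \<sigma>. sat M \<psi> s \<and> (sat M \<phi> s \<or> win M A t (spend M b s \<sigma>) ?Q) else sat M \<psi> s)"
      unfolding win_unfold[OF assms(1,2,4), of b] e using c out by (intro bex_cong if_cong ball_cong refl) blast
    then show ?thesis
      unfolding sat_win using ne ja by (cases "sat M \<psi> s"; cases "sat M \<phi> s") auto
  qed
qed


section \<open>Decoding a valid instance\<close>

lemma items_bset [simp]: "items (bset l) = map binary l"
  by (simp add: bset_def)

lemma nats_bset [simp]: "nats (bset l) = l"
  by (simp add: nats_def comp_def)

lemma enc_set_bset: "enc_set X = bset (sorted_list_of_set X)"
  by (simp add: enc_set_def bset_def)

lemma bits_of_unary [simp]: "bits_of (unary n) = replicate n True"
  by (simp add: unary_def)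

definition split_int :: "int \<Rightarrow> bool \<times> nat" where "split_int z = (z < 0, nat \<bar>z\<bar>)"

lemma dint_signed [simp]: "dint (signed_binary z) = split_int z"
  by (simp add: dint_def signed_binary_def split_int_def)

lemma look_map: "distinct ks \<Longrightarrow> k \<in> set ks \<Longrightarrow> look (map (\<lambda>k. (k, f k)) ks) k = f k"
  by (induction ks) (auto simp: look_def filter_map comp_def filter_empty_conv)

locale input =
  fixes M :: input_cgs
  assumes rb: "rb_cgs M"
begin

abbreviation "D \<equiv> enc_cgs M"
abbreviation "AL \<equiv> sorted_list_of_set (Agt M)"
abbreviation "SL \<equiv> sorted_list_of_set (St M)"
abbreviation "avl s a \<equiv> sorted_list_of_set (avail M s a)"

lemma fin: "finite (Agt M)" "finite (St M)" "finite (Act M)" "finite (Props M)"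
  "p \<in> Props M \<Longrightarrow> finite (val M p)" "s \<in> St M \<Longrightarrow> a \<in> Agt M \<Longrightarrow> finite (avail M s a)"
proof -
  show "finite (Agt M)" "finite (Act M)" "finite (Props M)" and s: "finite (St M)" using rb by (auto simp: rb_cgs_def)
  have "val M p \<subseteq> St M" if "p \<in> Props M" using rb that by (simp add: rb_cgs_def)
  then show "p \<in> Props M \<Longrightarrow> finite (val M p)" using s finite_subset by blast
  have "avail M s a \<subseteq> Act M" if "s \<in> St M" "a \<in> Agt M" using rb that by (simp add: rb_cgs_def)
  then show "s \<in> St M \<Longrightarrow> a \<in> Agt M \<Longrightarrow> finite (avail M s a)" using \<open>finite (Act M)\<close> finite_subset by blast
qed

lemma nres: "1 \<le> nres M" using rb by (simp add: rb_cgs_def)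

lemma agents_D [simp]: "agents D = AL"
  by (simp add: agents_def enc_cgs_def enc_set_bset)

lemma res_D [simp]: "res D = nres M"
  by (simp add: res_def enc_cgs_def)

lemma sts_D [simp]: "sts D = SL"
  by (simp add: sts_def enc_cgs_def enc_set_bset)

lemma acts_D [simp]: "acts D = sorted_list_of_set (Act M)"
  by (simp add: acts_def enc_cgs_def enc_set_bset)

lemma vals_D: "vals D = map (\<lambda>p. (p, sorted_list_of_set (val M p))) (sorted_list_of_set (Props M))"
  by (simp add: vals_def enc_cgs_def enc_val_def enc_set_bset comp_def)

lemma avails_D: "avails D = map (\<lambda>k. (k, avl (fst k) (snd k))) (List.product SL AL)"
  by (simp add: avails_def enc_cgs_def enc_avail_def enc_set_bset comp_def map_concat product_concat_map)

definition cost_keys :: "(nat \<times> nat) list" where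
  "cost_keys = concat (map (\<lambda>s. map (\<lambda>x. (s, x)) (sorted_list_of_set (\<Union>a\<in>Agt M. avail M s a))) SL)"

lemma costs_D: "costs D = map (\<lambda>k. (k, map (\<lambda>i. split_int (cost M (fst k) (snd k) i)) [0..<nres M])) cost_keys"
  by (simp add: costs_def enc_cgs_def enc_cost_def comp_def map_concat cost_keys_def)

definition delta_keys :: "(nat \<times> nat list) list" where
  "delta_keys = concat (map (\<lambda>s. map (\<lambda>xs. (s, xs)) (product_lists (map (avl s) AL))) SL)"

lemma deltas_D: "deltas D = map (\<lambda>k. (k, delta M (fst k) (joint_of_list M (snd k)))) delta_keys"
  by (simp add: deltas_def enc_cgs_def enc_delta_def comp_def map_concat delta_keys_def bset_def[symmetric])

lemma look_vals: "p \<in> Props M \<Longrightarrow> look (vals D) p = sorted_list_of_set (val M p)"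
  unfolding vals_D using fin by (intro look_map) auto

lemma look_avails: "s \<in> St M \<Longrightarrow> a \<in> Agt M \<Longrightarrow> look (avails D) (s, a) = avl s a"
  unfolding avails_D using fin look_map[of "List.product SL AL" "(s, a)" "\<lambda>k. avl (fst k) (snd k)"]
  by (auto simp: distinct_product)

lemma distinct_pairs: "distinct xs \<Longrightarrow> (\<And>x. distinct (f x)) \<Longrightarrow> distinct (concat (map (\<lambda>x. map (\<lambda>y. (x, y)) (f x)) xs))"
  by (induction xs) (auto simp: distinct_map inj_on_def)

lemma look_costs:
  assumes "s \<in> St M" "a \<in> Agt M" "x \<in> avail M s a"
  shows "look (costs D) (s, x) = map (\<lambda>i. split_int (cost M s x i)) [0..<nres M]"
proof -
  have "(s, x) \<in> set cost_keys" using assms fin by (auto simp: cost_keys_def)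
  moreover have "distinct cost_keys" unfolding cost_keys_def by (intro distinct_pairs) auto
  ultimately show ?thesis
    unfolding costs_D using look_map[of cost_keys "(s, x)" "\<lambda>k. map (\<lambda>i. split_int (cost M (fst k) (snd k) i)) [0..<nres M]"]
    by simp
qed

lemma joint_of_list_map: "\<sigma> \<in> joint_actions M (Agt M) s \<Longrightarrow> joint_of_list M (map \<sigma> AL) = \<sigma>"
  using fin(1) by (auto simp: joint_of_list_def joint_actions_def fun_eq_iff map_of_zip_map restrict_def PiE_def extensional_def)

lemma set_product:
  assumes "s \<in> St M"
  shows "set (product_lists (map (avl s) AL)) = (\<lambda>\<sigma>. map \<sigma> AL) ` joint_actions M (Agt M) s"
proof (intro set_eqI iffI)
  fix xs assume "xs \<in> set (product_lists (map (avl s) AL))"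
  then have l: "list_all2 (\<lambda>x ys. x \<in> set ys) xs (map (avl s) AL)" by (simp add: product_lists_set)
  then have len: "length xs = length AL" using list_all2_lengthD by fastforce
  let ?\<sigma> = "joint_of_list M xs"
  have nth: "?\<sigma> (AL ! i) = xs ! i" if "i < length AL" for i
    using that len fin(1) nth_mem[OF that] by (auto simp: joint_of_list_def map_of_zip_nth)
  have "xs = map ?\<sigma> AL" by (rule nth_equalityI) (simp_all add: len nth)
  moreover have "?\<sigma> a \<in> avail M s a" if "a \<in> Agt M" for a
  proof -
    have "a \<in> set AL" using that fin(1) by simp
    then obtain i where i: "i < length AL" "a = AL ! i" unfolding in_set_conv_nth by blast
    then have "xs ! i \<in> set (avl s a)" using l by (auto simp: list_all2_conv_all_nth)
    then show ?thesis using i nth fin(6)[OF assms that] by simp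
  qed
  ultimately show "xs \<in> (\<lambda>\<sigma>. map \<sigma> AL) ` joint_actions M (Agt M) s"
    by (intro image_eqI[of _ _ ?\<sigma>]) (auto simp: joint_actions_def joint_of_list_def)
next
  fix xs assume "xs \<in> (\<lambda>\<sigma>. map \<sigma> AL) ` joint_actions M (Agt M) s"
  then obtain \<sigma> where \<sigma>: "\<sigma> \<in> joint_actions M (Agt M) s" "xs = map \<sigma> AL" by auto
  have "\<sigma> a \<in> set (avl s a)" if "a \<in> Agt M" for a
    using \<sigma>(1) that fin(6)[OF assms that] by (auto simp: joint_actions_def)
  moreover have "AL ! i \<in> Agt M" if "i < length AL" for i using nth_mem[OF that] fin(1) by simp
  ultimately show "xs \<in> set (product_lists (map (avl s) AL))"
    unfolding \<sigma>(2) by (simp add: product_lists_set list_all2_conv_all_nth del: length_sorted_list_of_set)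
qed

lemma set_moves: "s \<in> St M \<Longrightarrow> set (moves D s) = (\<lambda>\<sigma>. map \<sigma> AL) ` joint_actions M (Agt M) s"
proof -
  assume s: "s \<in> St M"
  have "set (moves D s) = {xs. (s, xs) \<in> set delta_keys}"
    by (force simp: moves_def deltas_D)
  also have "\<dots> = set (product_lists (map (avl s) AL))"
    using s fin(2) by (auto simp: delta_keys_def)
  finally show ?thesis using set_product[OF s] by simp
qed

lemma set_deltas: "((s, xs), t) \<in> set (deltas D) \<longleftrightarrow>
    s \<in> St M \<and> (\<exists>\<sigma>\<in>joint_actions M (Agt M) s. xs = map \<sigma> AL \<and> t = delta M s \<sigma>)"
proof -
  have "((s, xs), t) \<in> set (deltas D) \<longleftrightarrow> s \<in> St M \<and> xs \<in> set (product_lists (map (avl s) AL)) \<and> t = delta M s (joint_of_list M xs)"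
    using fin(2) by (auto simp: deltas_D delta_keys_def image_iff)
  then show ?thesis
    using set_product[of s] joint_of_list_map[of _ s] by (cases "s \<in> St M") (auto simp del: map_eq_conv)
qed

text \<open>The keys record the coalition, so a position needs no separate component for it.\<close>

definition endow_list :: "nat set \<Rightarrow> (nat \<Rightarrow> nat \<Rightarrow> nat) \<Rightarrow> endow" where
  "endow_list A b = map (\<lambda>a. (a, map (b a) [0..<nres M])) (sorted_list_of_set A)"

lemma team_map:
  assumes "A \<subseteq> Agt M"
  shows "team D (endow_list A b) (map \<sigma> AL) = map \<sigma> (filter (\<lambda>a. a \<in> A) AL)"
proof -
  have "finite A" using assms fin(1) finite_subset by blast
  then have "fst ` set (endow_list A b) = A" by (auto simp: endow_list_def image_image)
  then show ?thesis
    by (simp add: team_def zip_map2 zip_same_conv_map filter_map comp_def)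
qed

lemma set_succs:
  assumes "A \<subseteq> Agt M" "s \<in> St M"
  shows "set (succs D s (endow_list A b) (map \<sigma> AL)) = outcomes M A s (restrict \<sigma> A)"
proof -
  have eq: "map \<sigma>' (filter (\<lambda>a. a \<in> A) AL) = map \<sigma> (filter (\<lambda>a. a \<in> A) AL) \<longleftrightarrow> restrict \<sigma>' A = restrict \<sigma> A" for \<sigma>' :: "nat \<Rightarrow> nat"
    using assms(1) fin(1) by (auto simp: restrict_def fun_eq_iff subset_iff)
  have "t \<in> set (succs D s (endow_list A b) (map \<sigma> AL)) \<longleftrightarrow>
     (\<exists>xs. ((s, xs), t) \<in> set (deltas D) \<and> team D (endow_list A b) xs = team D (endow_list A b) (map \<sigma> AL))" for t
    unfolding succs_def by force
  also have "\<dots> t \<longleftrightarrow> (\<exists>\<sigma>'\<in>joint_actions M (Agt M) s. t = delta M s \<sigma>' \<and> restrict \<sigma>' A = restrict \<sigma> A)" for t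
    unfolding set_deltas eq[symmetric] using assms(2) by (metis team_map[OF assms(1)])
  finally show ?thesis by (auto simp: outcomes_def)
qed

text \<open>The other agents always have some action, so each choice of the coalition extends to a
  joint action; ranging over the transition table thus misses no choice.\<close>

lemma joint_actions_restrict:
  assumes "A \<subseteq> Agt M" "s \<in> St M"
  shows "joint_actions M A s = (\<lambda>\<sigma>. restrict \<sigma> A) ` joint_actions M (Agt M) s"
proof (intro set_eqI iffI)
  fix \<sigma> assume \<sigma>: "\<sigma> \<in> joint_actions M A s"
  from outcomes_ne[OF rb assms this] obtain \<tau> where "\<tau> \<in> joint_actions M (Agt M) s" "restrict \<tau> A = \<sigma>"
    by (auto simp: outcomes_def)
  then show "\<sigma> \<in> (\<lambda>\<sigma>. restrict \<sigma> A) ` joint_actions M (Agt M) s" by blast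
next
  fix \<sigma> assume "\<sigma> \<in> (\<lambda>\<sigma>. restrict \<sigma> A) ` joint_actions M (Agt M) s"
  then show "\<sigma> \<in> joint_actions M A s" using assms(1) by (auto simp: joint_actions_def PiE_iff)
qed

lemma cost_vec_map:
  assumes "\<sigma> \<in> joint_actions M (Agt M) s" "s \<in> St M" "a \<in> Agt M"
  shows "cost_vec D s (map \<sigma> AL) a = map (\<lambda>i. split_int (cost M s (\<sigma> a) i)) [0..<nres M]"
proof -
  have f: "filter (\<lambda>x. x = a) xs = [a]" if "distinct xs" "a \<in> set xs" for xs
    using that by (induction xs) (auto simp: filter_empty_conv)
  have "filter (\<lambda>p. fst p = a) (zip AL (map \<sigma> AL)) = [(a, \<sigma> a)]"
    using f[of AL] assms(3) fin(1) by (simp add: zip_map2 zip_same_conv_map filter_map comp_def)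
  then show ?thesis
    using look_costs[OF assms(2,3), of "\<sigma> a"] assms by (auto simp: cost_vec_def joint_actions_def)
qed

lemma affordable_map:
  assumes "A \<subseteq> Agt M" "\<sigma> \<in> joint_actions M (Agt M) s" "s \<in> St M"
  shows "affordable D s (endow_list A b) (map \<sigma> AL) \<longleftrightarrow> can_pay M A b s (restrict \<sigma> A)"
proof -
  have fA: "finite A" using assms fin(1) finite_subset by blast
  have "affordable D s (endow_list A b) (map \<sigma> AL) \<longleftrightarrow>
    (\<forall>a\<in>A. \<forall>q\<in>set (zip (map (b a) [0..<nres M]) (map (\<lambda>i. split_int (cost M s (\<sigma> a) i)) [0..<nres M])).
       fst (snd q) \<longrightarrow> snd (snd q) \<le> fst q)"
    unfolding affordable_def endow_list_def using fA assms(1) cost_vec_map[OF assms(2,3)] by (auto simp: subset_iff)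
  also have "\<dots> \<longleftrightarrow> (\<forall>a\<in>A. \<forall>i<nres M. cost M s (\<sigma> a) i < 0 \<longrightarrow> nat \<bar>cost M s (\<sigma> a) i\<bar> \<le> b a i)"
    by (auto simp: zip_map_map zip_same_conv_map split_int_def)
  also have "\<dots> \<longleftrightarrow> can_pay M A b s (restrict \<sigma> A)"
    unfolding can_pay_def consumed_def by (intro ball_cong all_cong refl) (auto simp: min_def)
  finally show ?thesis .
qed

lemma pay_map:
  assumes "A \<subseteq> Agt M" "\<sigma> \<in> joint_actions M (Agt M) s" "s \<in> St M"
  shows "pay D s (endow_list A b) (map \<sigma> AL) = endow_list A (spend M b s (restrict \<sigma> A))"
proof -
  have fA: "finite A" using assms fin(1) finite_subset by blast
  have "map (\<lambda>q. if fst (snd q) then fst q - snd (snd q) else fst q + snd (snd q))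
      (zip (map (b a) [0..<nres M]) (cost_vec D s (map \<sigma> AL) a)) = map (spend M b s (restrict \<sigma> A) a) [0..<nres M]"
    if "a \<in> A" for a
  proof -
    have "a \<in> Agt M" using that assms(1) by blast
    then show ?thesis
      using that cost_vec_map[OF assms(2,3)]
      by (auto simp: zip_map_map zip_same_conv_map split_int_def spend_def consumed_def produced_def)
  qed
  then show ?thesis
    unfolding pay_def endow_list_def using fA by simp
qed


section \<open>The tree evaluates to the truth value\<close>

abbreviation "code_fm \<equiv> enc_fm unary (nres M)"

lemma bounds_enc: "finite A \<Longrightarrow> bounds (enc_bound unary (nres M) A b) = endow_list A b"
  by (simp add: bounds_def enc_bound_def endow_list_def comp_def)

lemma start_enc:
  "start (code_fm (Next A b \<phi>)) s = (code_fm (Next A b \<phi>), s, bounds (enc_bound unary (nres M) A b))"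
  "start (code_fm (Until A b \<phi> \<psi>)) s = (code_fm (Until A b \<phi> \<psi>), s, bounds (enc_bound unary (nres M) A b))"
  "start (code_fm (Release A b \<phi> \<psi>)) s = (code_fm (Release A b \<phi> \<psi>), s, bounds (enc_bound unary (nres M) A b))"
  by (simp_all add: start_def)

definition ev :: "nat \<Rightarrow> position \<Rightarrow> bool \<Rightarrow> bool" where
  "ev n b v \<longleftrightarrow> evals (children D) n (True, [b]) v"

lemma ev_mono: "ev n b v \<Longrightarrow> n \<le> m \<Longrightarrow> ev m b v"
  unfolding ev_def by (rule evals_mono)

text \<open>The heights may differ. Hence, as soon as some value is known to exist within height
  \<open>n\<close>, \<open>ev n b True\<close> can be read as the truth value.\<close>

lemma evals_unique: "evals ch n x v \<Longrightarrow> evals ch m x w \<Longrightarrow> v = w"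
proof (induction arbitrary: m w rule: evals.induct)
  case (evals x n f v)
  from evals.prems show ?case
  proof cases
    case (evals n' g)
    then have "f c = g c" if "c \<in> set (ch x)" for c using that evals.IH by blast
    then show ?thesis using evals \<open>v = _\<close> by auto
  qed
qed

text \<open>The NAND of NANDs is a disjunction of conjunctions; its two levels account for the two
  additional units of height.\<close>

lemma ev_choices:
  assumes "\<And>x. x \<in> set (options D b) \<Longrightarrow> \<exists>l. x = (False, l) \<and> (\<forall>b'\<in>set l. \<exists>v. ev n b' v)"
  shows "ev (Suc (Suc n)) b (\<exists>l. (False, l) \<in> set (options D b) \<and> (\<forall>b'\<in>set l. ev n b' True))"
proof -
  have tv: "ev n b' (ev n b' True)" if "\<exists>v. ev n b' v" for b'
    using that evals_unique unfolding ev_def by (metis (full_types))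
  have "evals (children D) (Suc n) x (\<exists>b'\<in>set (snd x). \<not> ev n b' True)" if x: "x \<in> set (options D b)" for x
  proof -
    from assms[OF x] obtain l where l: "x = (False, l)" "\<forall>b'\<in>set l. \<exists>v. ev n b' v" by auto
    show ?thesis
      \<comment> \<open>The children of an option are of the form \<open>(True, [b'])\<close>, from
        which \<open>hd (snd c)\<close> recovers the position.\<close>
      by (rule evals.intros[where f = "\<lambda>c. ev n (hd (snd c)) True"])
        (use l tv in \<open>auto simp: children_def ev_def\<close>)
  qed
  note option = this
  have ch: "children D (True, [b]) = options D b" by (simp add: children_def)
  have eq: "(\<exists>l. (False, l) \<in> set (options D b) \<and> (\<forall>b'\<in>set l. ev n b' True)) \<longleftrightarrow>
      (\<exists>x\<in>set (children D (True, [b])). \<not> (\<exists>b'\<in>set (snd x). \<not> ev n b' True))" (is "?l \<longleftrightarrow> ?r")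
  proof
    assume ?r
    then obtain x where x: "x \<in> set (options D b)" "\<forall>b'\<in>set (snd x). ev n b' True" unfolding ch by blast
    then show ?l using assms[OF x(1)] by auto
  qed (force simp: ch)
  show ?thesis unfolding ev_def[of "Suc (Suc n)"] eq
    by (rule evals.intros[OF _ refl]) (use option in \<open>simp add: ch\<close>)
qed

lemma code_fm_items:
  "dnat (item 0 (code_fm (Prop p))) = 0" "dnat (item (Suc 0) (code_fm (Prop p))) = p"
  "dnat (item 0 (code_fm (Neg \<phi>))) = 1" "item (Suc 0) (code_fm (Neg \<phi>)) = code_fm \<phi>"
  "dnat (item 0 (code_fm (Or \<phi> \<psi>))) = 2" "item (Suc 0) (code_fm (Or \<phi> \<psi>)) = code_fm \<phi>" "item 2 (code_fm (Or \<phi> \<psi>)) = code_fm \<psi>"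
  "dnat (item 0 (code_fm (Next A b \<phi>))) = 3" "item 2 (code_fm (Next A b \<phi>)) = code_fm \<phi>"
  "dnat (item 0 (code_fm (Until A b \<phi> \<psi>))) = 4" "item 2 (code_fm (Until A b \<phi> \<psi>)) = code_fm \<phi>"
  "item 3 (code_fm (Until A b \<phi> \<psi>)) = code_fm \<psi>"
  "dnat (item 0 (code_fm (Release A b \<phi> \<psi>))) = 5" "item 2 (code_fm (Release A b \<phi> \<psi>)) = code_fm \<phi>"
  "item 3 (code_fm (Release A b \<phi> \<psi>)) = code_fm \<psi>"
  by simp_all

declare enc_fm.simps [simp del]

lemma options_start:
  "options D (start d s) = options D (d, s, if dnat (item 0 d) < 3 then [] else bounds (item 1 d))"
  by (simp add: start_def)

lemma ex_option:
  "(\<exists>l. (False, l) \<in> set ((False, k) # L) \<and> P l) \<longleftrightarrow> P k \<or> (\<exists>l. (False, l) \<in> set L \<and> P l)"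
  "(\<exists>l. (False, l) \<in> set (map (\<lambda>x. (False, f x)) xs) \<and> P l) \<longleftrightarrow> (\<exists>x\<in>set xs. P (f x))"
  by auto

lemma ball_option:
  "(\<forall>b\<in>set (x # (if c then map f xs else [])). P b) \<longleftrightarrow> P x \<and> (c \<longrightarrow> (\<forall>t\<in>set xs. P (f t)))"
  by (cases c) auto

lemma ev_Prop:
  assumes "s \<in> St M" "p \<in> Props M" shows "ev 2 (start (code_fm (Prop p)) s) (sat M (Prop p) s)"
proof -
  have o: "options D (start (code_fm (Prop p)) s) = (if s \<in> val M p then [(False, [])] else [])"
    using look_vals[OF assms(2)] fin(5)[OF assms(2)] unfolding options_start by (simp add: options_def code_fm_items)
  have "ev 2 (start (code_fm (Prop p)) s) (\<exists>l. (False, l) \<in> set (options D (start (code_fm (Prop p)) s)) \<and> (\<forall>b'\<in>set l. ev 0 b' True))"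
    unfolding numeral_2_eq_2 by (rule ev_choices) (simp add: o split: if_splits)
  then show ?thesis by (simp add: o split: if_splits)
qed

lemma ev_Neg:
  assumes "ev n (start (code_fm \<phi>) s) v" shows "ev (Suc n) (start (code_fm (Neg \<phi>)) s) (\<not> v)"
proof -
  have "options D (start (code_fm (Neg \<phi>)) s) = [(True, [start (code_fm \<phi>) s])]"
    unfolding options_start by (simp add: options_def code_fm_items)
  then have ch: "children D (True, [start (code_fm (Neg \<phi>)) s]) = [(True, [start (code_fm \<phi>) s])]"
    by (simp add: children_def)
  show ?thesis unfolding ev_def
    by (rule evals.intros[where f = "\<lambda>_. v"]) (use assms in \<open>simp_all add: ch ev_def\<close>)
qed

lemma ev_True_iff: "ev n b v \<Longrightarrow> ev n b True \<longleftrightarrow> v"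
  using evals_unique unfolding ev_def by metis

lemma ev_Or:
  assumes "ev n (start (code_fm \<phi>) s) v" "ev n (start (code_fm \<psi>) s) w"
  shows "ev (Suc (Suc n)) (start (code_fm (Or \<phi> \<psi>)) s) (v \<or> w)"
proof -
  have o: "options D (start (code_fm (Or \<phi> \<psi>)) s) = [(False, [start (code_fm \<phi>) s]), (False, [start (code_fm \<psi>) s])]"
    unfolding options_start by (simp add: options_def code_fm_items)
  have "ev (Suc (Suc n)) (start (code_fm (Or \<phi> \<psi>)) s)
      (\<exists>l. (False, l) \<in> set (options D (start (code_fm (Or \<phi> \<psi>)) s)) \<and> (\<forall>b'\<in>set l. ev n b' True))"
    by (rule ev_choices) (use assms in \<open>auto simp: o\<close>)
  then show ?thesis unfolding o ex_option(1) by (simp add: assms[THEN ev_True_iff])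
qed

lemma endow_list_Nil: "A \<subseteq> Agt M \<Longrightarrow> endow_list A b = [] \<longleftrightarrow> A = {}"
  using fin(1) by (auto simp: endow_list_def dest: finite_subset)

lemma ev_empty:
  assumes "3 \<le> dnat (item 0 d)" shows "ev 2 (d, s, []) True"
proof -
  have o: "options D (d, s, []) = [(False, [])]" using assms by (simp add: options_def)
  have "ev 2 (d, s, []) (\<exists>l. (False, l) \<in> set (options D (d, s, [])) \<and> (\<forall>b'\<in>set l. ev 0 b' True))"
    unfolding numeral_2_eq_2 by (rule ev_choices) (simp add: o)
  then show ?thesis by (simp add: o)
qed

lemma moves_iff:
  assumes "A \<subseteq> Agt M" "s \<in> St M"
    "\<And>\<sigma>. \<sigma> \<in> joint_actions M (Agt M) s \<Longrightarrow> P (map \<sigma> AL) \<longleftrightarrow> P' (restrict \<sigma> A)"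
  shows "(\<exists>xs\<in>set (moves D s). P xs) \<longleftrightarrow> (\<exists>\<sigma>\<in>joint_actions M A s. P' \<sigma>)"
  unfolding set_moves[OF assms(2)] joint_actions_restrict[OF assms(1,2)] using assms(3) by auto

text \<open>Every step lowers each summand, so this bounds the length of a play. The sum avoids
  singling out a member and is still at most the length of the unary bounds.\<close>

definition budget :: "nat set \<Rightarrow> (nat \<Rightarrow> nat \<Rightarrow> nat) \<Rightarrow> nat" where "budget A b = (\<Sum>a\<in>A. b a 0)"

context
  fixes A :: "nat set"
  assumes A: "A \<subseteq> Agt M" "A \<noteq> {}"
begin

lemma succs_St: "s \<in> St M \<Longrightarrow> \<sigma> \<in> joint_actions M (Agt M) s \<Longrightarrow> t \<in> set (succs D s (endow_list A b) (map \<sigma> AL)) \<Longrightarrow> t \<in> St M"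
  using set_succs[OF A(1), of s b \<sigma>] outcomes_subset[OF rb, of s A "restrict \<sigma> A"] by auto

lemma ev_Next:
  assumes "s \<in> St M" and IH: "\<And>t. t \<in> St M \<Longrightarrow> ev n (start (code_fm \<phi>) t) (sat M \<phi> t)"
  shows "ev (Suc (Suc n)) (start (code_fm (Next A b \<phi>)) s) (sat M (Next A b \<phi>) s)"
proof -
  let ?e = "endow_list A b"
  let ?b = "start (code_fm (Next A b \<phi>)) s"
  have fA: "finite A" using A fin(1) finite_subset by blast
  have o: "options D ?b = map (\<lambda>xs. (False, map (\<lambda>t. start (code_fm \<phi>) t) (succs D s ?e xs))) (filter (\<lambda>xs. affordable D s ?e xs) (moves D s))"
    using endow_list_Nil[OF A(1)] A(2) unfolding start_enc bounds_enc[OF fA] by (simp add: options_def code_fm_items)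
  have "ev (Suc (Suc n)) ?b (\<exists>l. (False, l) \<in> set (options D ?b) \<and> (\<forall>b'\<in>set l. ev n b' True))"
    by (rule ev_choices) (use IH succs_St[OF assms(1)] in \<open>force simp: o set_moves[OF assms(1)]\<close>)
  also have "(\<exists>l. (False, l) \<in> set (options D ?b) \<and> (\<forall>b'\<in>set l. ev n b' True)) \<longleftrightarrow>
      (\<exists>xs\<in>set (moves D s). affordable D s ?e xs \<and> (\<forall>t\<in>set (succs D s ?e xs). ev n (start (code_fm \<phi>) t) True))"
    unfolding o ex_option by auto
  also have "\<dots> \<longleftrightarrow> (\<exists>\<sigma>\<in>joint_actions M A s. can_pay M A b s \<sigma> \<and> (\<forall>t\<in>outcomes M A s \<sigma>. sat M \<phi> t))"
  proof (rule moves_iff[OF A(1) assms(1)])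
    fix \<sigma> assume \<sigma>: "\<sigma> \<in> joint_actions M (Agt M) s"
    show "affordable D s ?e (map \<sigma> AL) \<and> (\<forall>t\<in>set (succs D s ?e (map \<sigma> AL)). ev n (start (code_fm \<phi>) t) True) \<longleftrightarrow>
      can_pay M A b s (restrict \<sigma> A) \<and> (\<forall>t\<in>outcomes M A s (restrict \<sigma> A). sat M \<phi> t)"
      using affordable_map[OF A(1) \<sigma> assms(1)] set_succs[OF A(1) assms(1)] succs_St[OF assms(1) \<sigma>] ev_True_iff[OF IH]
      by auto
  qed
  also have "\<dots> \<longleftrightarrow> sat M (Next A b \<phi>) s" by (rule sat_Next[OF rb A assms(1), symmetric])
  finally show ?thesis .
qed

lemma budget_spend:
  assumes "s \<in> St M" "\<sigma> \<in> joint_actions M (Agt M) s" "can_pay M A b s (restrict \<sigma> A)"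
  shows "budget A (spend M b s (restrict \<sigma> A)) < budget A b"
  unfolding budget_def
proof (rule sum_strict_mono)
  show "finite A" using A fin(1) finite_subset by blast
  have "restrict \<sigma> A \<in> joint_actions M A s" using joint_actions_restrict[OF A(1) assms(1)] assms(2) by blast
  then show "spend M b s (restrict \<sigma> A) a 0 < b a 0" if "a \<in> A" for a
    using spend_less[OF rb A(1) assms(1) _ assms(3) that] by blast
qed (rule A(2))

text \<open>Along a play the position keeps the original formula, with its bound \<open>c\<close>,
  while the amounts actually owned are given by \<open>b\<close>. The claim must therefore treat the
  two as independent.\<close>

lemma ev_Until:
  assumes "s \<in> St M" and \<phi>: "\<And>t. t \<in> St M \<Longrightarrow> ev n (start (code_fm \<phi>) t) (sat M \<phi> t)"
    and \<psi>: "\<And>t. t \<in> St M \<Longrightarrow> ev n (start (code_fm \<psi>) t) (sat M \<psi> t)"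
  shows "ev (2 * budget A b + n + 2) (code_fm (Until A c \<phi> \<psi>), s, endow_list A b) (sat M (Until A b \<phi> \<psi>) s)"
  using assms(1)
proof (induction "budget A b" arbitrary: b s rule: less_induct)
  case less
  let ?d = "code_fm (Until A c \<phi> \<psi>)"
  let ?e = "endow_list A b"
  let ?b = "(?d, s, ?e)"
  let ?n = "2 * budget A b + n"
  have o: "options D ?b = (False, [start (code_fm \<psi>) s]) #
      map (\<lambda>xs. (False, start (code_fm \<phi>) s # map (\<lambda>t. (?d, t, pay D s ?e xs)) (succs D s ?e xs)))
        (filter (\<lambda>xs. affordable D s ?e xs) (moves D s))"
    using endow_list_Nil[OF A(1)] A(2) by (simp add: options_def code_fm_items)
  \<comment> \<open>The budget drops by at least one, which releases the two units of height used by
    the present step.\<close>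
  have step: "ev ?n (?d, t, pay D s ?e (map \<sigma> AL)) (sat M (Until A (spend M b s (restrict \<sigma> A)) \<phi> \<psi>) t)"
    if "\<sigma> \<in> joint_actions M (Agt M) s" "affordable D s ?e (map \<sigma> AL)" "t \<in> St M" for \<sigma> t
  proof -
    have less': "budget A (spend M b s (restrict \<sigma> A)) < budget A b"
      using that budget_spend[OF less.prems that(1)] affordable_map[OF A(1) that(1) less.prems] by blast
    show ?thesis
      unfolding pay_map[OF A(1) that(1) less.prems]
      by (rule ev_mono[OF less.hyps[OF less' that(3)]]) (use less' in simp)
  qed
  have \<phi>': "ev ?n (start (code_fm \<phi>) s) (sat M \<phi> s)" and \<psi>': "ev ?n (start (code_fm \<psi>) s) (sat M \<psi> s)"
    using \<phi>[OF less.prems] \<psi>[OF less.prems] by (auto elim: ev_mono)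
  have "ev (Suc (Suc ?n)) ?b (\<exists>l. (False, l) \<in> set (options D ?b) \<and> (\<forall>b'\<in>set l. ev ?n b' True))"
  proof (rule ev_choices)
    fix x assume "x \<in> set (options D ?b)"
    then consider "x = (False, [start (code_fm \<psi>) s])" | \<sigma> where "\<sigma> \<in> joint_actions M (Agt M) s" "affordable D s ?e (map \<sigma> AL)"
      "x = (False, start (code_fm \<phi>) s # map (\<lambda>t. (?d, t, pay D s ?e (map \<sigma> AL))) (succs D s ?e (map \<sigma> AL)))"
      unfolding o by (auto simp: set_moves[OF less.prems])
    then show "\<exists>l. x = (False, l) \<and> (\<forall>b'\<in>set l. \<exists>v. ev ?n b' v)"
    proof cases
      case 1
      then show ?thesis using \<psi>' by auto
    next
      case 2
      then show ?thesis using \<phi>' step[OF 2(1,2)] succs_St[OF less.prems 2(1)] by auto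
    qed
  qed
  also have "(\<exists>l. (False, l) \<in> set (options D ?b) \<and> (\<forall>b'\<in>set l. ev ?n b' True)) \<longleftrightarrow>
      ev ?n (start (code_fm \<psi>) s) True \<or> (\<exists>xs\<in>set (moves D s). affordable D s ?e xs \<and> ev ?n (start (code_fm \<phi>) s) True \<and>
        (\<forall>t\<in>set (succs D s ?e xs). ev ?n (?d, t, pay D s ?e xs) True))"
    unfolding o ex_option by auto
  also have "(\<exists>xs\<in>set (moves D s). affordable D s ?e xs \<and> ev ?n (start (code_fm \<phi>) s) True \<and>
        (\<forall>t\<in>set (succs D s ?e xs). ev ?n (?d, t, pay D s ?e xs) True)) \<longleftrightarrow>
      (\<exists>\<sigma>\<in>joint_actions M A s. can_pay M A b s \<sigma> \<and> sat M \<phi> s \<and> (\<forall>t\<in>outcomes M A s \<sigma>. sat M (Until A (spend M b s \<sigma>) \<phi> \<psi>) t))"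
  proof (rule moves_iff[OF A(1) less.prems])
    fix \<sigma> assume \<sigma>: "\<sigma> \<in> joint_actions M (Agt M) s"
    show "affordable D s ?e (map \<sigma> AL) \<and> ev ?n (start (code_fm \<phi>) s) True \<and>
        (\<forall>t\<in>set (succs D s ?e (map \<sigma> AL)). ev ?n (?d, t, pay D s ?e (map \<sigma> AL)) True) \<longleftrightarrow>
      can_pay M A b s (restrict \<sigma> A) \<and> sat M \<phi> s \<and>
        (\<forall>t\<in>outcomes M A s (restrict \<sigma> A). sat M (Until A (spend M b s (restrict \<sigma> A)) \<phi> \<psi>) t)"
      unfolding affordable_map[OF A(1) \<sigma> less.prems, symmetric] set_succs[OF A(1) less.prems, of b, symmetric] ev_True_iff[OF \<phi>']
      using step[OF \<sigma>, THEN ev_True_iff] succs_St[OF less.prems \<sigma>] by blast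
  qed
  also have "ev ?n (start (code_fm \<psi>) s) True \<or> \<dots> \<longleftrightarrow> sat M (Until A b \<phi> \<psi>) s"
    unfolding sat_Until[OF rb A less.prems] ev_True_iff[OF \<psi>'] by blast
  finally show ?case by simp
qed

lemma ev_Release:
  assumes "s \<in> St M" and \<phi>: "\<And>t. t \<in> St M \<Longrightarrow> ev n (start (code_fm \<phi>) t) (sat M \<phi> t)"
    and \<psi>: "\<And>t. t \<in> St M \<Longrightarrow> ev n (start (code_fm \<psi>) t) (sat M \<psi> t)"
  shows "ev (2 * budget A b + n + 2) (code_fm (Release A c \<phi> \<psi>), s, endow_list A b) (sat M (Release A b \<phi> \<psi>) s)"
  using assms(1)
proof (induction "budget A b" arbitrary: b s rule: less_induct)
  case less
  let ?d = "code_fm (Release A c \<phi> \<psi>)"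
  let ?e = "endow_list A b"
  let ?b = "(?d, s, ?e)"
  let ?n = "2 * budget A b + n"
  have o: "options D ?b = (False, [start (code_fm \<psi>) s, start (code_fm \<phi>) s]) #
      map (\<lambda>xs. (False, start (code_fm \<psi>) s #
        (if affordable D s ?e xs then map (\<lambda>t. (?d, t, pay D s ?e xs)) (succs D s ?e xs) else []))) (moves D s)"
    using endow_list_Nil[OF A(1)] A(2) by (simp add: options_def code_fm_items)
  have step: "ev ?n (?d, t, pay D s ?e (map \<sigma> AL)) (sat M (Release A (spend M b s (restrict \<sigma> A)) \<phi> \<psi>) t)"
    if "\<sigma> \<in> joint_actions M (Agt M) s" "affordable D s ?e (map \<sigma> AL)" "t \<in> St M" for \<sigma> t
  proof -
    have less': "budget A (spend M b s (restrict \<sigma> A)) < budget A b"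
      using that budget_spend[OF less.prems that(1)] affordable_map[OF A(1) that(1) less.prems] by blast
    show ?thesis
      unfolding pay_map[OF A(1) that(1) less.prems]
      by (rule ev_mono[OF less.hyps[OF less' that(3)]]) (use less' in simp)
  qed
  have \<phi>': "ev ?n (start (code_fm \<phi>) s) (sat M \<phi> s)" and \<psi>': "ev ?n (start (code_fm \<psi>) s) (sat M \<psi> s)"
    using \<phi>[OF less.prems] \<psi>[OF less.prems] by (auto elim: ev_mono)
  have "ev (Suc (Suc ?n)) ?b (\<exists>l. (False, l) \<in> set (options D ?b) \<and> (\<forall>b'\<in>set l. ev ?n b' True))"
  proof (rule ev_choices)
    fix x assume "x \<in> set (options D ?b)"
    then consider "x = (False, [start (code_fm \<psi>) s, start (code_fm \<phi>) s])" | \<sigma> where "\<sigma> \<in> joint_actions M (Agt M) s"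
      "x = (False, start (code_fm \<psi>) s # (if affordable D s ?e (map \<sigma> AL)
         then map (\<lambda>t. (?d, t, pay D s ?e (map \<sigma> AL))) (succs D s ?e (map \<sigma> AL)) else []))"
      unfolding o by (auto simp: set_moves[OF less.prems])
    then show "\<exists>l. x = (False, l) \<and> (\<forall>b'\<in>set l. \<exists>v. ev ?n b' v)"
    proof cases
      case 1
      then show ?thesis using \<phi>' \<psi>' by auto
    next
      case 2
      then show ?thesis using \<psi>' step[OF 2(1)] succs_St[OF less.prems 2(1)] by auto
    qed
  qed
  also have "(\<exists>l. (False, l) \<in> set (options D ?b) \<and> (\<forall>b'\<in>set l. ev ?n b' True)) \<longleftrightarrow>
      ev ?n (start (code_fm \<psi>) s) True \<and> ev ?n (start (code_fm \<phi>) s) True \<or>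
      (\<exists>xs\<in>set (moves D s). ev ?n (start (code_fm \<psi>) s) True \<and>
        (affordable D s ?e xs \<longrightarrow> (\<forall>t\<in>set (succs D s ?e xs). ev ?n (?d, t, pay D s ?e xs) True)))"
    unfolding o ex_option ball_option by simp
  also have "(\<exists>xs\<in>set (moves D s). ev ?n (start (code_fm \<psi>) s) True \<and>
        (affordable D s ?e xs \<longrightarrow> (\<forall>t\<in>set (succs D s ?e xs). ev ?n (?d, t, pay D s ?e xs) True))) \<longleftrightarrow>
      (\<exists>\<sigma>\<in>joint_actions M A s. sat M \<psi> s \<and> (can_pay M A b s \<sigma> \<longrightarrow> (\<forall>t\<in>outcomes M A s \<sigma>. sat M (Release A (spend M b s \<sigma>) \<phi> \<psi>) t)))"
  proof (rule moves_iff[OF A(1) less.prems])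
    fix \<sigma> assume \<sigma>: "\<sigma> \<in> joint_actions M (Agt M) s"
    show "ev ?n (start (code_fm \<psi>) s) True \<and> (affordable D s ?e (map \<sigma> AL) \<longrightarrow>
        (\<forall>t\<in>set (succs D s ?e (map \<sigma> AL)). ev ?n (?d, t, pay D s ?e (map \<sigma> AL)) True)) \<longleftrightarrow>
      sat M \<psi> s \<and> (can_pay M A b s (restrict \<sigma> A) \<longrightarrow>
        (\<forall>t\<in>outcomes M A s (restrict \<sigma> A). sat M (Release A (spend M b s (restrict \<sigma> A)) \<phi> \<psi>) t))"
      unfolding affordable_map[OF A(1) \<sigma> less.prems, symmetric] set_succs[OF A(1) less.prems, of b, symmetric] ev_True_iff[OF \<psi>']
      using step[OF \<sigma>, THEN ev_True_iff] succs_St[OF less.prems \<sigma>] by blast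
  qed
  also have "ev ?n (start (code_fm \<psi>) s) True \<and> ev ?n (start (code_fm \<phi>) s) True \<or> \<dots> \<longleftrightarrow> sat M (Release A b \<phi> \<psi>) s"
    unfolding sat_Release[OF rb A less.prems] ev_True_iff[OF \<psi>'] ev_True_iff[OF \<phi>'] by blast
  finally show ?case by simp
qed

end

primrec height :: "(nat, nat) fm \<Rightarrow> nat" where
  "height (Prop p) = 2"
| "height (Neg \<phi>) = Suc (height \<phi>)"
| "height (Or \<phi> \<psi>) = Suc (Suc (max (height \<phi>) (height \<psi>)))"
| "height (Next A b \<phi>) = height \<phi> + 2"
| "height (Until A b \<phi> \<psi>) = 2 * budget A b + max (height \<phi>) (height \<psi>) + 2"
| "height (Release A b \<phi> \<psi>) = 2 * budget A b + max (height \<phi>) (height \<psi>) + 2"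

lemma ev_sat: "fm_over M \<phi> \<Longrightarrow> s \<in> St M \<Longrightarrow> ev (height \<phi>) (start (code_fm \<phi>) s) (sat M \<phi> s)"
proof (induction \<phi> arbitrary: s)
  case (Prop p)
  then show ?case using ev_Prop[of s p] by simp
next
  case (Neg \<phi>)
  then show ?case using ev_Neg[of "height \<phi>"] by simp
next
  case (Or \<phi> \<psi>)
  then have "ev (max (height \<phi>) (height \<psi>)) (start (code_fm \<phi>) s) (sat M \<phi> s)"
    "ev (max (height \<phi>) (height \<psi>)) (start (code_fm \<psi>) s) (sat M \<psi> s)"
    by (simp_all add: ev_mono[OF _ max.cobounded1] ev_mono[OF _ max.cobounded2])
  then show ?case using ev_Or by simp
next
  case (Next A b \<phi>)
  have A: "A \<subseteq> Agt M" using Next.prems by simp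
  show ?case
  proof (cases "A = {}")
    case True
    then have "start (code_fm (Next A b \<phi>)) s = (code_fm (Next A b \<phi>), s, [])"
      by (simp add: start_enc bounds_enc endow_list_def)
    moreover have "sat M (Next A b \<phi>) s" unfolding sat_win using True win_empty[OF rb Next.prems(2)] by simp
    ultimately show ?thesis using ev_mono[OF ev_empty[of "code_fm (Next A b \<phi>)" s], of "height (Next A b \<phi>)"] by (simp add: code_fm_items)
  next
    case False
    then show ?thesis using ev_Next[OF A False Next.prems(2)] Next by simp
  qed
next
  case (Until A b \<phi> \<psi>)
  have A: "A \<subseteq> Agt M" "finite A" using Until.prems fin(1) finite_subset by auto
  have st: "start (code_fm (Until A b \<phi> \<psi>)) s = (code_fm (Until A b \<phi> \<psi>), s, endow_list A b)"
    by (simp only: start_enc bounds_enc[OF A(2)])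
  show ?case
  proof (cases "A = {}")
    case True
    have "sat M (Until A b \<phi> \<psi>) s" unfolding sat_win using True win_empty[OF rb Until.prems(2)] by simp
    then show ?thesis
      using True ev_mono[OF ev_empty[of "code_fm (Until A b \<phi> \<psi>)" s], of "height (Until A b \<phi> \<psi>)"] unfolding st
      by (simp add: endow_list_def code_fm_items)
  next
    case False
    let ?n = "max (height \<phi>) (height \<psi>)"
    have "ev ?n (start (code_fm \<phi>) t) (sat M \<phi> t)" "ev ?n (start (code_fm \<psi>) t) (sat M \<psi> t)" if "t \<in> St M" for t
      using Until that by (simp_all add: ev_mono[OF _ max.cobounded1] ev_mono[OF _ max.cobounded2])
    from ev_Until[OF A(1) False Until.prems(2) this, of b b] show ?thesis unfolding st by simp
  qed
next
  case (Release A b \<phi> \<psi>)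
  have A: "A \<subseteq> Agt M" "finite A" using Release.prems fin(1) finite_subset by auto
  have st: "start (code_fm (Release A b \<phi> \<psi>)) s = (code_fm (Release A b \<phi> \<psi>), s, endow_list A b)"
    by (simp only: start_enc bounds_enc[OF A(2)])
  show ?case
  proof (cases "A = {}")
    case True
    have "sat M (Release A b \<phi> \<psi>) s" unfolding sat_win using True win_empty[OF rb Release.prems(2)] by simp
    then show ?thesis
      using True ev_mono[OF ev_empty[of "code_fm (Release A b \<phi> \<psi>)" s], of "height (Release A b \<phi> \<psi>)"] unfolding st
      by (simp add: endow_list_def code_fm_items)
  next
    case False
    let ?n = "max (height \<phi>) (height \<psi>)"
    have "ev ?n (start (code_fm \<phi>) t) (sat M \<phi> t)" "ev ?n (start (code_fm \<psi>) t) (sat M \<psi> t)" if "t \<in> St M" for t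
      using Release that by (simp_all add: ev_mono[OF _ max.cobounded1] ev_mono[OF _ max.cobounded2])
    from ev_Release[OF A(1) False Release.prems(2) this, of b b] show ?thesis unfolding st by simp
  qed
qed

end


section \<open>The accepted data are the encodings\<close>

lemma strict_sorted: "strict l \<longleftrightarrow> sorted_wrt (<) l"
  by (induction l) auto

lemma strict_sorted_list_of_set [simp]: "strict (sorted_list_of_set X)"
  by (simp add: strict_sorted)

text \<open>Strictly increasing lists are determined by their sets; encoding a set read from checked
  data gives the original list back.\<close>

lemma sorted_list_of_set_strict: "strict l \<Longrightarrow> sorted_list_of_set (set l) = l"
  by (simp add: strict_sorted strict_sorted_iff sorted_list_of_set.idem_if_sorted_distinct)

lemma strict_distinct: "strict l \<Longrightarrow> distinct l"
  by (simp add: strict_sorted strict_sorted_iff)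

lemma strict_filter: "strict l \<Longrightarrow> strict (filter P l)"
  by (induction l) auto

lemma filter_key_empty: "filter (\<lambda>p. fst p = k) l = [] \<longleftrightarrow> k \<notin> fst ` set l"
  by (induction l) auto

lemma look_member: "distinct (map fst l) \<Longrightarrow> p \<in> set l \<Longrightarrow> look l (fst p) = snd p"
proof (induction l)
  case (Cons q l)
  show ?case
  proof (cases "p = q")
    case True
    have "filter (\<lambda>p'. fst p' = fst p) l = []"
      unfolding filter_key_empty using Cons.prems True by simp
    then show ?thesis using True by (simp add: look_def)
  next
    case False
    then have "p \<in> set l" "fst q \<noteq> fst p" using Cons.prems by force+
    then show ?thesis using Cons by (simp add: look_def)
  qed
qed simp

lemma length_block: "x \<in> set xs \<Longrightarrow> length (f x) \<le> length (concat (map f xs))"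
  by (induction xs) auto

definition clock :: "data \<Rightarrow> bool list" where "clock D = True # map (\<lambda>_. True) (deltas D)"

context input
begin

lemma avail_Act: "s \<in> St M \<Longrightarrow> a \<in> Agt M \<Longrightarrow> avail M s a \<subseteq> Act M \<and> avail M s a \<noteq> {}"
  and val_St: "p \<in> Props M \<Longrightarrow> val M p \<subseteq> St M"
  and cost_less: "s \<in> St M \<Longrightarrow> a \<in> Agt M \<Longrightarrow> x \<in> avail M s a \<Longrightarrow> cost M s x 0 \<le> -1"
  and delta_St: "s \<in> St M \<Longrightarrow> \<sigma> \<in> joint_actions M (Agt M) s \<Longrightarrow> delta M s \<sigma> \<in> St M"
  and nonempty: "Agt M \<noteq> {}" "St M \<noteq> {}" "Act M \<noteq> {}"
  using rb by (simp_all add: rb_cgs_def)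

lemma cost_keys_eq:
  "cost_keys = concat (map (\<lambda>s. map (\<lambda>x. (s, x))
     (filter (\<lambda>x. \<exists>a\<in>set AL. x \<in> set (look (avails D) (s, a))) (sorted_list_of_set (Act M)))) SL)"
proof -
  have "sorted_list_of_set (\<Union>a\<in>Agt M. avail M s a) =
      filter (\<lambda>x. \<exists>a\<in>set AL. x \<in> set (look (avails D) (s, a))) (sorted_list_of_set (Act M))"
    if s: "s \<in> set SL" for s
  proof -
    let ?l = "filter (\<lambda>x. \<exists>a\<in>set AL. x \<in> set (look (avails D) (s, a))) (sorted_list_of_set (Act M))"
    have sS: "s \<in> St M" using s fin(2) by simp
    have "set ?l = {x \<in> Act M. \<exists>a\<in>Agt M. x \<in> avail M s a}"
      using fin(1,3) fin(6)[OF sS] look_avails[OF sS] by auto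
    also have "\<dots> = (\<Union>a\<in>Agt M. avail M s a)" using avail_Act[OF sS] by blast
    finally show ?thesis
      using sorted_list_of_set_strict[of ?l] strict_filter[OF strict_sorted_list_of_set[of "Act M"]] by metis
  qed
  then show ?thesis unfolding cost_keys_def by (intro arg_cong[of _ _ concat] map_cong) auto
qed

text \<open>Each block of the product is a part of the transition table, hence shorter than the
  counter, and the cut has no effect.\<close>

lemma delta_keys_eq:
  "delta_keys = concat (map (\<lambda>s. map (\<lambda>xs. (s, xs)) (cut_product (clock D) (map (\<lambda>a. look (avails D) (s, a)) AL))) SL)"
proof -
  have "product_lists (map (avl s) AL) = cut_product (clock D) (map (\<lambda>a. look (avails D) (s, a)) AL)"
    if s: "s \<in> set SL" for s
  proof -
    have "s \<in> St M" using s fin(2) by simp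
    then have eq: "map (\<lambda>a. look (avails D) (s, a)) AL = map (avl s) AL"
      using fin(1) look_avails by (intro map_cong) auto
    have "length (map (\<lambda>xs. (s, xs)) (product_lists (map (avl s) AL))) \<le> length delta_keys"
      unfolding delta_keys_def using s by (rule length_block)
    then have "length (product_lists (map (avl s) AL)) \<le> length (clock D)"
      by (simp add: clock_def deltas_D)
    then show ?thesis unfolding eq by (simp add: cut_product clock_def)
  qed
  then show ?thesis unfolding delta_keys_def by (intro arg_cong[of _ _ concat] map_cong) auto
qed

lemma bint_split [simp]: "bint (split_int z) = signed_binary z"
  by (simp add: bint_def split_int_def signed_binary_def)

lemma normal_form_D: "normal_form D = D"
proof -
  have i1: "item 1 D = unary (nres M)" by (simp add: enc_cgs_def)
  show ?thesis
    unfolding normal_form_def i1 agents_D sts_D acts_D vals_D avails_D costs_D deltas_D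
    by (simp add: enc_cgs_def enc_set_bset enc_val_def enc_avail_def enc_cost_def enc_delta_def
        comp_def map_concat product_concat_map cost_keys_def delta_keys_def bset_def[symmetric] unary_def)
qed

lemma ok_cgs_D: "ok_cgs D"
proof -
  have ne: "AL \<noteq> []" "SL \<noteq> []" "sorted_list_of_set (Act M) \<noteq> []"
    using nonempty fin by auto
  have v: "strict (snd p) \<and> (\<forall>s\<in>set (snd p). s \<in> set SL)" if p: "p \<in> set (vals D)" for p
  proof -
    obtain q where "q \<in> Props M" "p = (q, sorted_list_of_set (val M q))" using p fin(4) by (auto simp: vals_D)
    then show ?thesis using val_St[of q] fin(2,5) by auto
  qed
  have a: "strict (snd p) \<and> snd p \<noteq> [] \<and> (\<forall>x\<in>set (snd p). x \<in> set (sorted_list_of_set (Act M)))"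
    if pa: "p \<in> set (avails D)" for p
  proof -
    obtain s b where p: "p = ((s, b), avl s b)" "s \<in> St M" "b \<in> Agt M" using pa fin by (auto simp: avails_D)
    then have "finite (avail M s b)" "avail M s b \<noteq> {}" "avail M s b \<subseteq> Act M" using fin(6) avail_Act by auto
    then show ?thesis using p fin(3) by auto
  qed
  have c: "length (snd p) = nres M \<and> (\<forall>z\<in>set (snd p). fst z \<longrightarrow> snd z \<noteq> 0) \<and> (case snd p of [] \<Rightarrow> False | z # _ \<Rightarrow> fst z)"
    if pc: "p \<in> set (costs D)" for p
  proof -
    obtain s x where p: "p = ((s, x), map (\<lambda>i. split_int (cost M s x i)) [0..<nres M])" "(s, x) \<in> set cost_keys"
      using pc by (auto simp: costs_D)
    then have s: "s \<in> St M" "x \<in> (\<Union>a\<in>Agt M. avail M s a)"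
      using fin by (auto simp: cost_keys_def)
    then have "cost M s x 0 \<le> -1" using cost_less by blast
    moreover have "[0..<nres M] = 0 # [1..<nres M]" using nres by (simp add: upt_conv_Cons)
    ultimately show ?thesis using p nres by (auto simp: split_int_def)
  qed
  have d: "snd p \<in> set SL" if pd: "p \<in> set (deltas D)" for p
  proof -
    obtain s xs t where p: "p = ((s, xs), t)" by (metis surj_pair)
    then obtain \<sigma> where "s \<in> St M" "\<sigma> \<in> joint_actions M (Agt M) s" "t = delta M s \<sigma>"
      using pd set_deltas by auto
    then show ?thesis using p delta_St fin(2) by auto
  qed
  have keys: "map fst (vals D) = sorted_list_of_set (Props M)"
    "map fst (avails D) = concat (map (\<lambda>s. map (\<lambda>a. (s, a)) AL) SL)"
    "map fst (costs D) = cost_keys" "map fst (deltas D) = delta_keys"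
    by (simp_all add: vals_D avails_D costs_D deltas_D comp_def product_concat_map)
  have "\<forall>b\<in>set (bits_of (item 1 D)). b" by (simp add: enc_cgs_def)
  then show ?thesis
    unfolding ok_cgs_def normal_form_D agents_D res_D sts_D acts_D keys
    using v a c d ne nres cost_keys_eq delta_keys_eq by (simp add: clock_def)
qed

lemma item_unary: "(\<forall>t\<in>set (bits_of y). t) \<Longrightarrow> Bits (bits_of y) = unary (length (bits_of y))"
  unfolding unary_def by (simp add: replicate_length_same)

lemma ok_bounds_enc:
  assumes "A \<subseteq> Agt M" shows "ok_bounds D (enc_bound unary (nres M) A b)"
proof -
  have "finite A" using assms fin(1) finite_subset by blast
  then show ?thesis
    using assms fin(1) unfolding ok_bounds_def enc_bound_def
    by (auto simp: comp_def unary_def)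
qed

lemma ok_fm_enc: "fm_over M \<phi> \<Longrightarrow> ok_fm D (code_fm \<phi>)"
proof (induction \<phi>)
  case (Prop p)
  then have "p \<in> set (map fst (vals D))" using fin(4) by (auto simp: vals_D)
  then show ?case by (subst ok_fm.simps) (simp add: ok_node_def subs_def enc_fm.simps)
next
  case (Neg \<phi>)
  then show ?case by (subst ok_fm.simps) (simp add: ok_node_def subs_def enc_fm.simps)
next
  case (Or \<phi> \<psi>)
  then show ?case by (subst ok_fm.simps) (simp add: ok_node_def subs_def enc_fm.simps)
next
  case (Next A b \<phi>)
  then show ?case using ok_bounds_enc[of A b] by (subst ok_fm.simps) (simp add: ok_node_def subs_def enc_fm.simps)
next
  case (Until A b \<phi> \<psi>)
  then show ?case using ok_bounds_enc[of A b] by (subst ok_fm.simps) (simp add: ok_node_def subs_def enc_fm.simps)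
next
  case (Release A b \<phi> \<psi>)
  then show ?case using ok_bounds_enc[of A b] by (subst ok_fm.simps) (simp add: ok_node_def subs_def enc_fm.simps)
qed

lemma ok_bounds_imp:
  assumes "ok_bounds D b"
  obtains A c where "A \<subseteq> Agt M" "b = enc_bound unary (nres M) A c"
proof -
  let ?key = "\<lambda>x. dnat (item 0 x)" and ?row = "\<lambda>x. items (item 1 x)"
  have b: "b = Lst (map (\<lambda>x. Lst [binary (?key x), Lst (map (\<lambda>y. Bits (bits_of y)) (?row x))]) (items b))"
    and st: "strict (map ?key (items b))" and A: "set (map ?key (items b)) \<subseteq> Agt M"
    and len: "\<And>x. x \<in> set (items b) \<Longrightarrow> length (?row x) = nres M"
    and un: "\<And>x y. x \<in> set (items b) \<Longrightarrow> y \<in> set (?row x) \<Longrightarrow> \<forall>t\<in>set (bits_of y). t"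
    using assms fin(1) unfolding ok_bounds_def agents_D res_D by auto
  \<comment> \<open>The amounts are read back by agent and index; strictness makes the agents
    distinct, so each row is found.\<close>
  let ?c = "\<lambda>a j. look (map (\<lambda>x. (?key x, map (\<lambda>y. length (bits_of y)) (?row x))) (items b)) a ! j"
  have look: "look (map (\<lambda>x. (?key x, map (\<lambda>y. length (bits_of y)) (?row x))) (items b)) (?key x) =
      map (\<lambda>y. length (bits_of y)) (?row x)" if "x \<in> set (items b)" for x
  proof -
    have "distinct (map fst (map (\<lambda>x. (?key x, map (\<lambda>y. length (bits_of y)) (?row x))) (items b)))"
      using strict_distinct[OF st] by (simp add: comp_def)
    from look_member[OF this, of "(?key x, map (\<lambda>y. length (bits_of y)) (?row x))"] that show ?thesis by auto
  qed
  have "Lst [binary (?key x), Lst (map (\<lambda>y. Bits (bits_of y)) (?row x))] =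
      Lst [binary (?key x), Lst (map (\<lambda>j. unary (?c (?key x) j)) [0..<nres M])]" if x: "x \<in> set (items b)" for x
  proof -
    have "map (\<lambda>y. Bits (bits_of y)) (?row x) = map (\<lambda>y. unary (length (bits_of y))) (?row x)"
      using item_unary un[OF x] by (intro map_cong) auto
    also have "\<dots> = map (\<lambda>j. unary (length (bits_of (?row x ! j)))) [0..<nres M]"
      using len[OF x] by (intro nth_equalityI) auto
    also have "\<dots> = map (\<lambda>j. unary (?c (?key x) j)) [0..<nres M]"
      unfolding look[OF x] using len[OF x] by (intro map_cong) auto
    finally show ?thesis by simp
  qed
  then have eq: "map (\<lambda>x. Lst [binary (?key x), Lst (map (\<lambda>y. Bits (bits_of y)) (?row x))]) (items b) =
      map (\<lambda>x. Lst [binary (?key x), Lst (map (\<lambda>j. unary (?c (?key x) j)) [0..<nres M])]) (items b)"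
    by (intro map_cong refl) blast
  have "b = Lst (map (\<lambda>x. Lst [binary (?key x), Lst (map (\<lambda>j. unary (?c (?key x) j)) [0..<nres M])]) (items b))"
    by (rule trans[OF b]) (rule arg_cong[OF eq])
  also have "\<dots> = enc_bound unary (nres M) (set (map ?key (items b))) ?c"
    unfolding enc_bound_def sorted_list_of_set_strict[OF st] by (simp add: comp_def)
  finally show ?thesis using that A by blast
qed

lemma ok_fm_imp: "ok_fm D' d \<Longrightarrow> D' = D \<Longrightarrow> \<exists>\<phi>. fm_over M \<phi> \<and> d = code_fm \<phi>"
proof (induction D' d rule: ok_fm.induct)
  case (1 D' d)
  have D': "D' = D" by fact
  have node: "ok_node D d" and sub: "\<And>y. y \<in> set (subs d) \<Longrightarrow> ok_fm D y"
    using "1.prems" ok_fm.simps[of D d] by auto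
  then have IH: "\<exists>\<phi>. fm_over M \<phi> \<and> y = code_fm \<phi>" if "y \<in> set (subs d)" for y
    using "1.IH"[OF that] that D' by auto
  from node show ?case
  proof (cases rule: ok_node_cases)
    case (1 p)
    then have "p \<in> Props M" using fin(4) by (auto simp: vals_D)
    then show ?thesis using 1 by (intro exI[of _ "Prop p"]) (simp add: enc_fm.simps)
  next
    case (2 x)
    then obtain \<phi> where "fm_over M \<phi>" "x = code_fm \<phi>" using IH[of x] by (auto simp: subs_Lst simp del: One_nat_def)
    then show ?thesis using 2 by (intro exI[of _ "Neg \<phi>"]) (simp add: enc_fm.simps)
  next
    case (3 x y)
    then obtain \<phi> \<psi> where "fm_over M \<phi>" "x = code_fm \<phi>" "fm_over M \<psi>" "y = code_fm \<psi>"
      using IH[of x] IH[of y] by (auto simp: subs_Lst)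
    then show ?thesis using 3 by (intro exI[of _ "Or \<phi> \<psi>"]) (simp add: enc_fm.simps)
  next
    case (4 b x)
    obtain A c where "A \<subseteq> Agt M" "b = enc_bound unary (nres M) A c" by (rule ok_bounds_imp[OF 4(2)])
    moreover obtain \<phi> where "fm_over M \<phi>" "x = code_fm \<phi>" using IH[of x] 4 by (auto simp: subs_Lst)
    ultimately show ?thesis using 4 by (intro exI[of _ "Next A c \<phi>"]) (simp add: enc_fm.simps)
  next
    case (5 b x y)
    obtain A c where "A \<subseteq> Agt M" "b = enc_bound unary (nres M) A c" by (rule ok_bounds_imp[OF 5(2)])
    moreover obtain \<phi> \<psi> where "fm_over M \<phi>" "x = code_fm \<phi>" "fm_over M \<psi>" "y = code_fm \<psi>"
      using IH[of x] IH[of y] 5 by (auto simp: subs_Lst)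
    ultimately show ?thesis using 5 by (intro exI[of _ "Until A c \<phi> \<psi>"]) (simp add: enc_fm.simps)
  next
    case (6 b x y)
    obtain A c where "A \<subseteq> Agt M" "b = enc_bound unary (nres M) A c" by (rule ok_bounds_imp[OF 6(2)])
    moreover obtain \<phi> \<psi> where "fm_over M \<phi>" "x = code_fm \<phi>" "fm_over M \<psi>" "y = code_fm \<psi>"
      using IH[of x] IH[of y] 6 by (auto simp: subs_Lst)
    ultimately show ?thesis using 6 by (intro exI[of _ "Release A c \<phi> \<psi>"]) (simp add: enc_fm.simps)
  qed
qed

end

section \<open>From accepted data back to a structure\<close>

definition join_int :: "bool \<times> nat \<Rightarrow> int" where
  "join_int z = (if fst z then - int (snd z) else int (snd z))"

lemma signed_join: "(fst z \<longrightarrow> snd z \<noteq> 0) \<Longrightarrow> signed_binary (join_int z) = bint z"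
  by (auto simp: signed_binary_def join_int_def bint_def)

text \<open>Each function is the lookup in its own table. The values off the tables are arbitrary,
  and the encoding does not see them.\<close>

definition model :: "data \<Rightarrow> input_cgs" where
  "model D = \<lparr>Agt = set (agents D), nres = res D, St = set (sts D), Props = set (map fst (vals D)),
     val = (\<lambda>p. set (look (vals D) p)), Act = set (acts D),
     avail = (\<lambda>s a. set (look (avails D) (s, a))),
     cost = (\<lambda>s x i. join_int (look (costs D) (s, x) ! i)),
     delta = (\<lambda>s \<sigma>. the (map_of (deltas D) (s, map \<sigma> (agents D))))\<rparr>"

text \<open>A table with distinct keys, listed in the order of the encoding, is reproduced when its
  lookup function is listed over these keys. The checks supply the order of the keys, and equality
  with the normal form supplies the shape.\<close>

lemma ok_cgs_model:
  assumes "ok_cgs D"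
  shows "rb_cgs (model D)" "enc_cgs (model D) = D"
proof -
  let ?M = "model D"
  note ok = assms[unfolded ok_cgs_def]
  have nf: "D = normal_form D" and un: "\<forall>b\<in>set (bits_of (item 1 D)). b"
    and ag: "strict (agents D)" "agents D \<noteq> []" and r: "1 \<le> res D"
    and st: "strict (sts D)" "sts D \<noteq> []" and ac: "strict (acts D)" "acts D \<noteq> []"
    and vk: "strict (map fst (vals D))"
    and v: "\<And>p. p \<in> set (vals D) \<Longrightarrow> strict (snd p) \<and> (\<forall>s\<in>set (snd p). s \<in> set (sts D))"
    and ak: "map fst (avails D) = concat (map (\<lambda>s. map (\<lambda>a. (s, a)) (agents D)) (sts D))"
    and a: "\<And>p. p \<in> set (avails D) \<Longrightarrow> strict (snd p) \<and> snd p \<noteq> [] \<and> (\<forall>x\<in>set (snd p). x \<in> set (acts D))"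
    and ck: "map fst (costs D) = concat (map (\<lambda>s. map (\<lambda>x. (s, x))
       (filter (\<lambda>x. \<exists>a\<in>set (agents D). x \<in> set (look (avails D) (s, a))) (acts D))) (sts D))"
    and c: "\<And>p. p \<in> set (costs D) \<Longrightarrow> length (snd p) = res D \<and> (\<forall>z\<in>set (snd p). fst z \<longrightarrow> snd z \<noteq> 0) \<and>
       (case snd p of [] \<Rightarrow> False | z # _ \<Rightarrow> fst z)"
    and dk: "map fst (deltas D) = concat (map (\<lambda>s. map (\<lambda>xs. (s, xs))
       (cut_product (clock D) (map (\<lambda>a. look (avails D) (s, a)) (agents D)))) (sts D))"
    and d: "\<And>p. p \<in> set (deltas D) \<Longrightarrow> snd p \<in> set (sts D)"
    using ok unfolding clock_def by blast+
  have dist: "distinct (agents D)" "distinct (sts D)" "distinct (acts D)" "distinct (map fst (vals D))"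
    using ag st ac vk strict_distinct by auto
  have pairs: "distinct (concat (map (\<lambda>x. map (\<lambda>y. (x, y)) (f x)) xs))" if "distinct xs" "\<And>x. distinct (f x)"
    for xs :: "nat list" and f :: "nat \<Rightarrow> 'b list"
    using that by (induction xs) (auto simp: distinct_map inj_on_def)
  have akd: "distinct (map fst (avails D))" unfolding ak by (rule pairs) (use dist in auto)
  have ckd: "distinct (map fst (costs D))" unfolding ck by (rule pairs) (use dist in auto)
  have aval: "strict (look (avails D) (s, b)) \<and> look (avails D) (s, b) \<noteq> [] \<and> set (look (avails D) (s, b)) \<subseteq> set (acts D)"
    if "s \<in> set (sts D)" "b \<in> set (agents D)" for s b
  proof -
    have "(s, b) \<in> set (map fst (avails D))" unfolding ak using that by auto
    then obtain p where "p \<in> set (avails D)" "fst p = (s, b)" by auto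
    then show ?thesis using look_member[OF akd, of p] a[of p] by auto
  qed
  have avl: "sorted_list_of_set (avail ?M s b) = look (avails D) (s, b)" if "s \<in> set (sts D)" "b \<in> set (agents D)" for s b
    using aval[OF that] by (simp add: model_def sorted_list_of_set_strict)
  define pl where "pl s = product_lists (map (\<lambda>a. look (avails D) (s, a)) (agents D))" for s
  \<comment> \<open>The cut product is a block of the keys of the table and thus shorter than the
    counter; so nothing was cut off.\<close>
  have cut: "cut_product (clock D) (map (\<lambda>a. look (avails D) (s, a)) (agents D)) = pl s" if s: "s \<in> set (sts D)" for s
  proof -
    have "length (map (\<lambda>xs. (s, xs)) (cut_product (clock D) (map (\<lambda>a. look (avails D) (s, a)) (agents D)))) \<le> length (map fst (deltas D))"
      unfolding dk using s by (rule length_block)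
    then show ?thesis by (simp add: cut_product pl_def clock_def min_def split: if_splits)
  qed
  have dk': "map fst (deltas D) = concat (map (\<lambda>s. map (\<lambda>xs. (s, xs)) (pl s)) (sts D))"
    unfolding dk using cut by (intro arg_cong[of _ _ concat] map_cong) auto
  have pld: "distinct (pl s)" if "s \<in> set (sts D)" for s
    unfolding pl_def using aval[OF that] strict_distinct by (intro distinct_product_lists) auto
  \<comment> \<open>\<open>pairs\<close> asks for distinct blocks at all arguments, not only at the
    states; hence the conditional.\<close>
  have "distinct (concat (map (\<lambda>s. map (\<lambda>xs. (s, xs)) (if s \<in> set (sts D) then pl s else [])) (sts D)))"
    by (rule pairs) (use dist pld in auto)
  also have "concat (map (\<lambda>s. map (\<lambda>xs. (s, xs)) (if s \<in> set (sts D) then pl s else [])) (sts D)) = map fst (deltas D)"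
    unfolding dk' by (intro arg_cong[of _ _ concat] map_cong) auto
  finally have dkd: "distinct (map fst (deltas D))" .
  have AgM: "sorted_list_of_set (Agt ?M) = agents D" using ag by (simp add: model_def sorted_list_of_set_strict)
  have StM: "sorted_list_of_set (St ?M) = sts D" using st by (simp add: model_def sorted_list_of_set_strict)
  have joint: "map \<sigma> (agents D) \<in> set (pl s)" if "\<sigma> \<in> joint_actions ?M (Agt ?M) s" for \<sigma> s
    using that by (auto simp: joint_actions_def model_def pl_def product_lists_set list_all2_conv_all_nth PiE_def)
  show "rb_cgs ?M"
    unfolding rb_cgs_def
  proof (intro conjI ballI)
    show "val ?M p \<subseteq> St ?M" if "p \<in> Props ?M" for p
    proof -
      have "p \<in> fst ` set (vals D)" using that by (simp add: model_def)
      then obtain q where q: "q \<in> set (vals D)" "fst q = p" by blast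
      then show ?thesis using look_member[OF dist(4) q(1)] v[OF q(1)] by (auto simp: model_def)
    qed
    show "avail ?M s b \<subseteq> Act ?M" "avail ?M s b \<noteq> {}" if "s \<in> St ?M" "b \<in> Agt ?M" for s b
      using aval[of s b] that by (auto simp: model_def)
    show "cost ?M s x 0 \<le> -1" if s: "s \<in> St ?M" and b: "b \<in> Agt ?M" and x: "x \<in> avail ?M s b" for s b x
    proof -
      have "x \<in> set (acts D)" using aval[of s b] s b x by (auto simp: model_def)
      then have "(s, x) \<in> set (map fst (costs D))" unfolding ck using s b x by (auto simp: model_def)
      then obtain p where p: "p \<in> set (costs D)" "fst p = (s, x)" by auto
      then obtain z zs where z: "snd p = z # zs" "fst z" "snd z \<noteq> 0" using c[OF p(1)] by (auto split: list.splits)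
      then show ?thesis using look_member[OF ckd p(1)] p(2) by (simp add: model_def join_int_def)
    qed
    show "delta ?M s \<sigma> \<in> St ?M" if s: "s \<in> St ?M" and \<sigma>: "\<sigma> \<in> joint_actions ?M (Agt ?M) s" for s \<sigma>
    proof -
      have "(s, map \<sigma> (agents D)) \<in> set (map fst (deltas D))"
        unfolding dk' using s joint[OF \<sigma>] by (auto simp: model_def)
      then obtain t where "((s, map \<sigma> (agents D)), t) \<in> set (deltas D)" by auto
      then show ?thesis using map_of_is_SomeI[OF dkd] d by (force simp: model_def)
    qed
  qed (use ag st ac r in \<open>auto simp: model_def\<close>)
  have "enc_val ?M = Lst (map (\<lambda>p. Lst [binary (fst p), bset (snd p)]) (vals D))"
  proof -
    have "sorted_list_of_set (Props ?M) = map fst (vals D)"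
      using sorted_list_of_set_strict[OF vk] by (simp add: model_def)
    moreover have "sorted_list_of_set (val ?M (fst p)) = snd p" if "p \<in> set (vals D)" for p
      using look_member[OF dist(4) that] v[OF that] by (simp add: model_def sorted_list_of_set_strict)
    ultimately show ?thesis by (simp add: enc_val_def enc_set_bset comp_def)
  qed
  moreover have "enc_avail ?M = Lst (map (\<lambda>p. Lst [binary (fst (fst p)), binary (snd (fst p)), bset (snd p)]) (avails D))"
  proof -
    let ?f = "\<lambda>k. Lst [binary (fst k), binary (snd k), bset (look (avails D) k)]"
    have "enc_avail ?M = Lst (concat (map (\<lambda>s. map (\<lambda>b. ?f (s, b)) (agents D)) (sts D)))"
      unfolding enc_avail_def AgM StM using avl
      by (auto simp: enc_set_bset intro!: arg_cong[of _ _ concat] map_cong)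
    also have "\<dots> = Lst (map ?f (map fst (avails D)))" unfolding ak by (simp add: map_concat comp_def)
    also have "\<dots> = Lst (map (\<lambda>p. Lst [binary (fst (fst p)), binary (snd (fst p)), bset (snd p)]) (avails D))"
      using look_member[OF akd] by simp
    finally show ?thesis .
  qed
  moreover have "enc_cost ?M = Lst (map (\<lambda>p. Lst [binary (fst (fst p)), binary (snd (fst p)), Lst (map bint (snd p))]) (costs D))"
  proof -
    let ?f = "\<lambda>k. Lst [binary (fst k), binary (snd k), Lst (map (\<lambda>i. signed_binary (join_int (look (costs D) k ! i))) [0..<res D])]"
    have k: "sorted_list_of_set (\<Union>a\<in>Agt ?M. avail ?M s a) =
        filter (\<lambda>x. \<exists>a\<in>set (agents D). x \<in> set (look (avails D) (s, a))) (acts D)" (is "_ = ?l")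
      if s: "s \<in> set (sts D)" for s
    proof -
      have "(\<Union>a\<in>Agt ?M. avail ?M s a) = set ?l" using aval[OF s] by (auto simp: model_def)
      then show ?thesis using sorted_list_of_set_strict[OF strict_filter[OF ac(1)]] by simp
    qed
    have "enc_cost ?M = Lst (concat (map (\<lambda>s. map (\<lambda>x. ?f (s, x))
        (filter (\<lambda>x. \<exists>a\<in>set (agents D). x \<in> set (look (avails D) (s, a))) (acts D))) (sts D)))"
      unfolding enc_cost_def StM using k
      by (auto simp: model_def[of D] intro!: arg_cong[of _ _ concat] map_cong)
    also have "\<dots> = Lst (map ?f (map fst (costs D)))" unfolding ck by (simp add: map_concat comp_def)
    also have "?f (fst p) = Lst [binary (fst (fst p)), binary (snd (fst p)), Lst (map bint (snd p))]"
      if p: "p \<in> set (costs D)" for p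
    proof -
      have "map (\<lambda>i. signed_binary (join_int (snd p ! i))) [0..<res D] = map bint (snd p)"
        using c[OF p] signed_join by (intro nth_equalityI) auto
      then show ?thesis using look_member[OF ckd p] by simp
    qed
    then have "Lst (map ?f (map fst (costs D))) =
      Lst (map (\<lambda>p. Lst [binary (fst (fst p)), binary (snd (fst p)), Lst (map bint (snd p))]) (costs D))" by simp
    finally show ?thesis .
  qed
  moreover have "enc_delta ?M = Lst (map (\<lambda>p. Lst [binary (fst (fst p)), bset (snd (fst p)), binary (snd p)]) (deltas D))"
  proof -
    let ?f = "\<lambda>k. Lst [binary (fst k), bset (snd k), binary (delta ?M (fst k) (joint_of_list ?M (snd k)))]"
    have "map (\<lambda>a. sorted_list_of_set (avail ?M s a)) (agents D) = map (\<lambda>a. look (avails D) (s, a)) (agents D)"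
      if "s \<in> set (sts D)" for s using avl[OF that] by auto
    then have pl_eq: "product_lists (map (\<lambda>a. sorted_list_of_set (avail ?M s a)) (agents D)) = pl s"
      if "s \<in> set (sts D)" for s using that by (simp only: pl_def)
    have "enc_delta ?M = Lst (concat (map (\<lambda>s. map (\<lambda>xs. ?f (s, xs)) (pl s)) (sts D)))"
      unfolding enc_delta_def AgM StM
      by (auto simp: bset_def pl_eq intro!: arg_cong[of _ _ concat] map_cong)
    also have "\<dots> = Lst (map ?f (map fst (deltas D)))" unfolding dk' by (simp add: map_concat comp_def)
    also have "?f (fst p) = Lst [binary (fst (fst p)), bset (snd (fst p)), binary (snd p)]" if p: "p \<in> set (deltas D)" for p
    proof -
      obtain s xs t where q: "p = ((s, xs), t)" by (metis surj_pair)
      then have "(s, xs) \<in> set (map fst (deltas D))" using p by force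
      then have "xs \<in> set (pl s)" unfolding dk' by auto
      then have len: "length xs = length (agents D)" unfolding pl_def by (auto dest: in_set_product_lists_length)
      have "map (joint_of_list ?M xs) (agents D) = xs"
      proof (rule nth_equalityI)
        fix i assume "i < length (map (joint_of_list ?M xs) (agents D))"
        then show "map (joint_of_list ?M xs) (agents D) ! i = xs ! i"
          using len dist(1) unfolding joint_of_list_def AgM by (simp add: model_def map_of_zip_nth)
      qed (simp add: len)
      then have "delta ?M s (joint_of_list ?M xs) = t"
        using map_of_is_SomeI[OF dkd p[unfolded q]] by (simp add: model_def)
      then show ?thesis by (simp add: q)
    qed
    then have "Lst (map ?f (map fst (deltas D))) =
      Lst (map (\<lambda>p. Lst [binary (fst (fst p)), bset (snd (fst p)), binary (snd p)]) (deltas D))" by simp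
    finally show ?thesis .
  qed
  moreover have "unary (nres ?M) = Bits (bits_of (item 1 D))"
    using un by (simp add: model_def res_def unary_def replicate_length_same)
  moreover have "sorted_list_of_set (Act ?M) = acts D" using ac by (simp add: model_def sorted_list_of_set_strict)
  ultimately have "enc_cgs ?M = normal_form D"
    unfolding enc_cgs_def normal_form_def enc_set_bset AgM StM by simp
  then show "enc_cgs ?M = D" using nf by simp
qed

lemma ok_inst_iff:
  "ok_inst d \<longleftrightarrow> (\<exists>M s \<phi>. rb_cgs M \<and> s \<in> St M \<and> fm_over M \<phi> \<and> d = Lst [enc_cgs M, binary s, enc_fm unary (nres M) \<phi>])"
proof
  assume ok: "ok_inst d"
  let ?D = "item 0 d"
  have c: "ok_cgs ?D" using ok by (simp add: ok_inst_def)
  interpret input "model ?D" by standard (rule ok_cgs_model[OF c])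
  have D: "enc_cgs (model ?D) = ?D" by (rule ok_cgs_model[OF c])
  from ok obtain \<phi> where \<phi>: "fm_over (model ?D) \<phi>" "item 2 d = code_fm \<phi>"
    using ok_fm_imp[of ?D "item 2 d"] D by (auto simp: ok_inst_def)
  have "dnat (item 1 d) \<in> St (model ?D)" using ok by (simp add: ok_inst_def model_def)
  moreover have "d = Lst [item 0 d, binary (dnat (item 1 d)), item 2 d]" using ok by (simp add: ok_inst_def)
  ultimately show "\<exists>M s \<phi>. rb_cgs M \<and> s \<in> St M \<and> fm_over M \<phi> \<and> d = Lst [enc_cgs M, binary s, enc_fm unary (nres M) \<phi>]"
    using rb \<phi> D by (intro exI[of _ "model ?D"] exI[of _ "dnat (item 1 d)"] exI[of _ \<phi>]) simp
next
  assume "\<exists>M s \<phi>. rb_cgs M \<and> s \<in> St M \<and> fm_over M \<phi> \<and> d = Lst [enc_cgs M, binary s, enc_fm unary (nres M) \<phi>]"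
  then obtain M s \<phi> where M: "rb_cgs M" "s \<in> St M" "fm_over M \<phi>"
    and d: "d = Lst [enc_cgs M, binary s, enc_fm unary (nres M) \<phi>]" by blast
  interpret input M by standard (rule M)
  show "ok_inst d" unfolding ok_inst_def d using ok_cgs_D ok_fm_enc[OF M(3)] M(2) fin(2) by simp
qed


section \<open>Size of the evaluation tree\<close>

lemma sz_items: "x \<in> set (items d) \<Longrightarrow> sz x \<le> sz d"
  using sz_mem[of x "items d"] by (cases d) auto

lemma sz_bits_of_le: "sz (bits_of d) \<le> sz d"
  by (cases d) auto

lemma sz_nat_eq: "sz (n::nat) = sz (binary_bits n)"
  by (simp add: sz_def ser_def tr_nat_def[symmetric])

lemma sz_dnat: "sz (dnat d) \<le> sz d"
  using sz_strip[of "bits_of d"] sz_bits_of_le[of d] by (simp add: sz_nat_eq dnat_def binary_bits_bits_val)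

lemma sz_nats: "n \<in> set (nats d) \<Longrightarrow> sz n \<le> sz d"
  unfolding nats_def using sz_dnat sz_items by (force intro: order_trans)

lemma bits_val_less: "bits_val bs < 2 ^ length bs"
  by (induction bs) (auto simp: of_bool_def)

lemma costs_less:
  assumes "p \<in> set (costs D)" "z \<in> set (snd p)"
  shows "snd z < 2 ^ sz D"
proof -
  obtain d where d: "d \<in> set (items (item 6 D))" "snd p = map dint (items (item 2 d))"
    using assms(1) by (auto simp: costs_def)
  then obtain y where y: "y \<in> set (items (item 2 d))" "z = dint y" using assms(2) by auto
  have "snd z < 2 ^ length (bits_of y)"
    using bits_val_less[of "tl (bits_of y)"] unfolding y dint_def by (auto split: list.split intro: less_trans)
  also have "length (bits_of y) \<le> sz D"
    using length_le_sz[of "bits_of y"] sz_bits_of_le[of y] sz_items[OF y(1)] sz_item[of 2 d] sz_items[OF d(1)] sz_item[of 6 D]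
    by linarith
  then have "(2::nat) ^ length (bits_of y) \<le> 2 ^ sz D" by simp
  finally show ?thesis .
qed

text \<open>An amount below \<open>2 ^ (2 * n + 1)\<close> has size at most
  \<open>8 * n + 5\<close>; there are at most \<open>n\<close> amounts in a row, and at most
  \<open>n\<close> rows, each with the name of an agent of size at most \<open>n\<close>.\<close>

definition endow_size :: "nat \<Rightarrow> nat" where
  "endow_size n = Suc (n * Suc (Suc (n + Suc (n * Suc (8 * n + 5)))))"

definition position_size :: "nat \<Rightarrow> nat" where "position_size n = Suc (n + Suc (n + endow_size n))"

context input
begin

lemma sz_state: "s \<in> St M \<Longrightarrow> sz s \<le> sz D"
  using sz_nats[of s "item 2 D"] sz_item[of 2 D] sts_D fin(2) unfolding sts_def by fastforce

lemma sz_agent: "a \<in> Agt M \<Longrightarrow> sz a \<le> sz D"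
  using sz_nats[of a "item 0 D"] sz_item[of 0 D] agents_D fin(1) unfolding agents_def by fastforce

lemma card_agents: "card (Agt M) \<le> sz D"
proof -
  have "card (Agt M) = length (items (item 0 D))"
    using agents_D fin(1) unfolding agents_def nats_def by (metis length_map length_sorted_list_of_set)
  also have "\<dots> \<le> sz (items (item 0 D))" by (rule length_le_sz)
  also have "\<dots> \<le> sz (item 0 D)" by (cases "item 0 D") auto
  also have "\<dots> \<le> sz D" by (rule sz_item)
  finally show ?thesis .
qed

lemma nres_le: "nres M \<le> sz D"
  using res_D length_le_sz[of "bits_of (item 1 D)"] sz_bits_of_le[of "item 1 D"] sz_item[of 1 D] unfolding res_def by linarith

lemma cost_less_power:
  assumes "s \<in> St M" "a \<in> Agt M" "x \<in> avail M s a" "i < nres M"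
  shows "nat \<bar>cost M s x i\<bar> < 2 ^ sz D"
proof -
  let ?p = "((s, x), map (\<lambda>i. split_int (cost M s x i)) [0..<nres M])"
  have "(s, x) \<in> set cost_keys" using assms fin by (auto simp: cost_keys_def)
  then have "?p \<in> set (costs D)" by (force simp: costs_D)
  then have "snd (split_int (cost M s x i)) < 2 ^ sz D" using assms(4) by (intro costs_less) auto
  then show ?thesis by (simp add: split_int_def)
qed

text \<open>The place where unary notation is essential: the amounts themselves, not just their
  numbers of bits, are bounded by the size of the formula. The factor 2 matches the two tree levels
  per step of a play.\<close>

lemma sz_enc_bound:
  assumes "finite A"
  shows "2 * (\<Sum>a\<in>A. b a 0) \<le> sz (enc_bound unary (nres M) A b)"
    and "a \<in> A \<Longrightarrow> j < nres M \<Longrightarrow> b a j \<le> sz (enc_bound unary (nres M) A b)"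
proof -
  let ?f = "\<lambda>a. Lst [binary a, Lst (map (\<lambda>j. unary (b a j)) [0..<nres M])]"
  have un: "sz (unary n) = 4 * n + 3" for n
    by (induction n) (simp_all add: unary_def)
  have row: "2 * b a j \<le> sz (?f a)" if "j < nres M" for a j
    using un[of "b a j"] sz_mem[of "unary (b a j)" "map (\<lambda>j. unary (b a j)) [0..<nres M]"] that by auto
  have "2 * sum_list (map (\<lambda>a. b a 0) as) \<le> sz (map ?f as)" for as
  proof (induction as)
    case (Cons a as)
    then show ?case using row[of 0 a] nres by simp
  qed simp
  from this[of "sorted_list_of_set A"] show "2 * (\<Sum>a\<in>A. b a 0) \<le> sz (enc_bound unary (nres M) A b)"
    using assms by (simp add: enc_bound_def sum_list_distinct_conv_sum_set)
  show "b a j \<le> sz (enc_bound unary (nres M) A b)" if "a \<in> A" "j < nres M"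
  proof -
    have "?f a \<in> set (map ?f (sorted_list_of_set A))"
      unfolding set_map using that assms by (intro imageI) simp
    from sz_mem[OF this] row[OF that(2), of a] show ?thesis
      unfolding enc_bound_def sz_data by linarith
  qed
qed

lemma height_le: "fm_over M \<phi> \<Longrightarrow> height \<phi> \<le> sz (code_fm \<phi>)"
proof (induction \<phi>)
  case (Until A b \<phi> \<psi>)
  then have "finite A" using fin(1) finite_subset by auto
  then show ?case using sz_enc_bound(1)[of A b] Until unfolding enc_fm.simps by (simp add: budget_def)
next
  case (Release A b \<phi> \<psi>)
  then have "finite A" using fin(1) finite_subset by auto
  then show ?case using sz_enc_bound(1)[of A b] Release unfolding enc_fm.simps by (simp add: budget_def)
qed (auto simp: enc_fm.simps)

text \<open>
  Every step costs a member of the coalition at least one unit of the diminishing resource and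
  yields less than \<open>2 ^ n\<close> units of the others.  Hence the quantity bounded here does not increase
  along a play, and the endowments keep polynomially many bits.
\<close>

definition bounded_endow :: "nat \<Rightarrow> nat set \<Rightarrow> (nat \<Rightarrow> nat \<Rightarrow> nat) \<Rightarrow> bool" where
  "bounded_endow n A b \<longleftrightarrow> A \<subseteq> Agt M \<and> (\<forall>a\<in>A. \<forall>j<nres M. b a j + 2 ^ n * b a 0 \<le> 2 ^ n * Suc n)"

text \<open>The formula need not be related to the given one; a bound on its size suffices, and
  items are never larger than the data containing them.\<close>

definition good_position :: "nat \<Rightarrow> position \<Rightarrow> bool" where
  "good_position n p \<longleftrightarrow> (case p of (d, s, e) \<Rightarrow> s \<in> St M \<and> (\<exists>\<phi>. fm_over M \<phi> \<and> d = code_fm \<phi> \<and> sz d \<le> n) \<and>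
     (e = [] \<or> (\<exists>A b. e = endow_list A b \<and> bounded_endow n A b)))"

lemma bounded_endow_spend:
  assumes b: "bounded_endow n A b" and n: "sz D \<le> n" and s: "s \<in> St M"
    and \<sigma>: "\<sigma> \<in> joint_actions M (Agt M) s" and pay: "can_pay M A b s (restrict \<sigma> A)"
  shows "bounded_endow n A (spend M b s (restrict \<sigma> A))"
  unfolding bounded_endow_def
proof (intro conjI ballI allI impI)
  show A: "A \<subseteq> Agt M" using b by (simp add: bounded_endow_def)
  fix a j assume a: "a \<in> A" and j: "j < nres M"
  let ?b' = "spend M b s (restrict \<sigma> A)"
  have x: "\<sigma> a \<in> avail M s a" using \<sigma> a A by (auto simp: joint_actions_def)
  have "(2::nat) ^ sz D \<le> 2 ^ n" using n by (intro power_increasing) auto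
  moreover have "a \<in> Agt M" using a A by auto
  ultimately have "nat \<bar>cost M s (\<sigma> a) j\<bar> < 2 ^ n" using cost_less_power[OF s _ x j] by (meson less_le_trans)
  then have 1: "?b' a j \<le> b a j + 2 ^ n"
    using a unfolding spend_def consumed_def produced_def by (simp add: nat_le_iff)
  have "restrict \<sigma> A \<in> joint_actions M A s" using joint_actions_restrict[OF A s] \<sigma> by blast
  from spend_less[OF rb A s this pay a] have "Suc (?b' a 0) \<le> b a 0" by simp
  then have 2: "2 ^ n * ?b' a 0 + 2 ^ n \<le> 2 ^ n * b a 0" using mult_le_mono2[of "Suc (?b' a 0)" "b a 0" "2 ^ n"] by simp
  have 3: "b a j + 2 ^ n * b a 0 \<le> 2 ^ n * Suc n" using b a j by (simp add: bounded_endow_def)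
  show "?b' a j + 2 ^ n * ?b' a 0 \<le> 2 ^ n * Suc n" using 1 2 3 by linarith
qed

lemma good_start:
  assumes "fm_over M \<phi>" "sz (code_fm \<phi>) \<le> n" "s \<in> St M"
  shows "good_position n (start (code_fm \<phi>) s)"
proof -
  have "bounds (item 1 (code_fm \<phi>)) = [] \<or> (\<exists>A b. bounds (item 1 (code_fm \<phi>)) = endow_list A b \<and> bounded_endow n A b)"
    if "\<not> dnat (item 0 (code_fm \<phi>)) < 3"
  proof -
    have B: "bounded_endow n A b"
      if A: "A \<subseteq> Agt M" and le: "sz (enc_bound unary (nres M) A b) \<le> n" for A b
    proof -
      have fA: "finite A" using A fin(1) finite_subset by blast
      have b: "b a j \<le> n" if "a \<in> A" "j < nres M" for a j using sz_enc_bound(2)[OF fA that, of b] le by simp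
      have "b a j + 2 ^ n * b a 0 \<le> 2 ^ n * Suc n" if "a \<in> A" "j < nres M" for a j
      proof -
        \<comment> \<open>The factor \<open>Suc n\<close> of the invariant splits: one
          \<open>2 ^ n\<close> covers the amount itself, and \<open>2 ^ n * n\<close> the weighted
          diminishing resource.\<close>
        have "b a j \<le> 2 ^ n" using b[OF that] less_exp[of n] by linarith
        moreover have "2 ^ n * b a 0 \<le> 2 ^ n * n" using b[OF that(1), of 0] nres by simp
        ultimately show ?thesis unfolding mult_Suc_right by (rule add_mono)
      qed
      then show ?thesis using A by (simp add: bounded_endow_def)
    qed
    have "\<exists>A b. A \<subseteq> Agt M \<and> item 1 (code_fm \<phi>) = enc_bound unary (nres M) A b"
      using that assms(1) by (cases \<phi>) (auto simp: enc_fm.simps)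
    then obtain A b where A: "A \<subseteq> Agt M" "item 1 (code_fm \<phi>) = enc_bound unary (nres M) A b" by blast
    have "sz (enc_bound unary (nres M) A b) \<le> n" using sz_item[of 1 "code_fm \<phi>"] assms(2) A by simp
    from B[OF A(1) this] A bounds_enc[of A b] fin(1) show ?thesis by (auto dest: finite_subset)
  qed
  then show ?thesis using assms by (auto simp: good_position_def start_def)
qed

lemma sz_good_position:
  assumes "good_position n p" "sz D \<le> n" shows "sz p \<le> position_size n"
proof -
  obtain d s e where p: "p = (d, s, e)" by (metis surj_pair)
  have s: "s \<in> St M" "sz d \<le> n" using assms(1) by (auto simp: good_position_def p)
  then have sn: "sz s \<le> n" using sz_state assms(2) by fastforce
  have "sz e \<le> endow_size n"
  proof (cases "e = []")
    case False
    then obtain A b where e: "e = endow_list A b" and b: "bounded_endow n A b"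
      using assms(1) by (auto simp: good_position_def p)
    have A: "A \<subseteq> Agt M" "finite A" using b fin(1) by (auto simp: bounded_endow_def dest: finite_subset)
    have v: "sz (b a j) \<le> 8 * n + 5" if "a \<in> A" "j < nres M" for a j
    proof -
      have "b a j \<le> 2 ^ n * Suc n" using b that by (fastforce simp: bounded_endow_def)
      also have "2 ^ n * Suc n < 2 ^ n * 2 ^ Suc n" using less_exp[of "Suc n"] by (intro mult_strict_left_mono) auto
      also have "(2::nat) ^ n * 2 ^ Suc n = 2 ^ (2 * n + 1)" unfolding power_add[symmetric] by (simp add: mult_2)
      finally show ?thesis using sz_nat_less[of "b a j" "2 * n + 1"] by simp
    qed
    have row: "sz (map (b a) [0..<nres M]) \<le> Suc (n * Suc (8 * n + 5))" if "a \<in> A" for a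
    proof -
      have "sz (map (b a) [0..<nres M]) \<le> Suc (length (map (b a) [0..<nres M]) * Suc (8 * n + 5))"
        using v[OF that] by (intro sz_list_bound) auto
      also have "\<dots> \<le> Suc (n * Suc (8 * n + 5))"
        using nres_le assms(2) mult_le_mono1[of "nres M" n "Suc (8 * n + 5)"] by simp
      finally show ?thesis .
    qed
    have "sz e \<le> Suc (length e * Suc (Suc (n + Suc (n * Suc (8 * n + 5)))))"
    proof (rule sz_list_bound)
      fix x assume "x \<in> set e"
      then obtain a where a: "a \<in> A" "x = (a, map (b a) [0..<nres M])" using A by (auto simp: e endow_list_def)
      then have "sz a \<le> n" using sz_agent[of a] A assms(2) by auto
      then show "sz x \<le> Suc (n + Suc (n * Suc (8 * n + 5)))" using row[OF a(1)] a(2) by simp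
    qed
    also have "length e \<le> n"
      using card_mono[OF fin(1) A(1)] card_agents assms(2) by (simp add: e endow_list_def)
    then have "Suc (length e * Suc (Suc (n + Suc (n * Suc (8 * n + 5))))) \<le> endow_size n"
      unfolding endow_size_def Suc_le_mono by (rule mult_le_mono1)
    finally show ?thesis .
  qed (simp add: endow_size_def)
  then show ?thesis using s sn by (simp add: p position_size_def)
qed

lemma good_pay:
  assumes "good_position n (d, s, endow_list A b)" "sz D \<le> n" "A \<noteq> {}" "bounded_endow n A b"
    "xs \<in> set (moves D s)" "affordable D s (endow_list A b) xs" "t \<in> set (succs D s (endow_list A b) xs)"
  shows "good_position n (d, t, pay D s (endow_list A b) xs)"
proof -
  have s: "s \<in> St M" using assms(1) by (auto simp: good_position_def)
  have A: "A \<subseteq> Agt M" using assms(4) by (simp add: bounded_endow_def)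
  obtain \<sigma> where \<sigma>: "\<sigma> \<in> joint_actions M (Agt M) s" "xs = map \<sigma> AL" using assms(5) set_moves[OF s] by auto
  have "bounded_endow n A (spend M b s (restrict \<sigma> A))"
    using bounded_endow_spend[OF assms(4,2) s \<sigma>(1)] affordable_map[OF A \<sigma>(1) s] assms(6) \<sigma>(2) by simp
  moreover have "t \<in> St M" using succs_St[OF A assms(3) s \<sigma>(1)] assms(7) \<sigma>(2) by simp
  ultimately show ?thesis
    using assms(1) pay_map[OF A \<sigma>(1) s] \<sigma>(2) by (auto simp: good_position_def)
qed

lemma good_choices:
  assumes p: "good_position n p" and n: "sz D \<le> n" and x: "x \<in> set (options D p)"
  shows "(\<exists>b. x = (True, [b]) \<and> good_position n b) \<or> (\<exists>l. x = (False, l) \<and> (\<forall>b\<in>set l. good_position n b))"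
proof -
  obtain d s e where p': "p = (d, s, e)" by (metis surj_pair)
  have s: "s \<in> St M" using p by (simp add: good_position_def p')
  obtain \<phi> where \<phi>: "fm_over M \<phi>" "d = code_fm \<phi>" "sz (code_fm \<phi>) \<le> n" using p by (auto simp: good_position_def p')
  have sub: "good_position n (start (code_fm \<psi>) t)" if "fm_over M \<psi>" "t \<in> St M" "code_fm \<psi> = item i d" for \<psi> t i
    using good_start[OF that(1) _ that(2), of n] sz_item[of i d] \<phi> that(3) by simp
  have su: "t \<in> St M" if "t \<in> set (succs D s e xs)" for t xs
  proof -
    have "t \<in> snd ` set (deltas D)" using that by (auto simp: succs_def)
    then show ?thesis using ok_cgs_D fin(2) unfolding ok_cgs_def by auto
  qed
  have pays: "good_position n (d, t, pay D s e xs)"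
    if h: "e \<noteq> []" "xs \<in> set (moves D s)" "affordable D s e xs" "t \<in> set (succs D s e xs)" for t xs
  proof -
    obtain A b where e: "e = endow_list A b" "bounded_endow n A b" using p h(1) by (auto simp: good_position_def p')
    moreover have "A \<noteq> {}" using h(1) e by (auto simp: endow_list_def)
    ultimately show ?thesis using good_pay[of n d s A b xs t] p n h by (simp add: p')
  qed
  show ?thesis
  proof (cases \<phi>)
    case (Prop q)
    then show ?thesis using x \<phi>(2) by (auto simp: p' options_def code_fm_items split: if_splits)
  next
    case (Neg \<psi>)
    then show ?thesis using x \<phi>(1,2) sub[of \<psi> s 1] s by (auto simp: p' options_def code_fm_items)
  next
    case (Or \<psi> \<theta>)
    then show ?thesis using x \<phi>(1,2) sub[of \<psi> s 1] sub[of \<theta> s 2] s by (auto simp: p' options_def code_fm_items)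
  next
    case (Next A b \<psi>)
    have "good_position n (start (code_fm \<psi>) t)" if "t \<in> St M" for t
      using sub[of \<psi> t 2] \<phi>(1,2) that Next by (simp add: code_fm_items)
    then show ?thesis using x \<phi>(2) su Next by (auto simp: p' options_def code_fm_items split: if_splits)
  next
    case (Until A b \<psi> \<theta>)
    have "good_position n (start (code_fm \<psi>) s)" "good_position n (start (code_fm \<theta>) s)"
      using sub[of \<psi> s 2] sub[of \<theta> s 3] \<phi>(1,2) s Until by (simp_all add: code_fm_items)
    then show ?thesis using x \<phi>(2) pays Until by (auto simp: p' options_def code_fm_items split: if_splits)
  next
    case (Release A b \<psi> \<theta>)
    have "good_position n (start (code_fm \<psi>) s)" "good_position n (start (code_fm \<theta>) s)"
      using sub[of \<psi> s 2] sub[of \<theta> s 3] \<phi>(1,2) s Release by (simp_all add: code_fm_items)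
    then show ?thesis using x \<phi>(2) pays Release by (auto simp: p' options_def code_fm_items split: if_splits)
  qed
qed

text \<open>Here \<open>q\<close> is a bound on the size of the list of options of a position.\<close>

definition good_node :: "nat \<Rightarrow> nat \<Rightarrow> node \<Rightarrow> bool" where
  "good_node n q x \<longleftrightarrow> (\<exists>b. x = (True, [b]) \<and> good_position n b) \<or>
     (\<exists>l. x = (False, l) \<and> (\<forall>b\<in>set l. good_position n b) \<and> sz l \<le> q)"

text \<open>The bounds do not accumulate with depth: a position is bounded by the invariant alone,
  and an inner node by the list of options it was taken from. The constant 6 is the cost of wrapping
  a position, as \<open>sz (True, [b]) = sz b + 6\<close>.\<close>

lemma good_children:
  assumes pc: "\<And>D x. sz (children D x) \<le> poly pc (sz (D, x))"
    and n: "sz D \<le> n" and x: "good_node n q x" and q: "q = poly pc (Suc (n + (position_size n + 6)))"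
  shows "sz (children D x) \<le> q + poly pc (Suc (n + Suc (Suc q))) \<and> (\<forall>c\<in>set (children D x). good_node n q c)"
proof -
  from x consider b where "x = (True, [b])" "good_position n b"
    | l where "x = (False, l)" "\<forall>b\<in>set l. good_position n b" "sz l \<le> q" by (auto simp: good_node_def)
  then show ?thesis
  proof cases
    case 1
    have "sz (D, x) \<le> Suc (n + (position_size n + 6))" using 1 n sz_good_position[OF 1(2) n] by simp
    then have s: "sz (children D x) \<le> q" unfolding q using pc poly_nat_mono order_trans by blast
    have "good_node n q c" if c: "c \<in> set (children D x)" for c
    proof -
      have "sz c \<le> q" using sz_mem[OF c] s by simp
      moreover have "c \<in> set (options D b)" using c 1 by (simp add: children_def)
      ultimately show ?thesis using good_choices[OF 1(2) n, of c] by (auto simp: good_node_def)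
    qed
    then show ?thesis using s by simp
  next
    case 2
    have "sz (D, x) \<le> Suc (n + Suc (Suc q))" using 2 n by simp
    then have "sz (children D x) \<le> poly pc (Suc (n + Suc (Suc q)))" using pc poly_nat_mono order_trans by blast
    moreover have "\<forall>c\<in>set (children D x). good_node n q c" using 2 by (auto simp: children_def good_node_def)
    ultimately show ?thesis by simp
  qed
qed

end

definition root :: "data \<Rightarrow> node" where
  "root d = (True, [start (item 2 d) (dnat (item 1 d))])"

text \<open>The size of the instance is a sufficient height by \<open>height_le\<close>, and it is
  available without reference to a structure or a formula.\<close>

definition holds :: "data \<Rightarrow> bool" where
  "holds d \<longleftrightarrow> evals (children (item 0 d)) (sz d) (root d) True"

lemma (in input) evals_root:
  assumes "s \<in> St M" "fm_over M \<phi>" "d = Lst [D, binary s, code_fm \<phi>]"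
  shows "evals (children (item 0 d)) (sz d) (root d) (sat M \<phi> s)"
proof -
  have "height \<phi> \<le> sz d" using height_le[OF assms(2)] assms(3) by simp
  from ev_mono[OF ev_sat[OF assms(2,1)] this] show ?thesis
    unfolding ev_def root_def using assms(3) by simp
qed

lemma holds_iff:
  assumes "rb_cgs M" "s \<in> St M" "fm_over M \<phi>"
  shows "holds (Lst [enc_cgs M, binary s, enc_fm unary (nres M) \<phi>]) \<longleftrightarrow> sat M \<phi> s"
proof -
  interpret input M by standard (rule assms)
  show ?thesis unfolding holds_def using evals_root[OF assms(2,3) refl] evals_unique by metis
qed

lemma ps_holds: "ps {d. ok_inst d} holds"
proof -
  from ps_size_UNIV[OF ps_children] obtain pc where "\<forall>p. sz (children (fst p) (snd p)) \<le> poly pc (sz p)" ..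
  then have pc: "sz (children D x) \<le> poly pc (sz (D, x))" for D x by (metis fst_conv snd_conv)
  define q where "q n = poly pc (Suc (n + (position_size n + 6)))" for n
  have polq: "pol q" unfolding q_def position_size_def endow_size_def
    by (intro pol_comp pol_Suc pol_add pol_mult pol_id pol_const)
  \<comment> \<open>The data determine the structure only up to values that the encoding ignores, so
    the invariant asks for some structure with this encoding.\<close>
  define G where "G d x \<longleftrightarrow> (\<exists>M. rb_cgs M \<and> item 0 d = enc_cgs M \<and> input.good_node M (sz d) (q (sz d)) x)" for d x
  show ?thesis
  proof (rule ps_evals[where ch = "\<lambda>d. children (item 0 d)" and r = root and n = sz and G = G and qn = "\<lambda>n. n"
        and qB = "\<lambda>n. q n + poly pc (Suc (n + Suc (Suc (q n))))"])
    show "ps UNIV (\<lambda>p. children (item 0 (fst p)) (snd p))"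
      by (rule ps_comp2[where f = children]) (intro ps_children ps_intros)+
    show "ps {d. ok_inst d} root" unfolding root_def by (intro ps_intros ps_start)
    show "pol (\<lambda>n. q n + poly pc (Suc (n + Suc (Suc (q n)))))"
      by (intro pol_add pol_comp pol_Suc pol_id polq)
    fix d assume "d \<in> {d. ok_inst d}"
    then obtain M s \<phi> where M: "rb_cgs M" "s \<in> St M" "fm_over M \<phi>" "d = Lst [enc_cgs M, binary s, enc_fm unary (nres M) \<phi>]"
      using ok_inst_iff by auto
    interpret input M by standard (rule M)
    show "evals (children (item 0 d)) (sz d) (root d) (holds d)"
      using evals_root[OF M(2,3,4)] holds_iff[OF M(1-3)] M(4) by simp
    have "good_position (sz d) (start (code_fm \<phi>) s)" using M by (intro good_start) auto
    then show "G d (root d)" unfolding G_def using M by (intro exI[of _ M]) (simp add: good_node_def root_def)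
  next
    fix d x assume "d \<in> {d. ok_inst d}" "G d x"
    then obtain M where M: "rb_cgs M" "item 0 d = enc_cgs M" "input.good_node M (sz d) (q (sz d)) x" by (auto simp: G_def)
    interpret input M by standard (rule M)
    have "sz D \<le> sz d" using sz_item[of 0 d] M(2) by simp
    from good_children[OF pc this M(3) q_def]
    show "sz (children (item 0 d) x) \<le> q (sz d) + poly pc (Suc (sz d + Suc (Suc (q (sz d))))) \<and>
        (\<forall>c\<in>set (children (item 0 d) x). G d c)"
      unfolding M(2) using M by (auto simp: G_def)
  qed auto
qed


section \<open>The machine\<close>

definition accepts :: "nat list \<Rightarrow> bool" where
  "accepts w \<longleftrightarrow> (if ok_inst (decode w) then holds (decode w) else False)"

lemma ps_accepts: "ps UNIV accepts"
proof -
  have "ps (UNIV \<inter> {w. ok_inst (decode w)}) (\<lambda>w. holds (decode w))"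
    by (rule ps_comp_on[OF _ ps_holds]) (intro ps_decode ps_id, simp)
  then show ?thesis unfolding accepts_def by (intro ps_if ps_ok_inst ps_decode ps_id ps_const)
qed

lemma accepts_iff: "accepts w \<longleftrightarrow> w \<in> model_checking unary"
proof
  assume a: "accepts w"
  then have "ok_inst (decode w)" by (simp add: accepts_def split: if_splits)
  then obtain M s \<phi> where M: "rb_cgs M" "s \<in> St M" "fm_over M \<phi>" "decode w = Lst [enc_cgs M, binary s, enc_fm unary (nres M) \<phi>]"
    using ok_inst_iff by auto
  then have "sat M \<phi> s" using a holds_iff[OF M(1-3)] by (simp add: accepts_def split: if_splits)
  then show "w \<in> model_checking unary" using M word_decode[OF M(4)] unfolding model_checking_def by blast
next
  assume "w \<in> model_checking unary"
  then obtain M s \<phi> where M: "rb_cgs M" "s \<in> St M" "fm_over M \<phi>" "sat M \<phi> s"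
    "w = word (Lst [enc_cgs M, binary s, enc_fm unary (nres M) \<phi>])"
    unfolding model_checking_def by blast
  have d: "decode w = Lst [enc_cgs M, binary s, enc_fm unary (nres M) \<phi>]" unfolding M(5) by (rule decode_word)
  moreover have "ok_inst (decode w)" unfolding ok_inst_iff using M d by blast
  ultimately show "accepts w" using holds_iff[OF M(1-3)] M(4) by (simp add: accepts_def)
qed

text \<open>The input is read from right to left and put on stack 1 as a list.\<close>

definition load :: com where
  "load = Seq (pushes [1]) (Seq (Loop 0 (\<lambda>g. g \<noteq> 0) (Move 0 Go_Right)) (Seq (Move 0 Go_Left)
     (Loop 0 (\<lambda>g. g \<noteq> 0) (Seq (Ite 0 (\<lambda>g. g = 1) (pushes (2 # ser (1::nat))) (Ite 0 (\<lambda>g. g = 2) (pushes (2 # ser (2::nat)))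
       (Ite 0 (\<lambda>g. g = 3) (pushes (2 # ser (3::nat))) (Ite 0 (\<lambda>g. g = 4) (pushes (2 # ser (4::nat))) (pushes (2 # ser (5::nat)))))))
       (Move 0 Go_Left)))))"

lemma wf_load: "wf_com load"
  by (simp add: load_def)

lemma exec_move_input:
  assumes "\<bar>h\<bar> \<le> int m" "\<bar>h'\<bar> \<le> int m" "fits m \<sigma>" "h' = (case mv of Go_Left \<Rightarrow> h - 1 | Stay \<Rightarrow> h | Go_Right \<Rightarrow> h + 1)"
  shows "exec m (Move 0 mv) (on_tapes (f, h) \<sigma>) (on_tapes (f, h') \<sigma>)"
proof (rule exec_Move)
  show "heads_within m (on_tapes (f, h) \<sigma>)" "heads_within m (on_tapes (f, h') \<sigma>)"
    using assms by (auto intro: heads_within_on_tapes)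
  show "on_tapes (f, h') \<sigma> = (on_tapes (f, h) \<sigma>)(0 := act_tape (on_tapes (f, h) \<sigma> 0) (read_tape (on_tapes (f, h) \<sigma> 0), mv))"
    using assms(4) by (auto simp: on_tapes_def fun_eq_iff)
qed

definition input_tape :: "nat list \<Rightarrow> int \<Rightarrow> nat" where
  "input_tape w i = (if 0 \<le> i \<and> i < int (length w) then w ! nat i else 0)"

text \<open>A symbol is below \<open>2 ^ 5\<close> and so has size at most 21; its list cell adds
  1.\<close>

lemma sz_symbols: "set w \<subseteq> {1..5} \<Longrightarrow> sz (w :: nat list) \<le> 22 * length w + 1"
proof (induction w)
  case (Cons g w)
  have "sz g \<le> 4 * 5 + 1" using Cons.prems by (intro sz_nat_less) (auto intro: le_less_trans[of _ 5])
  then show ?case using Cons by simp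
qed simp

lemma exec_load:
  assumes w: "set w \<subseteq> {1..5}" and m: "22 * length w + 1 \<le> m"
  shows "exec m load (on_tapes (input_tape w, 0) (\<lambda>_. [])) (on_tapes (input_tape w, -1) (stk (ser w)))"
proof -
  let ?f = "input_tape w" and ?n = "int (length w)"
  have m0: "length w \<le> m" "1 \<le> m" using m by auto
  have s: "length (ser (drop k w)) \<le> m" for k
    using sz_drop[of k w] sz_symbols[OF w] m by (simp add: sz_def)
  have f: "fits m (stk (ser (drop k w)))" for k by (intro fits_stk s)
  have fN: "fits m (stk [1])" using m0 by (intro fits_stk) simp
  have stk0: "(\<lambda>_. []) = stk []" by (auto simp: stk_def)
  have 1: "exec m (pushes [1]) (on_tapes (?f, 0) (\<lambda>_. [])) (on_tapes (?f, 0) (stk [1]))"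
    using sexec_pushes[of "[1]" "[]" m] m0 unfolding stk0 by (simp add: sexec_def)
  have nz: "?f (int k) \<noteq> 0 \<longleftrightarrow> k < length w" for k
  proof (cases "k < length w")
    case True
    then have "w ! k \<in> {1..5}" using w nth_mem by blast
    then show ?thesis using True by (auto simp: input_tape_def)
  qed (simp add: input_tape_def)
  have 2: "exec m (Loop 0 (\<lambda>g. g \<noteq> 0) (Move 0 Go_Right)) (on_tapes (?f, int k) (stk [1])) (on_tapes (?f, ?n) (stk [1]))"
    if "k \<le> length w" for k
    using that
  proof (induction k rule: inc_induct)
    case base
    show ?case using nz[of "length w"] fN m0
      by (intro exec_LoopF heads_within_on_tapes[OF fN]) (auto simp: on_tapes_def)
  next
    case (step k)
    have e: "exec m (Move 0 Go_Right) (on_tapes (?f, int k) (stk [1])) (on_tapes (?f, int (Suc k)) (stk [1]))"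
      using step.hyps m0 by (intro exec_move_input fN) auto
    have z: "read_tape (on_tapes (?f, int k) (stk [1]) 0) \<noteq> 0" using nz[of k] step.hyps by (simp add: on_tapes_def)
    show ?case by (rule exec_LoopT[OF _ _ e step.IH]) (simp, rule z)
  qed
  have 3: "exec m (Move 0 Go_Left) (on_tapes (?f, ?n) (stk [1])) (on_tapes (?f, ?n - 1) (stk [1]))"
    using m0 by (intro exec_move_input fN) auto
  let ?sel = "Ite 0 (\<lambda>g. g = 1) (pushes (2 # ser (1::nat))) (Ite 0 (\<lambda>g. g = 2) (pushes (2 # ser (2::nat)))
       (Ite 0 (\<lambda>g. g = 3) (pushes (2 # ser (3::nat))) (Ite 0 (\<lambda>g. g = 4) (pushes (2 # ser (4::nat))) (pushes (2 # ser (5::nat))))))"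
  let ?loop = "Loop 0 (\<lambda>g. g \<noteq> 0) (Seq ?sel (Move 0 Go_Left))"
  \<comment> \<open>With the head on cell \<open>k - 1\<close>, the suffix from position
    \<open>k\<close> on has been loaded. The loop ends on the blank cell -1, one step beyond the
    input.\<close>
  have 4: "exec m ?loop (on_tapes (?f, int k - 1) (stk (ser (drop k w)))) (on_tapes (?f, -1) (stk (ser w)))"
    if "k \<le> length w" for k
    using that
  proof (induction k)
    case 0
    have h: "heads_within m (on_tapes (?f, -1) (stk (ser w)))"
      using m0 f[of 0] by (intro heads_within_on_tapes[of m]) auto
    have z: "\<not> read_tape (on_tapes (?f, -1) (stk (ser w)) 0) \<noteq> 0" by (simp add: on_tapes_def input_tape_def)
    show ?case using exec_LoopF[OF _ h, of 0 "\<lambda>g. g \<noteq> 0", OF _ z] by simp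
  next
    case (Suc k)
    let ?g = "w ! k" and ?\<tau> = "on_tapes (?f, int k) (stk (ser (drop (Suc k) w)))"
    have d: "drop k w = ?g # drop (Suc k) w" using Suc.prems by (simp add: Cons_nth_drop_Suc)
    have r: "read_tape (?\<tau> 0) = ?g" using Suc.prems by (simp add: on_tapes_def input_tape_def)
    have "?g \<in> set w" using Suc.prems by simp
    then have g: "?g \<in> {1..5}" using w by blast
    have "sexec m (pushes (2 # ser ?g)) (stk (ser (drop (Suc k) w))) (stk ((2 # ser ?g) @ ser (drop (Suc k) w)))"
      using s[of k] by (intro sexec_pushes) (simp add: d)
    then have p: "exec m (pushes (2 # ser ?g)) ?\<tau> (on_tapes (?f, int k) (stk (ser (drop k w))))"
      using Suc.prems m0 by (simp add: sexec_def d)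
    have "?g = 1 \<or> ?g = 2 \<or> ?g = 3 \<or> ?g = 4 \<or> ?g = 5" using g by auto
    then have a: "exec m ?sel ?\<tau> (on_tapes (?f, int k) (stk (ser (drop k w))))"
      using p by (elim disjE) (intro exec_Ite; simp only: r; simp)+
    have b: "exec m (Move 0 Go_Left) (on_tapes (?f, int k) (stk (ser (drop k w)))) (on_tapes (?f, int k - 1) (stk (ser (drop k w))))"
      using Suc.prems m0 by (intro exec_move_input f) auto
    have c: "exec m ?loop (on_tapes (?f, int k - 1) (stk (ser (drop k w)))) (on_tapes (?f, -1) (stk (ser w)))"
      using Suc by simp
    have "read_tape (?\<tau> 0) \<noteq> 0" using r g by auto
    from exec_LoopT[OF _ this exec_Seq[OF a b] c] show ?case by simp
  qed
  show ?thesis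
    unfolding load_def using exec_Seq[OF 1 exec_Seq[OF _ exec_Seq[OF 3]]] 2[of 0] 4[of "length w"] by simp
qed

theorem theorem2p4: "model_checking unary \<in> PSPACE"
proof -
  obtain c p where c: "wf_com c" "\<And>w rest m. sz w + length rest \<le> m \<Longrightarrow>
       sexec (m + poly p (sz w)) c (stk (ser w @ rest)) (stk (ser (accepts w) @ rest))"
    using ps_accepts by (rule psE) auto
  let ?T = "compile (Seq load c)"
  \<comment> \<open>The polynomial \<open>22 * n + 1\<close> bounds the size of the loaded word, in
    terms of which the space of \<open>c\<close> is expressed.\<close>
  let ?b = "[:1, 22:] :: nat poly"
  let ?s = "?b + pcompose p ?b"
  have main: "(\<exists>t. fst (run ?T w t) = (if w \<in> model_checking unary then accept ?T else reject ?T)) \<and>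
      (\<forall>t. \<forall>(f, h)\<in>set (snd (run ?T w t)). \<bar>h\<bar> \<le> int (poly ?s (length w)))"
    if w: "w \<in> lists {1..5}" for w
  proof -
    have ws: "set w \<subseteq> {1..5}" using w by auto
    let ?m = "22 * length w + 1"
    let ?M = "?m + poly p ?m"
    have M: "poly ?s (length w) = ?M" by (simp add: poly_pcompose algebra_simps)
    have 1: "exec ?M load (on_tapes (input_tape w, 0) (\<lambda>_. [])) (on_tapes (input_tape w, -1) (stk (ser w)))"
      by (rule exec_load[OF ws]) simp
    have "sexec (?m + poly p (sz w)) c (stk (ser w)) (stk (ser (accepts w)))"
      using c(2)[of w "[]" ?m] sz_symbols[OF ws] by simp
    then have "sexec ?M c (stk (ser w)) (stk (ser (accepts w)))"
      by (rule sexec_mono) (use poly_nat_mono[OF sz_symbols[OF ws], of p] in simp)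
    then have 2: "exec ?M c (on_tapes (input_tape w, -1) (stk (ser w))) (on_tapes (input_tape w, -1) (stk (ser (accepts w))))"
      by (simp add: sexec_def)
    have init: "init_config ?T w = (0, map (on_tapes (input_tape w, 0) (\<lambda>_. [])) [0..<5])"
      by (auto simp: init_config_def compile_def on_tapes_def tape_of_def input_tape_def numeral_nat fun_eq_iff)
    have top: "read_tape (on_tapes (input_tape w, -1) (stk (ser (accepts w))) 1) = 2 \<longleftrightarrow> accepts w"
      by (cases "accepts w") (simp_all add: on_tapes_def stk_def read_tape_of)
    note run = exec_compile[OF exec_Seq[OF 1 2] init, unfolded top]
    show ?thesis unfolding M accepts_iff[symmetric] using run by blast
  qed
  have "turing_machine ?T" using c(1) wf_load by (intro turing_machine_compile) simp
  moreover have "5 < symbols ?T" by (simp add: compile_def)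
  moreover have "model_checking unary \<subseteq> lists {1..5}"
    using set_word by (fastforce simp: model_checking_def)
  moreover have "decides_in_space ?T 5 (model_checking unary) (poly ?s)"
    unfolding decides_in_space_def using main by blast
  ultimately show ?thesis unfolding PSPACE_def by blast
qed


end
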